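(* Let $\epsilon>0$ and $C>0$. There exist constants $c=c(C,\epsilon)>0$ and $X_0=X_0(C,\epsilon)$ such that the following holds. Let $q$ be a prime power, $n\ge2$ and $1\le b\le n/2$ integers, $M_1,M_2,A_1,A_2\in\mathbb{F}_q[T]$ with $M_1,M_2\ne0$, $M=\mathrm{lcm}(M_1,M_2)$, $\gcd(A_i,M)=1$ for $i=1,2$, and suppose that for $i=1,2$, \[ \deg M_i\le (1/2-\epsilon)b\quad\text{and}\quad P_j(M_i)\le C\frac{q^j}{j^{1+\epsilon}}\ \text{for all integers } j\ge1. \] Then, whenever $q^n\ge X_0$, \[ |M(2n;A_1,A_2,M_1,M_2)|\ \ge\ c\,\frac{1}{\Phi(M_1)\Phi(M_2)}\cdot\frac{q^{2n}}{n^{\delta}(1+\log n)^{3/2}}. \]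
   Context: $\mathbb{F}_q$ is the finite field with $q$ elements; $\mathcal{M}_k$ is the set of monic polynomials of degree $k$ in $\mathbb{F}_q[T]$. $M(2n;A_1,A_2,M_1,M_2)=\{G_1G_2: G_1,G_2\in\mathcal{M}_n,\ G_1\equiv A_1\bmod M_1,\ G_2\equiv A_2\bmod M_2\}$. For nonzero $M$, $\Phi(M)=\#\{A:\deg A<\deg M,\ \gcd(A,M)=1\}$ and $P_j(M)$ is the number of distinct monic irreducible divisors of $M$ of degree $j$. $\delta=1-\frac{1+\log\log 2}{\log 2}$, $\log$ natural logarithm. *)

theory Defs
  imports Complex_Main "HOL-Algebra.Polynomial_Divisibility" "HOL-Algebra.Weak_Morphisms"
begin

text \<open>
  Polynomials over a field \<open>F\<close> are the elements of \<^term>\<open>poly_ring F\<close>: coefficient lists with the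
  leading coefficient first, the zero polynomial being \<open>[]\<close>. Finite fields are given by explicit
  carriers, because constants that are uniform in \<open>q\<close> have to be quantified outside the field, and
  one cannot quantify over types there. Carriers inside \<^typ>\<open>nat\<close> suffice:
\<close>

lemma finite_field_iso_nat:
  assumes "field R" and "finite (carrier R)"
  shows "\<exists>F :: nat ring. field F \<and> finite (carrier F) \<and> is_ring_iso R F"
proof -
  interpret field R by fact
  obtain f :: "'a \<Rightarrow> nat" where f: "inj_on f (carrier R)"
    using finite_imp_inj_to_nat_seg[OF assms(2)] by blast
  have "field (image_ring f R)"
    by (rule inj_imp_image_ring_is_field[OF f])
  moreover have "finite (carrier (image_ring f R))"
    using assms(2) by (simp add: image_ring_carrier)
  moreover have "is_ring_iso R (image_ring f R)"
    using inj_imp_image_ring_iso[OF f] unfolding is_ring_iso_def by blast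
  ultimately show ?thesis by blast
qed

definition monic_polys :: "('a, 'b) ring_scheme \<Rightarrow> nat \<Rightarrow> 'a list set" where
  "monic_polys F k =
     {G \<in> carrier (poly_ring F). G \<noteq> [] \<and> lead_coeff G = \<one>\<^bsub>F\<^esub> \<and> Polynomials.degree G = k}"

definition poly_cong ::
    "('a, 'b) ring_scheme \<Rightarrow> 'a list \<Rightarrow> 'a list \<Rightarrow> 'a list \<Rightarrow> bool" where
  "poly_cong F G A M \<longleftrightarrow> M pdivides\<^bsub>F\<^esub> (G \<ominus>\<^bsub>poly_ring F\<^esub> A)"

definition poly_coprime :: "('a, 'b) ring_scheme \<Rightarrow> 'a list \<Rightarrow> 'a list \<Rightarrow> bool" where
  "poly_coprime F A B \<longleftrightarrow> \<one>\<^bsub>poly_ring F\<^esub> gcdof\<^bsub>poly_ring F\<^esub> A B"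

text \<open>The set \<open>M(2n; A\<^sub>1, A\<^sub>2, M\<^sub>1, M\<^sub>2)\<close>; the parameter \<open>n\<close> is the degree of each factor.\<close>

definition mult_table ::
    "('a, 'b) ring_scheme \<Rightarrow> nat \<Rightarrow> 'a list \<Rightarrow> 'a list \<Rightarrow> 'a list \<Rightarrow> 'a list \<Rightarrow> 'a list set" where
  "mult_table F n A1 A2 M1 M2 =
     {G1 \<otimes>\<^bsub>poly_ring F\<^esub> G2 | G1 G2.
        G1 \<in> monic_polys F n \<and> G2 \<in> monic_polys F n \<and>
        poly_cong F G1 A1 M1 \<and> poly_cong F G2 A2 M2}"

text \<open>
  \<^term>\<open>Polynomials.degree []\<close> is \<open>0\<close>, so \<open>deg 0 = -\<infinity>\<close> needs the disjunct \<open>A = []\<close>;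
  it gives \<open>\<Phi>(M) = 1\<close> for nonzero constants \<open>M\<close>.
\<close>

definition poly_phi :: "('a, 'b) ring_scheme \<Rightarrow> 'a list \<Rightarrow> nat" where
  "poly_phi F M =
     card {A \<in> carrier (poly_ring F).
       (A = [] \<or> Polynomials.degree A < Polynomials.degree M) \<and> poly_coprime F A M}"

definition num_irred_divisors :: "('a, 'b) ring_scheme \<Rightarrow> nat \<Rightarrow> 'a list \<Rightarrow> nat" where
  "num_irred_divisors F j M =
     card {P \<in> monic_polys F j. pirreducible\<^bsub>F\<^esub> (carrier F) P \<and> P pdivides\<^bsub>F\<^esub> M}"

definition ford_delta :: real where
  "ford_delta = 1 - (1 + ln (ln 2)) / ln 2"

end

(*
Consider products f = a X1 X2, where a is a product of J primes (J about log n / log 2) of degrees at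
most a small multiple of n, and X1, X2 are rough, that is, have only prime factors of degree at least a
fixed multiple of n. Such an f lies in the table as soon as some divisor d of a has a degree y for which
d X1 and (a/d) X2 have degree n and lie in the two residue classes. For each y among the degrees of
divisors of a, the Brun-Hooley sieve gives a positive proportion (of order 1/n) of rough X1, X2, and f has
boundedly many representations of this kind. It remains to bound from below the sum over a of
D(a) / q^(deg a), where D(a) is the number of degrees of divisors of a.

Distribute the J primes over dyadic blocks of degrees. The total mass of a block is log 2 up to a
summable error; here the hypothesis on P_j(M_i) is used, as primes dividing M_i are excluded. By a second
moment argument D(a) is on average at least 2^J / (2 S), where S depends only on the number of primes in
each block. As in the cycle lemma, rotating the blocks shows that the mean of 1/S over all distributions is
1 / (2 J), and the distributions in which deg a is too large or the error terms accumulate carry at most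
half of it. With Stirling's formula this gives (2 e log 2)^J / J^(3/2), and (2 e log 2)^J is of order
n^(2 - delta).
*)
theory Submission
  imports Defs "HOL-Library.FuncSet" "HOL-Library.Multiset" "HOL-Combinatorics.Multiset_Permutations"
begin

text \<open>Uniformity in \<open>q\<close> shapes the proof. After unique factorisation all counting
  takes place among multisets of abstract primes, with \<open>q ^ k\<close> multisets of each degree
  \<open>k\<close>; this already yields the prime counts, with bounds free of \<open>q\<close>.
  Residue classes and their multiples are counted exactly, so the sieve has no remainder as long as
  the degrees of its moduli stay in range. The classes modulo \<open>M1\<close> and
  \<open>M2\<close> have densities \<open>q ^ - degree M1\<close> and
  \<open>q ^ - degree M2\<close>, while the theorem speaks of \<open>\<Phi>\<close>. The hypothesis
  on the prime divisors is used a second time to see that \<open>\<Phi>(M)\<close> has the order of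
  \<open>q ^ degree M\<close>. There are as many primes as blocks. This makes the rotation work: a
  full turn gains \<open>2 ^ J\<close> from the primes and loses \<open>2 ^ J\<close> from the
  scales of the blocks. The first \<open>i0\<close> blocks are left out because their masses may be
  far from \<open>ln 2\<close>. For the boundedly many \<open>n\<close> for which no block is left,
  a product has at most \<open>2 ^ (2 * n)\<close> factorisations, a bound that is again uniform in
  \<open>q\<close>.\<close>

context field
begin

interpretation UP: principal_domain "poly_ring R"
  by (rule univ_poly_is_principal[OF carrier_is_subfield])

section \<open>Monic polynomials: degrees, normalisation, number\<close>

definition is_monic :: "'a list \<Rightarrow> bool" where
  "is_monic p \<longleftrightarrow> p \<in> carrier (poly_ring R) \<and> p \<noteq> [] \<and> lead_coeff p = \<one>"

lemma monic_polys_eq: "monic_polys R k = {p. is_monic p \<and> degree p = k}"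
  by (auto simp: monic_polys_def is_monic_def)

lemma is_monic_carrier: "is_monic p \<Longrightarrow> p \<in> carrier (poly_ring R)"
  by (simp add: is_monic_def)

lemma poly_ring_mult_degree:
  assumes "p \<in> carrier (poly_ring R)" "r \<in> carrier (poly_ring R)" "p \<noteq> []" "r \<noteq> []"
  shows "p \<otimes>\<^bsub>poly_ring R\<^esub> r \<noteq> []"
    and "degree (p \<otimes>\<^bsub>poly_ring R\<^esub> r) = degree p + degree r"
    and "lead_coeff (p \<otimes>\<^bsub>poly_ring R\<^esub> r) = lead_coeff p \<otimes> lead_coeff r"
  using assms poly_mult_degree_eq[OF carrier_is_subring, of p r] poly_mult_lead_coeff[OF carrier_is_subring, of p r]
    poly_mult_integral[OF carrier_is_subring, of p r]
  by (auto simp: univ_poly_carrier univ_poly_mult)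

lemma lead_coeff_carrier:
  assumes "p \<in> carrier (poly_ring R)" "p \<noteq> []"
  shows "lead_coeff p \<in> carrier R" "lead_coeff p \<noteq> \<zero>"
proof -
  have "polynomial (carrier R) p" using assms(1) by (simp add: univ_poly_carrier)
  then show "lead_coeff p \<in> carrier R" "lead_coeff p \<noteq> \<zero>"
    using assms(2) by (auto simp: polynomial_def)
qed

lemma is_monic_one: "is_monic [\<one>]"
  using UP.one_closed by (simp add: is_monic_def univ_poly_one)

lemma is_monic_mult:
  assumes "is_monic p" "is_monic r"
  shows "is_monic (p \<otimes>\<^bsub>poly_ring R\<^esub> r)" "degree (p \<otimes>\<^bsub>poly_ring R\<^esub> r) = degree p + degree r"
  using assms poly_ring_mult_degree[of p r] by (auto simp: is_monic_def)

lemma is_monic_mult_cancel: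
  assumes "is_monic p" "r \<in> carrier (poly_ring R)" "is_monic (p \<otimes>\<^bsub>poly_ring R\<^esub> r)"
  shows "is_monic r" "degree (p \<otimes>\<^bsub>poly_ring R\<^esub> r) = degree p + degree r"
proof -
  have "r \<noteq> []"
  proof
    assume "r = []"
    then have "p \<otimes>\<^bsub>poly_ring R\<^esub> r = []"
      using UP.r_null[OF is_monic_carrier[OF assms(1)]] by (simp add: univ_poly_zero)
    then show False using assms(3) by (simp add: is_monic_def)
  qed
  then show "is_monic r" "degree (p \<otimes>\<^bsub>poly_ring R\<^esub> r) = degree p + degree r"
    using assms poly_ring_mult_degree[of p r] lead_coeff_carrier[of r] by (auto simp: is_monic_def)
qed

lemma is_monic_add_small:
  assumes p: "is_monic p" and r: "r \<in> carrier (poly_ring R)" "r = [] \<or> degree r < degree p"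
  shows "is_monic (p \<oplus>\<^bsub>poly_ring R\<^esub> r)" "degree (p \<oplus>\<^bsub>poly_ring R\<^esub> r) = degree p"
proof -
  have "is_monic (p \<oplus>\<^bsub>poly_ring R\<^esub> r) \<and> degree (p \<oplus>\<^bsub>poly_ring R\<^esub> r) = degree p"
  proof (cases "r = []")
    case True
    then have "p \<oplus>\<^bsub>poly_ring R\<^esub> r = p"
      using UP.r_zero[OF is_monic_carrier[OF p]] by (simp add: univ_poly_zero)
    then show ?thesis using p by simp
  next
    case False
    then have lt: "degree r < degree p" using r by simp
    have pol: "polynomial (carrier R) p" "polynomial (carrier R) r"
      using p r by (auto simp: univ_poly_carrier is_monic_def)
    define s where "s = poly_add p r"
    have sp: "p \<oplus>\<^bsub>poly_ring R\<^esub> r = s" by (simp add: s_def univ_poly_add)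
    have deg: "degree s = degree p"
      unfolding s_def using poly_add_degree_eq[OF carrier_is_subring pol] lt by simp
    then have ne: "s \<noteq> []" using lt by auto
    have "lead_coeff s = coeff s (degree s)" by (rule lead_coeff_simp[OF ne, symmetric])
    also have "\<dots> = coeff p (degree p) \<oplus> coeff r (degree p)"
      unfolding deg using poly_add_coeff[of p r] polynomial_incl[OF pol(1)] polynomial_incl[OF pol(2)]
      by (simp add: s_def)
    also have "\<dots> = \<one>"
      using p lt coeff_degree[of r "degree p"] lead_coeff_simp[of p] by (simp add: is_monic_def)
    finally have "lead_coeff s = \<one>" .
    then show ?thesis
      using UP.a_closed[OF is_monic_carrier[OF p] r(1)] ne deg sp by (simp add: is_monic_def)
  qed
  then show "is_monic (p \<oplus>\<^bsub>poly_ring R\<^esub> r)" "degree (p \<oplus>\<^bsub>poly_ring R\<^esub> r) = degree p" by auto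
qed

lemma is_monic_degree_0: "is_monic p \<Longrightarrow> degree p = 0 \<Longrightarrow> p = [\<one>]"
  by (cases p) (auto simp: is_monic_def)

lemma units_iff_degree_0:
  assumes "p \<in> carrier (poly_ring R)" "p \<noteq> []"
  shows "p \<in> Units (poly_ring R) \<longleftrightarrow> degree p = 0"
proof
  assume "degree p = 0"
  then obtain k where "p = [k]" using assms(2) by (cases p) auto
  then show "p \<in> Units (poly_ring R)"
    using lead_coeff_carrier[OF assms] by (auto simp: univ_poly_carrier_units)
qed (auto simp: univ_poly_carrier_units)

lemma normalize_to_monic:
  assumes "p \<in> carrier (poly_ring R)" "p \<noteq> []"
  obtains c where "c \<in> Units (poly_ring R)" "is_monic (c \<otimes>\<^bsub>poly_ring R\<^esub> p)"
    "degree (c \<otimes>\<^bsub>poly_ring R\<^esub> p) = degree p"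
proof -
  define k where "k = inv (lead_coeff p)"
  have k: "k \<in> carrier R" "k \<noteq> \<zero>" "k \<otimes> lead_coeff p = \<one>"
    using lead_coeff_carrier[OF assms] subfield_m_inv[OF carrier_is_subfield, of "lead_coeff p"]
    by (auto simp: k_def)
  have c: "[k] \<in> Units (poly_ring R)" using k by (auto simp: univ_poly_carrier_units)
  have cc: "[k] \<in> carrier (poly_ring R)" using UP.Units_closed[OF c] .
  show thesis
    using that[OF c] poly_ring_mult_degree[OF cc assms(1) _ assms(2)] k UP.m_closed[OF cc assms(1)]
    by (simp add: is_monic_def)
qed

lemma card_monic_polys:
  assumes "finite (carrier R)"
  shows "finite (monic_polys R k)" "card (monic_polys R k) = card (carrier R) ^ k"
proof -
  have eq: "monic_polys R k = (\<lambda>as. \<one> # as) ` {as. set as \<subseteq> carrier R \<and> length as = k}"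
  proof (intro equalityI subsetI)
    fix p assume "p \<in> monic_polys R k"
    then have p: "p \<in> carrier (poly_ring R)" "p \<noteq> []" "lead_coeff p = \<one>" "degree p = k"
      by (auto simp: monic_polys_def)
    then have "set p \<subseteq> carrier R" by (auto simp: univ_poly_carrier[symmetric] polynomial_def)
    then show "p \<in> (\<lambda>as. \<one> # as) ` {as. set as \<subseteq> carrier R \<and> length as = k}"
      using p by (cases p) auto
  next
    fix p assume "p \<in> (\<lambda>as. \<one> # as) ` {as. set as \<subseteq> carrier R \<and> length as = k}"
    then show "p \<in> monic_polys R k"
      by (auto simp: monic_polys_def univ_poly_carrier[symmetric] polynomial_def)
  qed
  show "finite (monic_polys R k)" unfolding eq using assms by (simp add: finite_lists_length_eq)
  show "card (monic_polys R k) = card (carrier R) ^ k"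
    unfolding eq using assms by (subst card_image) (auto simp: card_lists_length_eq inj_on_def)
qed

section \<open>Unique factorisation into monic irreducibles\<close>

definition monic_irreducibles :: "'a list set" where
  "monic_irreducibles = {p. is_monic p \<and> pirreducible (carrier R) p}"

lemma monic_irreducibles_carrier: "monic_irreducibles \<subseteq> carrier (poly_ring R)"
  by (auto simp: monic_irreducibles_def is_monic_def)

lemma monic_irreducible_degree_pos:
  assumes "p \<in> monic_irreducibles"
  shows "degree p \<ge> 1"
proof -
  have p: "p \<in> carrier (poly_ring R)" "p \<noteq> []" "pirreducible (carrier R) p"
    using assms by (auto simp: monic_irreducibles_def is_monic_def)
  then have "p \<notin> Units (poly_ring R)" using pirreducibleE(2)[OF carrier_is_subring] by blast
  then have "degree p \<noteq> 0" using units_iff_degree_0[OF p(1,2)] by blast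
  then show ?thesis by simp
qed

text \<open>A monic divisor of least positive degree is irreducible: a proper factor of it, made
  monic, would be a smaller one.\<close>

lemma exists_monic_irreducible_factor:
  assumes f: "is_monic f" "degree f \<ge> 1"
  obtains p g where "p \<in> monic_irreducibles" "is_monic g" "f = p \<otimes>\<^bsub>poly_ring R\<^esub> g"
proof -
  define Q where "Q d \<longleftrightarrow> d \<ge> 1 \<and> (\<exists>p g. is_monic p \<and> is_monic g \<and> degree p = d \<and> f = p \<otimes>\<^bsub>poly_ring R\<^esub> g)" for d
  have "f = f \<otimes>\<^bsub>poly_ring R\<^esub> [\<one>]"
    using UP.r_one[OF is_monic_carrier[OF f(1)]] by (simp add: univ_poly_one)
  then have "Q (degree f)" using f is_monic_one by (auto simp: Q_def)
  then have Ql: "Q (LEAST d. Q d)" by (rule LeastI)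
  define d where "d = (LEAST d. Q d)"
  have Qd: "Q d" using Ql by (simp add: d_def)
  have minimal: "d \<le> d'" if "Q d'" for d' using Least_le[of Q d'] that by (simp add: d_def)
  obtain p g where pg: "is_monic p" "is_monic g" "degree p = d" "f = p \<otimes>\<^bsub>poly_ring R\<^esub> g" and d1: "d \<ge> 1"
    using Qd by (auto simp: Q_def)
  have pc: "p \<in> carrier (poly_ring R)" "p \<noteq> []" and gc: "g \<in> carrier (poly_ring R)"
    using pg by (auto simp: is_monic_def)
  have "pirreducible (carrier R) p"
  proof (rule pirreducibleI[OF carrier_is_subring pc])
    show "p \<notin> Units (poly_ring R)" using units_iff_degree_0[OF pc] pg d1 by simp
    fix s t assume st: "s \<in> carrier (poly_ring R)" "t \<in> carrier (poly_ring R)" "p = s \<otimes>\<^bsub>poly_ring R\<^esub> t"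
    have "s \<noteq> []"
    proof
      assume "s = []"
      then have "p = []" using st UP.l_null[OF st(2)] by (simp add: univ_poly_zero)
      then show False using pc by simp
    qed
    have "t \<noteq> []"
    proof
      assume "t = []"
      then have "p = []" using st UP.r_null[OF st(1)] by (simp add: univ_poly_zero)
      then show False using pc by simp
    qed
    have deg: "degree s + degree t = d"
      using poly_ring_mult_degree(2)[OF st(1,2) \<open>s \<noteq> []\<close> \<open>t \<noteq> []\<close>] st pg by simp
    show "s \<in> Units (poly_ring R) \<or> t \<in> Units (poly_ring R)"
    proof (rule ccontr)
      assume "\<not> (s \<in> Units (poly_ring R) \<or> t \<in> Units (poly_ring R))"
      then have "degree s \<noteq> 0" "degree t \<noteq> 0"
        using units_iff_degree_0 st \<open>s \<noteq> []\<close> \<open>t \<noteq> []\<close> by auto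
      then have s_deg: "degree s \<ge> 1" "degree s < d" using deg by auto
      obtain c where c: "c \<in> Units (poly_ring R)" "is_monic (c \<otimes>\<^bsub>poly_ring R\<^esub> s)"
        "degree (c \<otimes>\<^bsub>poly_ring R\<^esub> s) = degree s"
        using normalize_to_monic[OF st(1) \<open>s \<noteq> []\<close>] by blast
      obtain e where e: "e \<in> carrier (poly_ring R)" "c \<otimes>\<^bsub>poly_ring R\<^esub> e = \<one>\<^bsub>poly_ring R\<^esub>"
        using c(1) UP.Units_inv_closed UP.Units_r_inv by blast
      have cc: "c \<in> carrier (poly_ring R)" using c(1) by (rule UP.Units_closed)
      \<comment> \<open>The unit \<open>c\<close> that makes \<open>s\<close> monic is compensated
        in the cofactor by its inverse \<open>e\<close>.\<close>
      define u where "u = e \<otimes>\<^bsub>poly_ring R\<^esub> (t \<otimes>\<^bsub>poly_ring R\<^esub> g)"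
      have u: "u \<in> carrier (poly_ring R)" using e(1) st gc by (simp add: u_def)
      have "(c \<otimes>\<^bsub>poly_ring R\<^esub> s) \<otimes>\<^bsub>poly_ring R\<^esub> u = (c \<otimes>\<^bsub>poly_ring R\<^esub> e) \<otimes>\<^bsub>poly_ring R\<^esub> ((s \<otimes>\<^bsub>poly_ring R\<^esub> t) \<otimes>\<^bsub>poly_ring R\<^esub> g)"
        unfolding u_def using cc e(1) st(1,2) gc by (simp add: UP.m_ac)
      also have "\<dots> = f" using e st pg gc pc by simp
      finally have fu: "f = (c \<otimes>\<^bsub>poly_ring R\<^esub> s) \<otimes>\<^bsub>poly_ring R\<^esub> u" by simp
      then have "is_monic u" using is_monic_mult_cancel[OF c(2) u] f by simp
      then have "Q (degree s)" unfolding Q_def using c fu s_deg by blast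
      then show False using minimal s_deg by fastforce
    qed
  qed
  then show thesis using that pg by (auto simp: monic_irreducibles_def)
qed

text \<open>The product of a multiset of polynomials; by commutativity the order chosen by \<open>SOME\<close> is irrelevant.\<close>

definition mset_prod :: "'a list multiset \<Rightarrow> 'a list" where
  "mset_prod a = foldr (\<otimes>\<^bsub>poly_ring R\<^esub>) (SOME xs. mset xs = a) \<one>\<^bsub>poly_ring R\<^esub>"

lemma mset_prod_mset:
  assumes "set xs \<subseteq> carrier (poly_ring R)"
  shows "mset_prod (mset xs) = foldr (\<otimes>\<^bsub>poly_ring R\<^esub>) xs \<one>\<^bsub>poly_ring R\<^esub>"
proof -
  define ys where "ys = (SOME ys. mset ys = mset xs)"
  have "mset ys = mset xs" unfolding ys_def by (rule someI[of _ xs]) simp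
  moreover have "set ys \<subseteq> carrier (poly_ring R)"
    using assms calculation by (metis set_mset_mset)
  ultimately show ?thesis
    unfolding mset_prod_def ys_def[symmetric] by (intro UP.multlist_perm_cong) auto
qed

lemma mset_prod_empty: "mset_prod {#} = [\<one>]"
  using mset_prod_mset[of "[]"] by (simp add: univ_poly_one)

lemma mset_prod_add:
  assumes "set_mset (add_mset p a) \<subseteq> carrier (poly_ring R)"
  shows "mset_prod (add_mset p a) = p \<otimes>\<^bsub>poly_ring R\<^esub> mset_prod a"
proof -
  obtain xs where xs: "mset xs = a" using ex_mset by blast
  then have "set (p # xs) \<subseteq> carrier (poly_ring R)" using assms by auto
  then show ?thesis using mset_prod_mset[of xs] mset_prod_mset[of "p # xs"] xs by simp
qed

lemma mset_prod_closed: "set_mset a \<subseteq> carrier (poly_ring R) \<Longrightarrow> mset_prod a \<in> carrier (poly_ring R)"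
proof (induction a)
  case empty
  then show ?case using UP.one_closed by (simp add: mset_prod_empty univ_poly_one)
next
  case (add p a)
  then show ?case by (simp add: mset_prod_add)
qed

lemma mset_prod_union:
  assumes "set_mset a \<subseteq> carrier (poly_ring R)" "set_mset c \<subseteq> carrier (poly_ring R)"
  shows "mset_prod (a + c) = mset_prod a \<otimes>\<^bsub>poly_ring R\<^esub> mset_prod c"
  using assms(1)
proof (induction a)
  case empty
  then show ?case
    using UP.l_one[OF mset_prod_closed[OF assms(2)]] by (simp add: mset_prod_empty univ_poly_one)
next
  case (add p a)
  then show ?case
    using assms(2) mset_prod_closed[of a] mset_prod_closed[of c] by (simp add: mset_prod_add UP.m_assoc)
qed

lemma mset_prod_monic:
  assumes "set_mset a \<subseteq> monic_irreducibles"
  shows "is_monic (mset_prod a)" "degree (mset_prod a) = (\<Sum>p\<in>#a. degree p)"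
proof -
  have "is_monic (mset_prod a) \<and> degree (mset_prod a) = (\<Sum>p\<in>#a. degree p)"
    using assms
  proof (induction a)
    case empty
    then show ?case using is_monic_one by (simp add: mset_prod_empty)
  next
    case (add p a)
    have "set_mset (add_mset p a) \<subseteq> carrier (poly_ring R)" using add.prems monic_irreducibles_carrier by blast
    moreover have "is_monic p" using add.prems by (simp add: monic_irreducibles_def)
    ultimately show ?case using add is_monic_mult[of p "mset_prod a"] by (simp add: mset_prod_add)
  qed
  then show "is_monic (mset_prod a)" "degree (mset_prod a) = (\<Sum>p\<in>#a. degree p)" by auto
qed

lemma exists_mset_prod:
  assumes "is_monic f"
  shows "\<exists>a. set_mset a \<subseteq> monic_irreducibles \<and> mset_prod a = f"
  using assms
proof (induction "degree f" arbitrary: f rule: less_induct)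
  case less
  show ?case
  proof (cases "degree f = 0")
    case True
    then have "mset_prod {#} = f" using is_monic_degree_0[OF less.prems] by (simp add: mset_prod_empty)
    then show ?thesis by (intro exI[of _ "{#}"]) auto
  next
    case False
    then have "degree f \<ge> 1" by simp
    then obtain p g where pg: "p \<in> monic_irreducibles" "is_monic g" "f = p \<otimes>\<^bsub>poly_ring R\<^esub> g"
      using exists_monic_irreducible_factor[OF less.prems] by blast
    have "is_monic p" using pg by (simp add: monic_irreducibles_def)
    then have "degree g < degree f"
      using is_monic_mult(2)[of p g] pg monic_irreducible_degree_pos[OF pg(1)] by simp
    then obtain a where a: "set_mset a \<subseteq> monic_irreducibles" "mset_prod a = g" using less.hyps pg(2) by blast
    have "set_mset (add_mset p a) \<subseteq> monic_irreducibles" using a pg by simp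
    moreover from this have "mset_prod (add_mset p a) = f"
      using mset_prod_add[of p a] monic_irreducibles_carrier a pg by auto
    ultimately show ?thesis by blast
  qed
qed

text \<open>Irreducibles are prime here, so \<open>p\<close> divides some \<open>r\<close> in
  \<open>a\<close>; the cofactor is then a monic unit, hence one.\<close>

lemma monic_irreducible_divides_mset_prod:
  assumes p: "p \<in> monic_irreducibles" and a: "set_mset a \<subseteq> monic_irreducibles" and d: "p pdivides mset_prod a"
  shows "p \<in># a"
  using a d
proof (induction a)
  case empty
  have "degree p \<le> degree [\<one>]"
    using pdivides_imp_degree_le[OF carrier_is_subring, of p "[\<one>]"] empty p monic_irreducibles_carrier
      is_monic_carrier[OF is_monic_one] by (auto simp: mset_prod_empty)
  then show ?case using monic_irreducible_degree_pos[OF p] by simp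
next
  case (add r a)
  have carr: "set_mset (add_mset r a) \<subseteq> carrier (poly_ring R)" using add.prems monic_irreducibles_carrier by blast
  have pc: "p \<in> carrier (poly_ring R)" using p monic_irreducibles_carrier by blast
  have prime: "pprime (carrier R) p"
    using pprime_iff_pirreducible[OF carrier_is_subfield pc] p by (simp add: monic_irreducibles_def)
  have "p pdivides r \<otimes>\<^bsub>poly_ring R\<^esub> mset_prod a"
    using add.prems(2) mset_prod_add[OF carr] by simp
  then consider "p pdivides r" | "p pdivides mset_prod a"
    using pprimeE(3)[OF carrier_is_subfield pc prime, of r "mset_prod a"] carr mset_prod_closed[of a] by auto
  then show ?case
  proof cases
    case 1
    have r: "is_monic r" "pirreducible (carrier R) r" "r \<in> carrier (poly_ring R)"
      using add.prems carr by (auto simp: monic_irreducibles_def)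
    obtain u where u: "u \<in> carrier (poly_ring R)" "r = p \<otimes>\<^bsub>poly_ring R\<^esub> u"
      using 1 unfolding pdivides_def factor_def by blast
    have pm: "is_monic p" using p by (simp add: monic_irreducibles_def)
    have um: "is_monic u" using is_monic_mult_cancel(1)[OF pm u(1)] r u by simp
    have "p \<notin> Units (poly_ring R)"
      using p pirreducibleE(2)[OF carrier_is_subring pc] by (simp add: monic_irreducibles_def)
    then have "u \<in> Units (poly_ring R)"
      using pirreducibleE(3)[OF carrier_is_subring r(3,2) pc u(1) u(2)] by blast
    then have "u = [\<one>]"
      using um units_iff_degree_0[OF u(1)] is_monic_degree_0 by (auto simp: is_monic_def)
    then have "r = p" using u UP.r_one[OF pc] by (simp add: univ_poly_one)
    then show ?thesis by simp
  next
    case 2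
    then show ?thesis using add by simp
  qed
qed

lemma mset_prod_inj:
  assumes "set_mset a \<subseteq> monic_irreducibles" "set_mset c \<subseteq> monic_irreducibles" "mset_prod a = mset_prod c"
  shows "a = c"
  using assms
proof (induction a arbitrary: c)
  case empty
  then have "mset_prod c = [\<one>]" by (simp add: mset_prod_empty)
  then have "(\<Sum>p\<in>#c. degree p) = 0"
    using mset_prod_monic(2)[OF empty(2)] by simp
  then have "degree p = 0" if "p \<in># c" for p using that by (auto dest: multi_member_split)
  then have "\<not> p \<in># c" for p using empty(2) monic_irreducible_degree_pos[of p] by force
  then show ?case by (metis multiset_nonemptyE)
next
  case (add p a)
  have carr: "set_mset (add_mset p a) \<subseteq> carrier (poly_ring R)" using add.prems monic_irreducibles_carrier by blast
  have pa: "mset_prod (add_mset p a) = p \<otimes>\<^bsub>poly_ring R\<^esub> mset_prod a" by (rule mset_prod_add[OF carr])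
  have "p pdivides mset_prod c"
    unfolding pdivides_def factor_def using pa add.prems(3) mset_prod_closed[of a] carr by auto
  then have "p \<in># c" using monic_irreducible_divides_mset_prod[of p c] add.prems by simp
  then obtain c' where c: "c = add_mset p c'" by (auto dest: multi_member_split)
  have carr': "set_mset (add_mset p c') \<subseteq> carrier (poly_ring R)" using add.prems c monic_irreducibles_carrier by blast
  have "p \<noteq> \<zero>\<^bsub>poly_ring R\<^esub>"
    using add.prems by (auto simp: monic_irreducibles_def is_monic_def univ_poly_zero)
  moreover have "p \<otimes>\<^bsub>poly_ring R\<^esub> mset_prod a = p \<otimes>\<^bsub>poly_ring R\<^esub> mset_prod c'"
    using add.prems(3) pa mset_prod_add[OF carr'] c by simp
  ultimately have "mset_prod a = mset_prod c'"
    using UP.m_lcancel[of p "mset_prod a" "mset_prod c'"] carr carr' mset_prod_closed[of a] mset_prod_closed[of c'] by auto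
  then have "a = c'" using add.IH[of c'] add.prems c by simp
  then show ?case by (simp add: c)
qed

text \<open>Carries the count of monic polynomials over to multisets. It supplies
  \<open>card_of_degree\<close> for the abstract setting in which all counting is done.\<close>

lemma bij_betw_mset_prod:
  "bij_betw mset_prod {a. set_mset a \<subseteq> monic_irreducibles \<and> (\<Sum>p\<in>#a. degree p) = k} (monic_polys R k)"
  unfolding bij_betw_def
proof
  show "inj_on mset_prod {a. set_mset a \<subseteq> monic_irreducibles \<and> (\<Sum>p\<in>#a. degree p) = k}"
    using mset_prod_inj by (intro inj_onI) auto
  show "mset_prod ` {a. set_mset a \<subseteq> monic_irreducibles \<and> (\<Sum>p\<in>#a. degree p) = k} = monic_polys R k"
  proof (intro equalityI subsetI)
    fix f assume "f \<in> monic_polys R k"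
    then have f: "is_monic f" "degree f = k" by (auto simp: monic_polys_eq)
    then obtain a where "set_mset a \<subseteq> monic_irreducibles" "mset_prod a = f" using exists_mset_prod by blast
    then show "f \<in> mset_prod ` {a. set_mset a \<subseteq> monic_irreducibles \<and> (\<Sum>p\<in>#a. degree p) = k}"
      using f mset_prod_monic(2)[of a] by auto
  next
    fix f assume "f \<in> mset_prod ` {a. set_mset a \<subseteq> monic_irreducibles \<and> (\<Sum>p\<in>#a. degree p) = k}"
    then obtain a where a: "set_mset a \<subseteq> monic_irreducibles" "(\<Sum>p\<in>#a. degree p) = k" "f = mset_prod a" by blast
    show "f \<in> monic_polys R k"
      unfolding monic_polys_eq a(3) using mset_prod_monic[OF a(1)] a(2) by blast
  qed
qed

section \<open>Divisibility, coprimality and residue classes\<close>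

lemma pdivides_trans:
  assumes "p \<in> carrier (poly_ring R)" "p pdivides r" "r pdivides s"
  shows "p pdivides s"
  using assms UP.divides_trans unfolding pdivides_def by blast

lemma pdivides_add:
  assumes "p \<in> carrier (poly_ring R)" "r \<in> carrier (poly_ring R)" "s \<in> carrier (poly_ring R)"
    and "p pdivides r" "p pdivides s"
  shows "p pdivides (r \<oplus>\<^bsub>poly_ring R\<^esub> s)"
proof -
  obtain u v where uv: "u \<in> carrier (poly_ring R)" "v \<in> carrier (poly_ring R)"
    "r = p \<otimes>\<^bsub>poly_ring R\<^esub> u" "s = p \<otimes>\<^bsub>poly_ring R\<^esub> v"
    using assms unfolding pdivides_def factor_def by blast
  then have "r \<oplus>\<^bsub>poly_ring R\<^esub> s = p \<otimes>\<^bsub>poly_ring R\<^esub> (u \<oplus>\<^bsub>poly_ring R\<^esub> v)"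
    using assms by (simp add: UP.r_distr)
  then show ?thesis using uv unfolding pdivides_def factor_def by auto
qed

lemma pdivides_uminus:
  assumes "p \<in> carrier (poly_ring R)" "r \<in> carrier (poly_ring R)" "p pdivides r"
  shows "p pdivides (\<ominus>\<^bsub>poly_ring R\<^esub> r)"
proof -
  obtain u where u: "u \<in> carrier (poly_ring R)" "r = p \<otimes>\<^bsub>poly_ring R\<^esub> u"
    using assms unfolding pdivides_def factor_def by blast
  then have "\<ominus>\<^bsub>poly_ring R\<^esub> r = p \<otimes>\<^bsub>poly_ring R\<^esub> (\<ominus>\<^bsub>poly_ring R\<^esub> u)"
    using assms by (simp add: UP.r_minus)
  then show ?thesis using u unfolding pdivides_def factor_def by auto
qed

lemma pdivides_mult:
  assumes "p \<in> carrier (poly_ring R)" "r \<in> carrier (poly_ring R)" "s \<in> carrier (poly_ring R)" "p pdivides r"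
  shows "p pdivides (s \<otimes>\<^bsub>poly_ring R\<^esub> r)"
proof -
  obtain u where u: "u \<in> carrier (poly_ring R)" "r = p \<otimes>\<^bsub>poly_ring R\<^esub> u"
    using assms unfolding pdivides_def factor_def by blast
  then have "s \<otimes>\<^bsub>poly_ring R\<^esub> r = p \<otimes>\<^bsub>poly_ring R\<^esub> (s \<otimes>\<^bsub>poly_ring R\<^esub> u)"
    using assms by (simp add: UP.m_lcomm)
  then show ?thesis using u assms unfolding pdivides_def factor_def by auto
qed

text \<open>A modulus need not be monic. Replacing it by its monic associate changes no divisibility
  on either side and makes unique factorisation applicable.\<close>

lemma monic_associate:
  assumes "M \<in> carrier (poly_ring R)" "M \<noteq> []"
  obtains M' where "is_monic M'" "degree M' = degree M"
    "\<And>f. f \<in> carrier (poly_ring R) \<Longrightarrow> M' pdivides f \<longleftrightarrow> M pdivides f"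
    "\<And>f. f \<in> carrier (poly_ring R) \<Longrightarrow> f pdivides M' \<longleftrightarrow> f pdivides M"
proof -
  obtain c where c: "c \<in> Units (poly_ring R)" "is_monic (c \<otimes>\<^bsub>poly_ring R\<^esub> M)"
    "degree (c \<otimes>\<^bsub>poly_ring R\<^esub> M) = degree M"
    using normalize_to_monic[OF assms] by blast
  define M' where "M' = c \<otimes>\<^bsub>poly_ring R\<^esub> M"
  have cc: "c \<in> carrier (poly_ring R)" using c(1) by (rule UP.Units_closed)
  obtain e where e: "e \<in> carrier (poly_ring R)" "e \<otimes>\<^bsub>poly_ring R\<^esub> c = \<one>\<^bsub>poly_ring R\<^esub>"
    using c(1) UP.Units_inv_closed UP.Units_l_inv by blast
  have M': "M' \<in> carrier (poly_ring R)" using cc assms by (simp add: M'_def)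
  have "M' = M \<otimes>\<^bsub>poly_ring R\<^esub> c" using cc assms by (simp add: M'_def UP.m_comm)
  then have d1: "M pdivides M'" using cc unfolding pdivides_def factor_def by blast
  have "M = M' \<otimes>\<^bsub>poly_ring R\<^esub> e"
  proof -
    have "M' \<otimes>\<^bsub>poly_ring R\<^esub> e = (e \<otimes>\<^bsub>poly_ring R\<^esub> c) \<otimes>\<^bsub>poly_ring R\<^esub> M"
      unfolding M'_def using cc e(1) assms(1) by (simp add: UP.m_ac)
    then show ?thesis using e assms by simp
  qed
  then have d2: "M' pdivides M" using e unfolding pdivides_def factor_def by blast
  show thesis
  proof (rule that[of M'])
    show "is_monic M'" "degree M' = degree M" using c by (auto simp: M'_def)
    fix f assume f: "f \<in> carrier (poly_ring R)"
    show "M' pdivides f \<longleftrightarrow> M pdivides f" using pdivides_trans d1 d2 M' assms by blast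
    show "f pdivides M' \<longleftrightarrow> f pdivides M" using pdivides_trans d1 d2 f by blast
  qed
qed

text \<open>A common divisor of positive degree has a monic associate, and that has an irreducible
  factor. The gcd is thereby replaced by a condition on primes, which unique factorisation can
  handle.\<close>

lemma poly_coprime_iff:
  assumes A: "A \<in> carrier (poly_ring R)" and M: "M \<in> carrier (poly_ring R)" "M \<noteq> []"
  shows "poly_coprime R A M \<longleftrightarrow> (\<forall>p\<in>monic_irreducibles. \<not> (p pdivides A \<and> p pdivides M))"
proof
  assume cop: "poly_coprime R A M"
  show "\<forall>p\<in>monic_irreducibles. \<not> (p pdivides A \<and> p pdivides M)"
  proof (intro ballI notI)
    fix p assume p: "p \<in> monic_irreducibles" "p pdivides A \<and> p pdivides M"
    have pc: "p \<in> carrier (poly_ring R)" using p monic_irreducibles_carrier by blast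
    have "p pdivides [\<one>]"
      using cop p pc unfolding poly_coprime_def isgcd_def pdivides_def by (simp add: univ_poly_one)
    then have "degree p \<le> degree [\<one>]"
      using pdivides_imp_degree_le[OF carrier_is_subring pc is_monic_carrier[OF is_monic_one]] by simp
    then show False using monic_irreducible_degree_pos[OF p(1)] by simp
  qed
next
  assume none: "\<forall>p\<in>monic_irreducibles. \<not> (p pdivides A \<and> p pdivides M)"
  show "poly_coprime R A M"
    unfolding poly_coprime_def isgcd_def
  proof (intro conjI ballI impI)
    show "\<one>\<^bsub>poly_ring R\<^esub> divides\<^bsub>poly_ring R\<^esub> A" "\<one>\<^bsub>poly_ring R\<^esub> divides\<^bsub>poly_ring R\<^esub> M"
      using UP.unit_divides[OF UP.Units_one_closed] A M by blast+
    fix y assume y: "y \<in> carrier (poly_ring R)"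
      and dv: "y divides\<^bsub>poly_ring R\<^esub> A \<and> y divides\<^bsub>poly_ring R\<^esub> M"
    have y0: "y \<noteq> []"
      using dv M zero_pdivides unfolding pdivides_def by blast
    have "degree y = 0"
    proof (rule ccontr)
      assume "degree y \<noteq> 0"
      obtain y' where y': "is_monic y'" "degree y' = degree y"
        "\<And>f. f \<in> carrier (poly_ring R) \<Longrightarrow> f pdivides y' \<longleftrightarrow> f pdivides y"
        using monic_associate[OF y y0] by metis
      then have "degree y' \<ge> 1" using \<open>degree y \<noteq> 0\<close> by simp
      then obtain p g where pg: "p \<in> monic_irreducibles" "is_monic g" "y' = p \<otimes>\<^bsub>poly_ring R\<^esub> g"
        using exists_monic_irreducible_factor[OF y'(1)] by blast
      have pc: "p \<in> carrier (poly_ring R)" using pg monic_irreducibles_carrier by blast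
      have "p pdivides y'" using pg is_monic_carrier unfolding pdivides_def factor_def by blast
      then have "p pdivides y" using y'(3) pc by blast
      then have "p pdivides A" "p pdivides M" using dv pdivides_trans[OF pc] unfolding pdivides_def by blast+
      then show False using none pg by blast
    qed
    then have "y \<in> Units (poly_ring R)" using units_iff_degree_0[OF y y0] by blast
    then show "y divides\<^bsub>poly_ring R\<^esub> \<one>\<^bsub>poly_ring R\<^esub>" by (rule UP.unit_divides[OF _ UP.one_closed])
  qed
qed

text \<open>Long division by the monic associate \<open>M'\<close>: the class consists of all
  \<open>M' * u + r\<close> with one fixed remainder \<open>r\<close> and \<open>u\<close> monic of
  degree \<open>k - degree M\<close>. For \<open>k = degree M\<close> it has a single element; the
  bound for \<open>poly_phi\<close> rests on this case.\<close>

lemma card_monic_residue_class: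
  assumes fin: "finite (carrier R)" and M: "M \<in> carrier (poly_ring R)" "M \<noteq> []"
    and B: "B \<in> carrier (poly_ring R)" and k: "degree M \<le> k"
  shows "card {h \<in> monic_polys R k. poly_cong R h B M} = card (carrier R) ^ (k - degree M)"
proof -
  obtain M' where M': "is_monic M'" "degree M' = degree M"
    "\<And>f. f \<in> carrier (poly_ring R) \<Longrightarrow> M' pdivides f \<longleftrightarrow> M pdivides f"
    using monic_associate[OF M] by metis
  have M'c: "M' \<in> carrier (poly_ring R)" "M' \<noteq> []" using M' by (auto simp: is_monic_def)
  define r where "r = B pmod M'"
  have r: "r \<in> carrier (poly_ring R)" "r = [] \<or> degree r < degree M'"
    using long_division_closed(2)[OF carrier_is_subfield B M'c(1)] pmod_degree[OF carrier_is_subfield B M'c]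
    by (auto simp: r_def)
  have cong_iff: "poly_cong R h B M \<longleftrightarrow> h pmod M' = r" if "h \<in> carrier (poly_ring R)" for h
    unfolding poly_cong_def r_def using same_pmod_iff_pdivides[OF carrier_is_subfield that B M'c(1)] M'(3) that B by simp
  have "bij_betw (\<lambda>u. (M' \<otimes>\<^bsub>poly_ring R\<^esub> u) \<oplus>\<^bsub>poly_ring R\<^esub> r) (monic_polys R (k - degree M)) {h \<in> monic_polys R k. poly_cong R h B M}"
    unfolding bij_betw_def
  proof
    have ld: "(u, r) = (((M' \<otimes>\<^bsub>poly_ring R\<^esub> u) \<oplus>\<^bsub>poly_ring R\<^esub> r) pdiv M', ((M' \<otimes>\<^bsub>poly_ring R\<^esub> u) \<oplus>\<^bsub>poly_ring R\<^esub> r) pmod M')"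
      if "u \<in> carrier (poly_ring R)" for u
      by (rule long_divisionI[OF carrier_is_subfield _ M'c]) (use that r M'c in \<open>auto intro!: long_dividesI\<close>)
    show "inj_on (\<lambda>u. (M' \<otimes>\<^bsub>poly_ring R\<^esub> u) \<oplus>\<^bsub>poly_ring R\<^esub> r) (monic_polys R (k - degree M))"
    proof (rule inj_onI)
      fix u v assume uv: "u \<in> monic_polys R (k - degree M)" "v \<in> monic_polys R (k - degree M)"
        "(M' \<otimes>\<^bsub>poly_ring R\<^esub> u) \<oplus>\<^bsub>poly_ring R\<^esub> r = (M' \<otimes>\<^bsub>poly_ring R\<^esub> v) \<oplus>\<^bsub>poly_ring R\<^esub> r"
      then have "u \<in> carrier (poly_ring R)" "v \<in> carrier (poly_ring R)" by (auto simp: monic_polys_def)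
      then show "u = v" using ld[of u] ld[of v] uv(3) by (metis Pair_inject)
    qed
    show "(\<lambda>u. (M' \<otimes>\<^bsub>poly_ring R\<^esub> u) \<oplus>\<^bsub>poly_ring R\<^esub> r) ` monic_polys R (k - degree M) = {h \<in> monic_polys R k. poly_cong R h B M}"
    proof (intro equalityI subsetI)
      fix h assume "h \<in> (\<lambda>u. (M' \<otimes>\<^bsub>poly_ring R\<^esub> u) \<oplus>\<^bsub>poly_ring R\<^esub> r) ` monic_polys R (k - degree M)"
      then obtain u where u: "is_monic u" "degree u = k - degree M" "h = (M' \<otimes>\<^bsub>poly_ring R\<^esub> u) \<oplus>\<^bsub>poly_ring R\<^esub> r"
        unfolding monic_polys_eq by blast
      have m: "is_monic (M' \<otimes>\<^bsub>poly_ring R\<^esub> u)" "degree (M' \<otimes>\<^bsub>poly_ring R\<^esub> u) = k"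
        using is_monic_mult[OF M'(1) u(1)] u(2) M'(2) k by auto
      have "r = [] \<or> degree r < degree (M' \<otimes>\<^bsub>poly_ring R\<^esub> u)"
        using r(2) m(2) M'(2) k by linarith
      then have "is_monic h" "degree h = k"
        using is_monic_add_small[OF m(1) r(1)] m(2) u(3) by blast+
      moreover have "h pmod M' = r" using ld[OF is_monic_carrier[OF u(1)]] u(3) by simp
      ultimately show "h \<in> {h \<in> monic_polys R k. poly_cong R h B M}"
        using cong_iff[OF is_monic_carrier[of h]] unfolding monic_polys_eq by blast
    next
      fix h assume "h \<in> {h \<in> monic_polys R k. poly_cong R h B M}"
      then have h: "is_monic h" "degree h = k" "poly_cong R h B M" unfolding monic_polys_eq by blast+
      then have hr: "h pmod M' = r" using cong_iff[OF is_monic_carrier] by blast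
      define u where "u = h pdiv M'"
      have u: "u \<in> carrier (poly_ring R)"
        unfolding u_def using long_division_closed(1)[OF carrier_is_subfield is_monic_carrier[OF h(1)] M'c(1)] .
      have hu: "h = (M' \<otimes>\<^bsub>poly_ring R\<^esub> u) \<oplus>\<^bsub>poly_ring R\<^esub> r"
        using pdiv_pmod[OF carrier_is_subfield is_monic_carrier[OF h(1)] M'c(1)] hr by (simp only: u_def)
      have Mu: "M' \<otimes>\<^bsub>poly_ring R\<^esub> u \<in> carrier (poly_ring R)" using M'c u by simp
      have mr: "\<ominus>\<^bsub>poly_ring R\<^esub> r \<in> carrier (poly_ring R)" using r by simp
      have small: "\<ominus>\<^bsub>poly_ring R\<^esub> r = [] \<or> degree (\<ominus>\<^bsub>poly_ring R\<^esub> r) < degree h"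
      proof (cases "r = []")
        case True
        then show ?thesis using UP.minus_zero by (simp add: univ_poly_zero)
      next
        case False
        then have "degree r < degree h" using r(2) M'(2) k h(2) by linarith
        moreover have "degree (\<ominus>\<^bsub>poly_ring R\<^esub> r) = degree r"
          using univ_poly_a_inv_def'[OF carrier_is_subring r(1)] by simp
        ultimately show ?thesis by simp
      qed
      have "h \<oplus>\<^bsub>poly_ring R\<^esub> (\<ominus>\<^bsub>poly_ring R\<^esub> r) = M' \<otimes>\<^bsub>poly_ring R\<^esub> u"
        unfolding hu using Mu r(1) by (simp add: UP.a_assoc UP.r_neg)
      then have m: "is_monic (M' \<otimes>\<^bsub>poly_ring R\<^esub> u)" "degree (M' \<otimes>\<^bsub>poly_ring R\<^esub> u) = k"
        using is_monic_add_small[OF h(1) mr small] h(2) by (simp_all only:)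
      have "is_monic u" "degree u = k - degree M"
        using is_monic_mult_cancel[OF M'(1) u m(1)] m(2) M'(2) by auto
      then show "h \<in> (\<lambda>u. (M' \<otimes>\<^bsub>poly_ring R\<^esub> u) \<oplus>\<^bsub>poly_ring R\<^esub> r) ` monic_polys R (k - degree M)"
        using hu unfolding monic_polys_eq by blast
    qed
  qed
  from bij_betw_same_card[OF this] show ?thesis using card_monic_polys(2)[OF fin, of "k - degree M"] by (simp only:)
qed

text \<open>Bezout: if \<open>x * G + y * M\<close> is one, then \<open>x\<close> inverts
  \<open>G\<close> modulo \<open>M\<close>, and \<open>B = x * A\<close> is the class
  sought.\<close>

lemma poly_cong_solve:
  assumes G: "G \<in> carrier (poly_ring R)" and A: "A \<in> carrier (poly_ring R)" and M: "M \<in> carrier (poly_ring R)"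
    and cop: "poly_coprime R G M"
  obtains B where "B \<in> carrier (poly_ring R)"
    "\<And>h. h \<in> carrier (poly_ring R) \<Longrightarrow> poly_cong R (G \<otimes>\<^bsub>poly_ring R\<^esub> h) A M \<longleftrightarrow> poly_cong R h B M"
proof -
  have "PIdl\<^bsub>poly_ring R\<^esub> \<one>\<^bsub>poly_ring R\<^esub> = PIdl\<^bsub>poly_ring R\<^esub> G <+>\<^bsub>poly_ring R\<^esub> PIdl\<^bsub>poly_ring R\<^esub> M"
    using UP.ideal_sum_iff_gcd[OF G M UP.one_closed] cop by (simp add: poly_coprime_def)
  then have "\<one>\<^bsub>poly_ring R\<^esub> \<in> PIdl\<^bsub>poly_ring R\<^esub> G <+>\<^bsub>poly_ring R\<^esub> PIdl\<^bsub>poly_ring R\<^esub> M"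
    using UP.cgenideal_self[OF UP.one_closed] by simp
  then obtain x y where xy: "x \<in> carrier (poly_ring R)" "y \<in> carrier (poly_ring R)"
    "\<one>\<^bsub>poly_ring R\<^esub> = (x \<otimes>\<^bsub>poly_ring R\<^esub> G) \<oplus>\<^bsub>poly_ring R\<^esub> (y \<otimes>\<^bsub>poly_ring R\<^esub> M)"
    unfolding set_add_def' cgenideal_def by blast
  have dvM: "M pdivides (s \<otimes>\<^bsub>poly_ring R\<^esub> M)" if "s \<in> carrier (poly_ring R)" for s
    using pdivides_mult[OF M M that] UP.divides_refl[OF M] by (simp add: pdivides_def)
  show thesis
  proof (rule that)
    show "x \<otimes>\<^bsub>poly_ring R\<^esub> A \<in> carrier (poly_ring R)" using xy A by simp
    fix h assume h: "h \<in> carrier (poly_ring R)"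
    show "poly_cong R (G \<otimes>\<^bsub>poly_ring R\<^esub> h) A M \<longleftrightarrow> poly_cong R h (x \<otimes>\<^bsub>poly_ring R\<^esub> A) M"
      unfolding poly_cong_def
    proof
      assume d: "M pdivides (G \<otimes>\<^bsub>poly_ring R\<^esub> h \<ominus>\<^bsub>poly_ring R\<^esub> A)"
      have "h \<ominus>\<^bsub>poly_ring R\<^esub> (x \<otimes>\<^bsub>poly_ring R\<^esub> A)
          = (h \<otimes>\<^bsub>poly_ring R\<^esub> ((x \<otimes>\<^bsub>poly_ring R\<^esub> G) \<oplus>\<^bsub>poly_ring R\<^esub> (y \<otimes>\<^bsub>poly_ring R\<^esub> M))) \<ominus>\<^bsub>poly_ring R\<^esub> (x \<otimes>\<^bsub>poly_ring R\<^esub> A)"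
        using h by (simp add: xy(3)[symmetric])
      also have "\<dots> = (x \<otimes>\<^bsub>poly_ring R\<^esub> (G \<otimes>\<^bsub>poly_ring R\<^esub> h \<ominus>\<^bsub>poly_ring R\<^esub> A)) \<oplus>\<^bsub>poly_ring R\<^esub> ((h \<otimes>\<^bsub>poly_ring R\<^esub> y) \<otimes>\<^bsub>poly_ring R\<^esub> M)"
        using h A G M xy(1,2) by algebra
      finally show "M pdivides (h \<ominus>\<^bsub>poly_ring R\<^esub> (x \<otimes>\<^bsub>poly_ring R\<^esub> A))"
        using pdivides_add[OF M _ _ pdivides_mult[OF M _ xy(1) d] dvM] h A G M xy(1,2) by simp
    next
      assume d: "M pdivides (h \<ominus>\<^bsub>poly_ring R\<^esub> (x \<otimes>\<^bsub>poly_ring R\<^esub> A))"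
      have "G \<otimes>\<^bsub>poly_ring R\<^esub> h \<ominus>\<^bsub>poly_ring R\<^esub> A
          = G \<otimes>\<^bsub>poly_ring R\<^esub> h \<ominus>\<^bsub>poly_ring R\<^esub> (((x \<otimes>\<^bsub>poly_ring R\<^esub> G) \<oplus>\<^bsub>poly_ring R\<^esub> (y \<otimes>\<^bsub>poly_ring R\<^esub> M)) \<otimes>\<^bsub>poly_ring R\<^esub> A)"
        using A by (simp add: xy(3)[symmetric])
      also have "\<dots> = (G \<otimes>\<^bsub>poly_ring R\<^esub> (h \<ominus>\<^bsub>poly_ring R\<^esub> (x \<otimes>\<^bsub>poly_ring R\<^esub> A))) \<oplus>\<^bsub>poly_ring R\<^esub> ((\<ominus>\<^bsub>poly_ring R\<^esub> (y \<otimes>\<^bsub>poly_ring R\<^esub> A)) \<otimes>\<^bsub>poly_ring R\<^esub> M)"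
        using h A G M xy(1,2) by algebra
      finally show "M pdivides (G \<otimes>\<^bsub>poly_ring R\<^esub> h \<ominus>\<^bsub>poly_ring R\<^esub> A)"
        using pdivides_add[OF M _ _ pdivides_mult[OF M _ G d] dvM] h A G M xy(1,2) by simp
    qed
  qed
qed

end

section \<open>Averaging over placements by rotating the bins\<close>

text \<open>A placement \<open>f\<close> puts the \<open>l\<close>-th of \<open>J\<close> primes into the block \<open>f l\<close> of primes of degree about
  \<open>2 ^ f l\<close>; its crowding bounds the number of coincidences among the degrees of subproducts.\<close>

definition placements :: "nat \<Rightarrow> (nat \<Rightarrow> nat) set" where
  "placements J = {..<J} \<rightarrow>\<^sub>E {..<J}"

definition num_below :: "nat \<Rightarrow> (nat \<Rightarrow> nat) \<Rightarrow> nat \<Rightarrow> nat" where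
  "num_below J f i = card {l\<in>{..<J}. f l \<le> i}"

definition crowding :: "nat \<Rightarrow> (nat \<Rightarrow> nat) \<Rightarrow> real" where
  "crowding J f = (\<Sum>i<J. 2 ^ num_below J f i / 2 ^ i)"

text \<open>Bin \<open>Suc s\<close> becomes bin \<open>0\<close> and bin \<open>s\<close> the last
  one. For \<open>s < J\<close>, adding \<open>J\<close> first keeps the subtraction of naturals
  from truncating.\<close>

definition rotate_bins :: "nat \<Rightarrow> nat \<Rightarrow> (nat \<Rightarrow> nat) \<Rightarrow> nat \<Rightarrow> nat" where
  "rotate_bins J s f = (\<lambda>l\<in>{..<J}. (f l + J - Suc s) mod J)"

lemma finite_placements: "finite (placements J)"
  by (auto simp: placements_def intro!: finite_PiE)

lemma card_placements: "card (placements J) = J ^ J"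
  by (simp add: placements_def card_PiE)

lemma placements_less: "f \<in> placements J \<Longrightarrow> l < J \<Longrightarrow> f l < J"
  by (auto simp: placements_def PiE_iff)

lemma placements_upd: "f \<in> placements J \<Longrightarrow> l < J \<Longrightarrow> i < J \<Longrightarrow> f(l := i) \<in> placements J"
  by (auto simp: placements_def PiE_iff extensional_def)

lemma rotate_bins_apply:
  assumes "f \<in> placements J" "s < J" "l < J"
  shows "rotate_bins J s f l = (if f l \<le> s then f l + J - Suc s else f l - Suc s)"
proof -
  have fl: "f l < J" using assms placements_less by blast
  show ?thesis
  proof (cases "f l \<le> s")
    case True
    then have "f l + J - Suc s < J" using assms by linarith
    then show ?thesis using True assms by (simp add: rotate_bins_def)
  next
    case False
    then have "f l + J - Suc s = (f l - Suc s) + J" by simp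
    moreover have "f l - Suc s < J" using fl by simp
    ultimately have "(f l + J - Suc s) mod J = f l - Suc s" by (metis mod_add_self2 mod_less)
    then show ?thesis using False assms by (simp add: rotate_bins_def)
  qed
qed

lemma rotate_bins_in_placements:
  assumes "f \<in> placements J" "s < J"
  shows "rotate_bins J s f \<in> placements J"
  using assms by (auto simp: placements_def rotate_bins_def)

lemma bij_rotate_bins:
  assumes "s < J"
  shows "bij_betw (rotate_bins J s) (placements J) (placements J)"
proof -
  have inj: "inj_on (rotate_bins J s) (placements J)"
  proof (rule inj_onI)
    fix f g assume fg: "f \<in> placements J" "g \<in> placements J"
      and eq: "rotate_bins J s f = rotate_bins J s g"
    have "f l = g l" if l: "l < J" for l
    proof -
      have "(if f l \<le> s then f l + J - Suc s else f l - Suc s)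
          = (if g l \<le> s then g l + J - Suc s else g l - Suc s)"
        using rotate_bins_apply[OF fg(1) assms l] rotate_bins_apply[OF fg(2) assms l] eq by simp
      then show ?thesis
        using placements_less[OF fg(1) l] placements_less[OF fg(2) l] assms
        by (auto split: if_splits)
    qed
    then show "f = g"
      using fg unfolding placements_def by (intro PiE_ext[of f _ _ g]) auto
  qed
  moreover have "rotate_bins J s ` placements J \<subseteq> placements J"
    using rotate_bins_in_placements[OF _ assms] by auto
  ultimately show ?thesis
    unfolding bij_betw_def using endo_inj_surj[OF finite_placements] by blast
qed

text \<open>The rotated bins \<open>0..i\<close> are the old bins from \<open>s + 1\<close> to
  \<open>s + 1 + i\<close>, read cyclically; a window that wraps around counts all \<open>J\<close>
  primes once more. The term \<open>num_below J f s\<close> stands on the left to avoid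
  subtraction.\<close>

lemma num_below_rotate:
  assumes f: "f \<in> placements J" and s: "s < J" and i: "i < J"
  shows "num_below J (rotate_bins J s f) i + num_below J f s =
     (if s + 1 + i < J then num_below J f (s + 1 + i) else J + num_below J f (s + 1 + i - J))"
proof (cases "s + 1 + i < J")
  case True
  have "{l\<in>{..<J}. rotate_bins J s f l \<le> i} \<union> {l\<in>{..<J}. f l \<le> s} = {l\<in>{..<J}. f l \<le> s + 1 + i}"
    using rotate_bins_apply[OF f s] True by (auto split: if_splits)
  moreover have "{l\<in>{..<J}. rotate_bins J s f l \<le> i} \<inter> {l\<in>{..<J}. f l \<le> s} = {}"
    using rotate_bins_apply[OF f s] True by (auto split: if_splits)
  ultimately have "card {l\<in>{..<J}. rotate_bins J s f l \<le> i} + card {l\<in>{..<J}. f l \<le> s}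
      = card {l\<in>{..<J}. f l \<le> s + 1 + i}"
    using card_Un_disjoint[of "{l\<in>{..<J}. rotate_bins J s f l \<le> i}" "{l\<in>{..<J}. f l \<le> s}"] by simp
  then show ?thesis using True by (simp add: num_below_def)
next
  case False
  have e1: "{l\<in>{..<J}. rotate_bins J s f l \<le> i} = {l\<in>{..<J}. \<not> f l \<le> s} \<union> {l\<in>{..<J}. f l \<le> s + 1 + i - J}"
  proof -
    have "rotate_bins J s f l \<le> i \<longleftrightarrow> \<not> f l \<le> s \<or> f l \<le> s + 1 + i - J" if l: "l < J" for l
      using rotate_bins_apply[OF f s l] False i s placements_less[OF f l]
      by (cases "f l \<le> s") (simp_all, linarith+)
    then show ?thesis by auto
  qed
  have e2: "card {l\<in>{..<J}. rotate_bins J s f l \<le> i}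
     = card {l\<in>{..<J}. \<not> f l \<le> s} + card {l\<in>{..<J}. f l \<le> s + 1 + i - J}"
    unfolding e1 using i False by (intro card_Un_disjoint) auto
  have "card {l\<in>{..<J}. \<not> f l \<le> s} + card {l\<in>{..<J}. f l \<le> s}
      = card ({l\<in>{..<J}. \<not> f l \<le> s} \<union> {l\<in>{..<J}. f l \<le> s})"
    by (rule card_Un_disjoint[symmetric]) auto
  also have "{l\<in>{..<J}. \<not> f l \<le> s} \<union> {l\<in>{..<J}. f l \<le> s} = {..<J}" by blast
  finally have "card {l\<in>{..<J}. \<not> f l \<le> s} + card {l\<in>{..<J}. f l \<le> s} = J" by simp
  then show ?thesis using False e2 by (simp add: num_below_def)
qed

lemma crowding_pos: "J > 0 \<Longrightarrow> crowding J f > 0"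
  unfolding crowding_def by (rule sum_pos) auto

text \<open>Continued beyond one turn, the summand \<open>w\<close> is periodic: a turn adds
  \<open>J\<close> both to the exponent in the numerator and to that in the denominator. So the
  rotation merely shifts the summands and rescales all of them by \<open>2 / w s\<close>.\<close>

lemma crowding_rotate:
  assumes f: "f \<in> placements J" and s: "s < J"
  shows "crowding J (rotate_bins J s f) = 2 * crowding J f / (2 ^ num_below J f s / 2 ^ s)"
proof -
  define w :: "nat \<Rightarrow> real" where "w j = 2 ^ num_below J f j / 2 ^ j" for j
  define shift where "shift i = (if s + 1 + i < J then s + 1 + i else s + 1 + i - J)" for i
  have tm: "2 ^ num_below J (rotate_bins J s f) i / 2 ^ i = 2 / w s * w (shift i)" if i: "i < J" for i
  proof (cases "s + 1 + i < J")
    case True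
    then have "(2::real) ^ num_below J (rotate_bins J s f) i * 2 ^ num_below J f s = 2 ^ num_below J f (s + 1 + i)"
      using num_below_rotate[OF f s i] by (metis power_add)
    then show ?thesis
      using True by (simp add: w_def shift_def power_add field_simps)
  next
    case False
    have a: "(2::real) ^ num_below J (rotate_bins J s f) i * 2 ^ num_below J f s = 2 ^ J * 2 ^ num_below J f (s + 1 + i - J)"
      using num_below_rotate[OF f s i] False by (metis power_add)
    have "s + 1 + i - J + J = s + 1 + i" using False by simp
    then have b: "(2::real) ^ (s + 1 + i - J) * 2 ^ J = 2 * 2 ^ s * 2 ^ i"
      by (metis (no_types, opaque_lifting) mult.commute power_add power_one_right)
    have c: "2 ^ num_below J (rotate_bins J s f) i = (2 ^ J * 2 ^ num_below J f (s + 1 + i - J)) / (2::real) ^ num_below J f s"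
      using a by (simp add: field_simps)
    have d: "(2::real) ^ J = 2 * 2 ^ s * 2 ^ i / 2 ^ (s + 1 + i - J)"
      using b by (simp add: field_simps)
    show ?thesis
      unfolding w_def shift_def c d using False by (simp add: field_simps)
  qed
  have "(\<Sum>i<J. w (shift i)) = (\<Sum>j<J. w j)"
    by (rule sum.reindex_bij_witness[of _ "\<lambda>j. if j \<le> s then j + J - Suc s else j - Suc s" shift])
      (use s in \<open>auto simp: shift_def split: if_splits\<close>)
  then have "crowding J (rotate_bins J s f) = 2 / w s * (\<Sum>j<J. w j)"
    unfolding crowding_def using tm by (simp add: sum_distrib_left[symmetric] del: times_divide_eq_left)
  then show ?thesis by (simp add: crowding_def w_def)
qed

text \<open>Over the \<open>J\<close> rotations of the bins the numbers \<open>1 / crowding\<close> add up to exactly \<open>1 / 2\<close>.\<close>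

lemma sum_inverse_crowding:
  assumes "J > 0"
  shows "(\<Sum>f\<in>placements J. 1 / crowding J f) = real J ^ J / (2 * real J)"
proof -
  have "real J * (\<Sum>f\<in>placements J. 1 / crowding J f) = (\<Sum>s<J. \<Sum>f\<in>placements J. 1 / crowding J f)"
    by simp
  also have "\<dots> = (\<Sum>s<J. \<Sum>f\<in>placements J. 1 / crowding J (rotate_bins J s f))"
    by (intro sum.cong refl sum.reindex_bij_betw[OF bij_rotate_bins, symmetric]) auto
  also have "\<dots> = (\<Sum>f\<in>placements J. \<Sum>s<J. 1 / crowding J (rotate_bins J s f))"
    by (rule sum.swap)
  also have "\<dots> = (\<Sum>f\<in>placements J. 1 / 2)"
  proof (intro sum.cong refl)
    fix f assume f: "f \<in> placements J"
    have "(\<Sum>s<J. 1 / crowding J (rotate_bins J s f)) = (\<Sum>s<J. (2 ^ num_below J f s / 2 ^ s) / (2 * crowding J f))"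
      by (intro sum.cong refl) (use crowding_rotate[OF f] in auto)
    also have "\<dots> = crowding J f / (2 * crowding J f)"
      unfolding crowding_def by (simp add: sum_divide_distrib)
    also have "\<dots> = 1 / 2" using crowding_pos[OF assms, of f] by simp
    finally show "(\<Sum>s<J. 1 / crowding J (rotate_bins J s f)) = 1 / 2" .
  qed
  finally show ?thesis using assms by (simp add: card_placements field_simps)
qed

text \<open>Moving one prime raises each \<open>num_below\<close> by at most one. So the crowding
  depends only mildly on the position of a single prime.\<close>

lemma crowding_upd_le: "crowding J (f(l := i)) \<le> 2 * crowding J f"
proof -
  have "num_below J (f(l := i)) k \<le> Suc (num_below J f k)" for k
  proof -
    have "{l'\<in>{..<J}. (f(l := i)) l' \<le> k} \<subseteq> insert l {l'\<in>{..<J}. f l' \<le> k}" by auto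
    then have "card {l'\<in>{..<J}. (f(l := i)) l' \<le> k} \<le> card (insert l {l'\<in>{..<J}. f l' \<le> k})"
      by (intro card_mono) auto
    also have "\<dots> \<le> Suc (card {l'\<in>{..<J}. f l' \<le> k})"
      by (simp add: card_insert_if)
    finally show ?thesis by (simp add: num_below_def)
  qed
  then have "(2::real) ^ num_below J (f(l := i)) k \<le> 2 ^ Suc (num_below J f k)" for k
    by (intro power_increasing) auto
  then have "(2::real) ^ num_below J (f(l := i)) k / 2 ^ k \<le> 2 * (2 ^ num_below J f k / 2 ^ k)" for k
    by (simp add: field_simps)
  then show ?thesis
    unfolding crowding_def sum_distrib_left by (intro sum_mono)
qed

text \<open>Under the weight \<open>1 / crowding\<close>, a given prime lies in a given bin with
  probability at most \<open>2 / J\<close>, twice the uniform value: its position is resampled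
  uniformly, at the cost of the factor 2 from \<open>crowding_upd_le\<close>.\<close>

lemma sum_weight_crowding_le:
  fixes \<tau> :: "nat \<Rightarrow> real"
  assumes J: "J > 0" and \<tau>: "\<And>i. \<tau> i \<ge> 0"
  shows "(\<Sum>f\<in>placements J. (\<Sum>l<J. \<tau> (f l)) / crowding J f)
      \<le> 2 * (\<Sum>i<J. \<tau> i) * (\<Sum>f\<in>placements J. 1 / crowding J f)"
proof -
  let ?P = "placements J" and ?S = "crowding J"
  have one: "real J * (\<Sum>f\<in>?P. \<tau> (f l) / ?S f) \<le> 2 * (\<Sum>i<J. \<tau> i) * (\<Sum>f\<in>?P. 1 / ?S f)"
    if l: "l < J" for l
  proof -
    have "real J * (\<Sum>f\<in>?P. \<tau> (f l) / ?S f) = (\<Sum>f\<in>?P. \<Sum>i<J. \<tau> (f l) / ?S f)"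
      by (simp add: sum_distrib_left)
    also have "\<dots> \<le> (\<Sum>f\<in>?P. \<Sum>i<J. 2 * (\<tau> (f l) / ?S (f(l := i))))"
    proof (intro sum_mono)
      fix f i
      have "?S (f(l := i)) \<le> 2 * ?S f" by (rule crowding_upd_le)
      then have "1 / ?S f \<le> 2 / ?S (f(l := i))"
        using crowding_pos[OF J, of f] crowding_pos[OF J, of "f(l := i)"] by (simp add: field_simps)
      then have "\<tau> (f l) * (1 / ?S f) \<le> \<tau> (f l) * (2 / ?S (f(l := i)))"
        using \<tau> by (intro mult_left_mono) auto
      then show "\<tau> (f l) / ?S f \<le> 2 * (\<tau> (f l) / ?S (f(l := i)))" by (simp add: field_simps)
    qed
    also have "\<dots> = (\<Sum>(f, i)\<in>?P \<times> {..<J}. 2 * (\<tau> (f l) / ?S (f(l := i))))"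
      by (rule sum.cartesian_product)
    \<comment> \<open>The reindexing is an involution that exchanges the old and the new position of
      the prime \<open>l\<close>. Afterwards \<open>\<tau>\<close> and the crowding depend on
      separate variables.\<close>
    also have "\<dots> = (\<Sum>(g, i)\<in>?P \<times> {..<J}. 2 * (\<tau> i / ?S g))"
      by (rule sum.reindex_bij_witness[of _ "\<lambda>(g, i). (g(l := i), g l)" "\<lambda>(f, i). (f(l := i), f l)"])
        (auto simp: l placements_upd placements_less)
    also have "\<dots> = (\<Sum>g\<in>?P. \<Sum>i<J. 2 * (\<tau> i / ?S g))"
      by (rule sum.cartesian_product[symmetric])
    also have "\<dots> = (\<Sum>g\<in>?P. 2 * (\<Sum>i<J. \<tau> i) * (1 / ?S g))"
      by (intro sum.cong refl) (simp add: sum_distrib_left sum_divide_distrib)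
    also have "\<dots> = 2 * (\<Sum>i<J. \<tau> i) * (\<Sum>f\<in>?P. 1 / ?S f)"
      by (rule sum_distrib_left[symmetric])
    finally show ?thesis .
  qed
  have "real J * (\<Sum>f\<in>?P. (\<Sum>l<J. \<tau> (f l)) / ?S f) = (\<Sum>l<J. real J * (\<Sum>f\<in>?P. \<tau> (f l) / ?S f))"
    by (simp add: sum_divide_distrib sum_distrib_left sum.swap[of _ ?P])
  also have "\<dots> \<le> (\<Sum>l<J. 2 * (\<Sum>i<J. \<tau> i) * (\<Sum>f\<in>?P. 1 / ?S f))"
    by (intro sum_mono one) auto
  finally show ?thesis using J by simp
qed

text \<open>Markov's inequality for the weight \<open>1 / crowding\<close>: the mean of the sum of
  \<open>\<tau>\<close> is at most \<open>2 * 2\<close>, so the placements with a sum above 8 carry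
  at most half of the total weight.\<close>

lemma sum_light_inverse_crowding:
  fixes \<tau> :: "nat \<Rightarrow> real"
  assumes J: "J > 0" and \<tau>: "\<And>i. \<tau> i \<ge> 0" and K: "(\<Sum>i<J. \<tau> i) \<le> 2"
  shows "(\<Sum>f\<in>{f\<in>placements J. (\<Sum>l<J. \<tau> (f l)) \<le> 8}. 1 / crowding J f) \<ge> real J ^ J / (4 * real J)"
proof -
  let ?P = "placements J" and ?S = "crowding J" and ?T = "\<lambda>f. \<Sum>l<J. \<tau> (f l)"
  have Spos: "?S f > 0" for f using crowding_pos[OF J] .
  have T0: "?T f \<ge> 0" for f using \<tau> by (simp add: sum_nonneg)
  have "(\<Sum>f\<in>?P. 1 / ?S f) \<le> (\<Sum>f\<in>?P. (if ?T f \<le> 8 then 1 / ?S f else 0) + (?T f / 8) / ?S f)"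
  proof (intro sum_mono)
    fix f
    show "1 / ?S f \<le> (if ?T f \<le> 8 then 1 / ?S f else 0) + (?T f / 8) / ?S f"
      using Spos[of f] T0[of f] by (auto simp: divide_right_mono field_simps)
  qed
  also have "\<dots> = (\<Sum>f\<in>{f\<in>?P. ?T f \<le> 8}. 1 / ?S f) + (\<Sum>f\<in>?P. ?T f / ?S f) / 8"
    by (simp add: sum.distrib sum.inter_filter[OF finite_placements] sum_divide_distrib mult.commute)
  also have "(\<Sum>f\<in>?P. ?T f / ?S f) \<le> 2 * 2 * (\<Sum>f\<in>?P. 1 / ?S f)"
  proof (rule order_trans[OF sum_weight_crowding_le[OF J \<tau>]])
    show "2 * sum \<tau> {..<J} * (\<Sum>f\<in>?P. 1 / ?S f) \<le> 2 * 2 * (\<Sum>f\<in>?P. 1 / ?S f)"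
      using K Spos by (intro mult_right_mono sum_nonneg) (auto simp: less_imp_le)
  qed
  finally show ?thesis using sum_inverse_crowding[OF J] by (simp add: field_simps)
qed

section \<open>Truncated inclusion-exclusion\<close>

definition esym :: "'a set \<Rightarrow> nat \<Rightarrow> ('a \<Rightarrow> real) \<Rightarrow> real" where
  "esym A s x = (\<Sum>U | U \<subseteq> A \<and> card U = s. \<Prod>P\<in>U. x P)"

text \<open>Bonferroni's truncation of the expanded product of all \<open>1 - x P\<close>. Real
  weights allow it to be evaluated both at indicators of divisibility and at densities.\<close>

definition truncated_sieve :: "'a set \<Rightarrow> nat \<Rightarrow> ('a \<Rightarrow> real) \<Rightarrow> real" where
  "truncated_sieve A r x = (\<Sum>U | U \<subseteq> A \<and> card U \<le> r. (-1) ^ card U * (\<Prod>P\<in>U. x P))"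

lemma esym_0: "finite A \<Longrightarrow> esym A 0 x = 1"
proof -
  assume "finite A"
  then have "{U. U \<subseteq> A \<and> card U = 0} = {{}}"
    by (auto dest: finite_subset)
  then show ?thesis by (simp add: esym_def)
qed

lemma esym_empty_Suc: "esym {} (Suc s) x = 0"
proof -
  have "{U::'a set. U \<subseteq> {} \<and> card U = Suc s} = {}" by auto
  then show ?thesis unfolding esym_def by (simp only: sum.empty)
qed

lemma esym_insert:
  assumes "finite A" "a \<notin> A"
  shows "esym (insert a A) (Suc s) x = esym A (Suc s) x + x a * esym A s x"
proof -
  let ?B = "{U. U \<subseteq> A \<and> card U = Suc s}" and ?C = "{U. U \<subseteq> A \<and> card U = s}"
  have fin: "finite ?B" "finite ?C" using assms(1) by auto
  have split: "{U. U \<subseteq> insert a A \<and> card U = Suc s} = ?B \<union> insert a ` ?C"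
  proof (intro equalityI subsetI)
    fix U assume U: "U \<in> {U. U \<subseteq> insert a A \<and> card U = Suc s}"
    show "U \<in> ?B \<union> insert a ` ?C"
    proof (cases "a \<in> U")
      case True
      then have "U = insert a (U - {a})" "U - {a} \<subseteq> A" "card (U - {a}) = s"
        using U by auto
      then show ?thesis by blast
    next
      case False
      then show ?thesis using U by auto
    qed
  next
    fix U assume "U \<in> ?B \<union> insert a ` ?C"
    then consider "U \<in> ?B" | V where "V \<in> ?C" "U = insert a V" by blast
    then show "U \<in> {U. U \<subseteq> insert a A \<and> card U = Suc s}"
    proof cases
      case 2
      then have "finite V" "a \<notin> V" using assms finite_subset by auto
      then show ?thesis using 2 by auto
    qed auto
  qed
  have inj: "inj_on (insert a) ?C"
    using assms(2) by (intro inj_onI) (auto dest: insert_ident[THEN iffD1, rotated 2])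
  have "esym (insert a A) (Suc s) x = (\<Sum>U\<in>?B. \<Prod>P\<in>U. x P) + (\<Sum>U\<in>insert a ` ?C. \<Prod>P\<in>U. x P)"
    unfolding esym_def split using fin assms(2) by (intro sum.union_disjoint) auto
  also have "(\<Sum>U\<in>insert a ` ?C. \<Prod>P\<in>U. x P) = (\<Sum>U\<in>?C. \<Prod>P\<in>insert a U. x P)"
    by (simp add: sum.reindex[OF inj])
  also have "\<dots> = (\<Sum>U\<in>?C. x a * (\<Prod>P\<in>U. x P))"
  proof (intro sum.cong refl)
    fix U assume "U \<in> ?C"
    then have "finite U" "a \<notin> U" using assms finite_subset by auto
    then show "(\<Prod>P\<in>insert a U. x P) = x a * (\<Prod>P\<in>U. x P)" by simp
  qed
  finally show ?thesis by (simp add: esym_def sum_distrib_left)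
qed

text \<open>Each product of \<open>s\<close> distinct factors occurs \<open>fact s\<close> times in
  the expanded power. The induction gets by with the first two terms of the binomial expansion,
  \<open>pw\<close>.\<close>

lemma esym_le_power:
  assumes "finite A" "\<And>P. P \<in> A \<Longrightarrow> x P \<ge> 0"
  shows "esym A s x \<le> (\<Sum>P\<in>A. x P) ^ s / fact s"
  using assms
proof (induction A arbitrary: s rule: finite_induct)
  case empty
  then show ?case by (cases s) (auto simp: esym_0 esym_empty_Suc)
next
  case (insert a A)
  define L where "L = (\<Sum>P\<in>A. x P)"
  have L0: "L \<ge> 0" and a0: "x a \<ge> 0" using insert by (auto simp: L_def intro: sum_nonneg)
  show ?case
  proof (cases s)
    case 0
    then show ?thesis using insert by (simp add: esym_0)
  next
    case (Suc k)
    have pw: "L ^ Suc m + real (Suc m) * x a * L ^ m \<le> (L + x a) ^ Suc m" for m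
    proof (induction m)
      case (Suc m)
      have "L ^ Suc (Suc m) + real (Suc (Suc m)) * x a * L ^ Suc m
          \<le> (L ^ Suc m + real (Suc m) * x a * L ^ m) * (L + x a)"
        using L0 a0 by (simp add: algebra_simps)
      also have "\<dots> \<le> (L + x a) ^ Suc m * (L + x a)"
        using Suc.IH L0 a0 by (intro mult_right_mono) auto
      finally show ?case by (simp add: mult.commute)
    qed (simp add: algebra_simps)
    have "esym (insert a A) s x = esym A (Suc k) x + x a * esym A k x"
      using esym_insert[OF insert(1,2)] Suc by simp
    also have "\<dots> \<le> L ^ Suc k / fact (Suc k) + x a * (L ^ k / fact k)"
    proof (intro add_mono mult_left_mono a0)
      show "esym A (Suc k) x \<le> L ^ Suc k / fact (Suc k)" "esym A k x \<le> L ^ k / fact k"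
        unfolding L_def using insert.prems by (intro insert.IH; simp)+
    qed
    also have "x a * (L ^ k / fact k) = real (Suc k) * x a * L ^ k / fact (Suc k)"
      by (simp del: of_nat_Suc)
    also have "L ^ Suc k / fact (Suc k) + \<dots> = (L ^ Suc k + real (Suc k) * x a * L ^ k) / fact (Suc k)"
      by (rule add_divide_distrib[symmetric])
    also have "\<dots> \<le> (L + x a) ^ Suc k / fact (Suc k)"
      by (intro divide_right_mono pw) auto
    finally show ?thesis using insert Suc by (simp add: L_def add.commute)
  qed
qed

lemma truncated_sieve_0: "finite A \<Longrightarrow> truncated_sieve A 0 x = 1"
proof -
  assume "finite A"
  then have "{U. U \<subseteq> A \<and> card U \<le> 0} = {{}}"
    by (auto dest: finite_subset)
  then show ?thesis by (simp add: truncated_sieve_def)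
qed

lemma truncated_sieve_Suc:
  assumes "finite A"
  shows "truncated_sieve A (Suc r) x = truncated_sieve A r x + (-1) ^ Suc r * esym A (Suc r) x"
proof -
  have split: "{U. U \<subseteq> A \<and> card U \<le> Suc r} = {U. U \<subseteq> A \<and> card U \<le> r} \<union> {U. U \<subseteq> A \<and> card U = Suc r}"
    by auto
  have "truncated_sieve A (Suc r) x = truncated_sieve A r x
      + (\<Sum>U | U \<subseteq> A \<and> card U = Suc r. (-1) ^ card U * (\<Prod>P\<in>U. x P))"
    unfolding truncated_sieve_def split using assms by (intro sum.union_disjoint) auto
  also have "(\<Sum>U | U \<subseteq> A \<and> card U = Suc r. (-1) ^ card U * (\<Prod>P\<in>U. x P))
      = (-1) ^ Suc r * esym A (Suc r) x"
    unfolding esym_def sum_distrib_left by (intro sum.cong) auto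
  finally show ?thesis .
qed

lemma truncated_sieve_insert:
  assumes "finite A" "a \<notin> A"
  shows "truncated_sieve (insert a A) (Suc r) x = truncated_sieve A (Suc r) x - x a * truncated_sieve A r x"
proof (induction r)
  case 0
  show ?case using assms
    by (simp add: truncated_sieve_Suc truncated_sieve_0 esym_insert esym_0)
next
  case (Suc r)
  show ?case
    using Suc.IH assms
    by (simp add: truncated_sieve_Suc[of "insert a A"] truncated_sieve_Suc[of A] esym_insert algebra_simps)
qed

text \<open>The error for \<open>insert a A\<close> at level \<open>Suc k\<close> is the error for
  \<open>A\<close> at level \<open>Suc k\<close> minus \<open>x a\<close> times that at level
  \<open>k\<close>. These two errors have opposite signs by induction, so the difference keeps its
  sign.\<close>

lemma truncated_sieve_alternating:
  assumes "finite A" "\<And>P. P \<in> A \<Longrightarrow> 0 \<le> x P \<and> x P \<le> 1"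
  shows "(-1) ^ r * (truncated_sieve A r x - (\<Prod>P\<in>A. 1 - x P)) \<ge> 0"
  using assms
proof (induction A arbitrary: r rule: finite_induct)
  case empty
  have "{U::'a set. U \<subseteq> {} \<and> card U \<le> r} = {{}}" by auto
  then show ?case by (simp add: truncated_sieve_def)
next
  case (insert a A)
  have a: "0 \<le> x a" "x a \<le> 1" using insert by auto
  have V1: "(\<Prod>P\<in>insert a A. 1 - x P) \<le> 1"
    using insert.prems by (intro prod_le_1) auto
  show ?case
  proof (cases r)
    case 0
    then show ?thesis using V1 insert by (simp add: truncated_sieve_0)
  next
    case (Suc k)
    define V where "V = (\<Prod>P\<in>A. 1 - x P)"
    have "(-1) ^ Suc k * (truncated_sieve A (Suc k) x - V) \<ge> 0"
      "(-1) ^ k * (truncated_sieve A k x - V) \<ge> 0"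
      unfolding V_def by (rule insert.IH; use insert.prems in blast)+
    then have "(-1) ^ Suc k * (truncated_sieve A (Suc k) x - V)
       + x a * ((-1) ^ k * (truncated_sieve A k x - V)) \<ge> 0"
      using a(1) by (intro add_nonneg_nonneg mult_nonneg_nonneg[of "x a"])
    moreover have "(\<Prod>P\<in>insert a A. 1 - x P) = (1 - x a) * V"
      using insert(1,2) by (simp add: V_def)
    then have "truncated_sieve (insert a A) (Suc k) x - (\<Prod>P\<in>insert a A. 1 - x P)
        = (truncated_sieve A (Suc k) x - V) - x a * (truncated_sieve A k x - V)"
      using truncated_sieve_insert[OF insert(1,2), of k x] by (simp add: algebra_simps)
    then have "(-1) ^ Suc k * (truncated_sieve (insert a A) (Suc k) x - (\<Prod>P\<in>insert a A. 1 - x P))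
        = (-1) ^ Suc k * (truncated_sieve A (Suc k) x - V) + x a * ((-1) ^ k * (truncated_sieve A k x - V))"
      by (simp only:) (simp add: algebra_simps)
    ultimately show ?thesis
      unfolding Suc by linarith
  qed
qed

lemma truncated_sieve_ge:
  assumes "finite A" "\<And>P. P \<in> A \<Longrightarrow> 0 \<le> x P \<and> x P \<le> 1" "even r"
  shows "(\<Prod>P\<in>A. 1 - x P) \<le> truncated_sieve A r x"
  using truncated_sieve_alternating[where A = A and x = x and r = r] assms(1,2) assms(3) by simp

lemma truncated_sieve_le:
  assumes "finite A" "\<And>P. P \<in> A \<Longrightarrow> 0 \<le> x P \<and> x P \<le> 1" "even r"
  shows "truncated_sieve A r x - (\<Prod>P\<in>A. 1 - x P) \<le> esym A (Suc r) x"
  using truncated_sieve_alternating[where A = A and x = x and r = "Suc r"] assms(1,2) assms(3)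
  by (simp add: truncated_sieve_Suc[OF assms(1)])

text \<open>Hooley's device. Lower bounds for the single blocks may be negative and cannot be
  multiplied; instead the upper bounds \<open>y\<close> are multiplied, and for each block its error
  times the other upper bounds is subtracted.\<close>

lemma prod_diff_le:
  fixes x y :: "'a \<Rightarrow> real"
  assumes "finite T" "\<And>t. t \<in> T \<Longrightarrow> 0 \<le> x t \<and> x t \<le> y t"
  shows "(\<Prod>t\<in>T. y t) - (\<Prod>t\<in>T. x t) \<le> (\<Sum>l\<in>T. (y l - x l) * (\<Prod>t\<in>T - {l}. y t))"
  using assms
proof (induction T rule: finite_induct)
  case (insert a T)
  let ?Y = "\<Prod>t\<in>T. y t" and ?Z = "\<Prod>t\<in>T. x t"
  have a: "0 \<le> x a" "x a \<le> y a" using insert by auto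
  then have ya: "0 \<le> y a" by linarith
  have XY: "?Z \<le> ?Y" using insert by (intro prod_mono) auto
  have "x a * (?Y - ?Z) \<le> y a * (?Y - ?Z)" using a XY by (intro mult_right_mono) auto
  also have "\<dots> \<le> y a * (\<Sum>l\<in>T. (y l - x l) * (\<Prod>t\<in>T - {l}. y t))"
    using insert.IH insert.prems ya by (intro mult_left_mono) auto
  also have "\<dots> = (\<Sum>l\<in>T. (y l - x l) * (\<Prod>t\<in>insert a T - {l}. y t))"
    unfolding sum_distrib_left
  proof (intro sum.cong refl)
    fix l assume l: "l \<in> T"
    then have "insert a T - {l} = insert a (T - {l})" using insert by auto
    then show "y a * ((y l - x l) * (\<Prod>t\<in>T - {l}. y t)) = (y l - x l) * (\<Prod>t\<in>insert a T - {l}. y t)"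
      using insert by simp
  qed
  finally have "x a * (?Y - ?Z) \<le> (\<Sum>l\<in>T. (y l - x l) * (\<Prod>t\<in>insert a T - {l}. y t))" .
  moreover have "insert a T - {a} = T" using insert by auto
  ultimately show ?case using insert(1,2) by (simp add: algebra_simps)
qed simp

text \<open>If divisibility by the elements of a set \<open>U\<close> has density \<open>\<Prod>P\<in>U. x P\<close> for every \<open>U\<close> that meets
  each block in an admissible set, then the mean of a product of block sums factorises.\<close>

lemma mean_prod_block_sums:
  fixes x :: "'p \<Rightarrow> real" and ind :: "'r \<Rightarrow> 'p \<Rightarrow> real" and w :: real
  assumes T: "finite T" and B: "\<And>t. t \<in> T \<Longrightarrow> finite (B t)" "disjoint_family_on B T"
    and \<U>: "\<And>t. t \<in> T \<Longrightarrow> \<U> t \<subseteq> Pow (B t)"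
    and dens: "\<And>g. g \<in> (\<Pi>\<^sub>E t\<in>T. \<U> t) \<Longrightarrow>
       (\<Sum>Z\<in>R. \<Prod>P\<in>(\<Union>t\<in>T. g t). ind Z P) = w * (\<Prod>P\<in>(\<Union>t\<in>T. g t). x P)"
  shows "(\<Sum>Z\<in>R. \<Prod>t\<in>T. \<Sum>U\<in>\<U> t. c t U * (\<Prod>P\<in>U. ind Z P))
       = w * (\<Prod>t\<in>T. \<Sum>U\<in>\<U> t. c t U * (\<Prod>P\<in>U. x P))"
proof -
  have fin: "finite (\<U> t)" if "t \<in> T" for t
    using \<U>[OF that] B(1)[OF that] finite_subset by blast
  have expand: "(\<Prod>t\<in>T. \<Sum>U\<in>\<U> t. c t U * (\<Prod>P\<in>U. z P))
      = (\<Sum>g\<in>(\<Pi>\<^sub>E t\<in>T. \<U> t). (\<Prod>t\<in>T. c t (g t)) * (\<Prod>P\<in>(\<Union>t\<in>T. g t). z P))" for z :: "'p \<Rightarrow> real"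
  proof -
    have "(\<Prod>t\<in>T. \<Sum>U\<in>\<U> t. c t U * (\<Prod>P\<in>U. z P))
      = (\<Sum>g\<in>(\<Pi>\<^sub>E t\<in>T. \<U> t). \<Prod>t\<in>T. c t (g t) * (\<Prod>P\<in>g t. z P))"
      by (rule prod_sum_PiE[OF T fin])
    also have "\<dots> = (\<Sum>g\<in>(\<Pi>\<^sub>E t\<in>T. \<U> t). (\<Prod>t\<in>T. c t (g t)) * (\<Prod>P\<in>(\<Union>t\<in>T. g t). z P))"
    proof (intro sum.cong refl)
      fix g assume g: "g \<in> (\<Pi>\<^sub>E t\<in>T. \<U> t)"
      have sub: "g t \<subseteq> B t" if "t \<in> T" for t using g \<U>[OF that] that by (auto simp: PiE_iff)
      have "(\<Prod>P\<in>(\<Union>t\<in>T. g t). z P) = (\<Prod>t\<in>T. \<Prod>P\<in>g t. z P)"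
      proof (rule prod.UNION_disjoint[OF T])
        show "\<forall>i\<in>T. finite (g i)" using sub B(1) finite_subset by blast
        show "\<forall>i\<in>T. \<forall>j\<in>T. i \<noteq> j \<longrightarrow> g i \<inter> g j = {}"
          using sub B(2) unfolding disjoint_family_on_def by blast
      qed
      then show "(\<Prod>t\<in>T. c t (g t) * (\<Prod>P\<in>g t. z P)) = (\<Prod>t\<in>T. c t (g t)) * (\<Prod>P\<in>(\<Union>t\<in>T. g t). z P)"
        by (simp add: prod.distrib)
    qed
    finally show ?thesis .
  qed
  have "(\<Sum>Z\<in>R. \<Prod>t\<in>T. \<Sum>U\<in>\<U> t. c t U * (\<Prod>P\<in>U. ind Z P))
      = (\<Sum>Z\<in>R. \<Sum>g\<in>(\<Pi>\<^sub>E t\<in>T. \<U> t). (\<Prod>t\<in>T. c t (g t)) * (\<Prod>P\<in>(\<Union>t\<in>T. g t). ind Z P))"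
    by (simp only: expand)
  also have "\<dots> = (\<Sum>g\<in>(\<Pi>\<^sub>E t\<in>T. \<U> t). (\<Prod>t\<in>T. c t (g t)) * (\<Sum>Z\<in>R. \<Prod>P\<in>(\<Union>t\<in>T. g t). ind Z P))"
    by (subst sum.swap) (simp add: sum_distrib_left)
  also have "\<dots> = (\<Sum>g\<in>(\<Pi>\<^sub>E t\<in>T. \<U> t). (\<Prod>t\<in>T. c t (g t)) * (w * (\<Prod>P\<in>(\<Union>t\<in>T. g t). x P)))"
    by (intro sum.cong refl arg_cong2[where f = "(*)"] dens)
  also have "\<dots> = w * (\<Prod>t\<in>T. \<Sum>U\<in>\<U> t. c t U * (\<Prod>P\<in>U. x P))"
    by (simp only: expand sum_distrib_left mult.left_commute)
  finally show ?thesis .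
qed

section \<open>Abstract arithmetic and the number of primes of each degree\<close>

text \<open>By unique factorisation, monic polynomials are encoded as the multisets of their monic irreducible
  factors. The only further input is that there are \<open>q ^ k\<close> of them in each degree \<open>k\<close>.\<close>

locale factorial_degree =
  fixes q :: nat and Irr :: "'p set" and dg :: "'p \<Rightarrow> nat"
  assumes q_ge_2: "q \<ge> 2"
    and dg_pos: "\<And>p. p \<in> Irr \<Longrightarrow> dg p \<ge> 1"
    and card_of_degree: "\<And>k. card {a. set_mset a \<subseteq> Irr \<and> (\<Sum>p\<in>#a. dg p) = k} = q ^ k"
begin

definition mdeg :: "'p multiset \<Rightarrow> nat" where
  "mdeg a = (\<Sum>p\<in>#a. dg p)"

definition monics :: "nat \<Rightarrow> 'p multiset set" where
  "monics k = {a. set_mset a \<subseteq> Irr \<and> mdeg a = k}"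

definition irr :: "nat \<Rightarrow> 'p set" where
  "irr j = {p \<in> Irr. dg p = j}"

lemma mdeg_simps [simp]: "mdeg {#} = 0" "mdeg (add_mset p a) = dg p + mdeg a"
  "mdeg (a + c) = mdeg a + mdeg c"
  by (auto simp: mdeg_def)

lemma mdeg_diff: "c \<subseteq># a \<Longrightarrow> mdeg (a - c) = mdeg a - mdeg c"
  by (metis add_diff_cancel_left' mdeg_simps(3) subset_mset.add_diff_inverse)

lemma mdeg_mono: "c \<subseteq># a \<Longrightarrow> mdeg c \<le> mdeg a"
  by (metis le_add1 mdeg_simps(3) subset_mset.add_diff_inverse)

lemma mdeg_mset_set: "finite U \<Longrightarrow> mdeg (mset_set U) = (\<Sum>p\<in>U. dg p)"
  by (simp add: mdeg_def sum_unfold_sum_mset)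

lemma mdeg_replicate: "mdeg (replicate_mset e p) = e * dg p"
  by (induction e) auto

lemma size_le_mdeg: "set_mset a \<subseteq> Irr \<Longrightarrow> size a \<le> mdeg a"
proof (induction a)
  case (add p a)
  then show ?case using dg_pos[of p] by auto
qed simp

lemma card_monics: "card (monics k) = q ^ k"
  using card_of_degree by (simp add: monics_def mdeg_def)

lemma finite_monics: "finite (monics k)"
  using card_monics[of k] q_ge_2 by (metis card.infinite not_numeral_le_zero power_not_zero)

lemma finite_irr: "finite (irr j)"
proof -
  have "(\<lambda>p. {#p#}) ` irr j \<subseteq> monics j"
    by (auto simp: irr_def monics_def)
  then show ?thesis
    using finite_monics finite_subset by (metis finite_imageD inj_on_def single_eq_single)
qed

lemma finite_irr_Union: "finite K \<Longrightarrow> finite {p \<in> Irr. dg p \<in> K}"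
proof -
  assume "finite K"
  moreover have "{p \<in> Irr. dg p \<in> K} = (\<Union>j\<in>K. irr j)" by (auto simp: irr_def)
  ultimately show ?thesis using finite_irr by simp
qed

lemma sum_by_degree:
  fixes h :: "nat \<Rightarrow> real"
  assumes "A \<subseteq> Irr" "finite K"
  shows "(\<Sum>p\<in>{p\<in>A. dg p \<in> K}. h (dg p)) = (\<Sum>j\<in>K. real (card (irr j \<inter> A)) * h j)"
proof -
  have fin: "finite {p\<in>A. dg p \<in> K}"
    by (rule rev_finite_subset[OF finite_irr_Union[OF assms(2)]]) (use assms(1) in auto)
  have "(\<Sum>p\<in>{p\<in>A. dg p \<in> K}. h (dg p)) = (\<Sum>j\<in>K. \<Sum>p | p \<in> {p\<in>A. dg p \<in> K} \<and> dg p = j. h (dg p))"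
    by (rule sum.group[OF fin assms(2), symmetric]) auto
  also have "\<dots> = (\<Sum>j\<in>K. real (card (irr j \<inter> A)) * h j)"
  proof (intro sum.cong refl)
    fix j assume "j \<in> K"
    then have "{p. p \<in> {p\<in>A. dg p \<in> K} \<and> dg p = j} = irr j \<inter> A"
      using assms(1) by (auto simp: irr_def)
    then show "(\<Sum>p | p \<in> {p\<in>A. dg p \<in> K} \<and> dg p = j. h (dg p)) = real (card (irr j \<inter> A)) * h j"
      by (simp add: irr_def)
  qed
  finally show ?thesis .
qed

lemma card_multiples:
  assumes "set_mset g \<subseteq> Irr"
  shows "card {f \<in> monics k. g \<subseteq># f} = (if mdeg g \<le> k then q ^ (k - mdeg g) else 0)"
proof (cases "mdeg g \<le> k")
  case True
  have "bij_betw (\<lambda>f. f - g) {f \<in> monics k. g \<subseteq># f} (monics (k - mdeg g))"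
  proof (rule bij_betw_byWitness[where f' = "\<lambda>f. f + g"])
    show "(\<lambda>f. f - g) ` {f \<in> monics k. g \<subseteq># f} \<subseteq> monics (k - mdeg g)"
      by (auto simp: monics_def mdeg_diff dest: in_diffD)
    show "(\<lambda>f. f + g) ` monics (k - mdeg g) \<subseteq> {f \<in> monics k. g \<subseteq># f}"
      using True assms by (auto simp: monics_def)
  qed auto
  then show ?thesis using True by (simp add: bij_betw_same_card card_monics)
next
  case False
  then have "{f \<in> monics k. g \<subseteq># f} = {}"
    using mdeg_mono by (fastforce simp: monics_def)
  then have "card {f \<in> monics k. g \<subseteq># f} = 0" by (simp only: card.empty)
  then show ?thesis using False by simp
qed

lemma mdeg_sum_count:
  assumes "finite A" "set_mset f \<subseteq> A"
  shows "mdeg f = (\<Sum>p\<in>A. dg p * count f p)"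
  using assms(2)
proof (induction f)
  case (add p f)
  have "(\<Sum>x\<in>A. dg x * count (add_mset p f) x) = (\<Sum>x\<in>A. (if x = p then dg p else 0) + dg x * count f x)"
    by (intro sum.cong) auto
  also have "\<dots> = dg p + (\<Sum>x\<in>A. dg x * count f x)"
    using assms(1) add.prems by (simp add: sum.distrib)
  finally show ?case using add by simp
qed simp

text \<open>The degree of each \<open>f\<close> is the sum of \<open>dg p\<close> over the prime
  powers \<open>p ^ e\<close>, \<open>e \<ge> 1\<close>, that divide \<open>f\<close>; both sides
  sum this over all \<open>f\<close> of degree \<open>n\<close>. In terms of generating functions it
  is the logarithmic derivative of the zeta function.\<close>

lemma degree_times_card:
  "n * q ^ n = (\<Sum>j\<in>{1..n}. \<Sum>e\<in>{1..n}. if e * j \<le> n then j * card (irr j) * q ^ (n - e * j) else 0)"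
proof -
  let ?A = "{p\<in>Irr. dg p \<in> {1..n}}"
  have finA: "finite ?A" by (rule finite_irr_Union) simp
  have count: "count f p = (\<Sum>e\<in>{1..n}. if replicate_mset e p \<subseteq># f then 1 else 0)"
    if f: "f \<in> monics n" for f p
  proof -
    have "count f p \<le> size f" by (simp add: count_le_size)
    also have "\<dots> \<le> n" using size_le_mdeg[of f] f by (simp add: monics_def)
    finally have "{e\<in>{1..n}. replicate_mset e p \<subseteq># f} = {1..count f p}"
      by (auto simp: count_le_replicate_mset_subset_eq[symmetric])
    then have "count f p = card {e\<in>{1..n}. replicate_mset e p \<subseteq># f}" by simp
    then show ?thesis by (simp add: sum.If_cases Int_def)
  qed
  have deg: "n = (\<Sum>p\<in>?A. dg p * count f p)" if f: "f \<in> monics n" for f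
  proof -
    have "set_mset f \<subseteq> ?A"
    proof
      fix p assume p: "p \<in># f"
      then have "dg p \<le> mdeg f" using mdeg_mono[of "{#p#}" f] by simp
      then show "p \<in> ?A" using p f dg_pos[of p] by (auto simp: monics_def)
    qed
    then show ?thesis using mdeg_sum_count[OF finA] f by (simp add: monics_def)
  qed
  have "n * q ^ n = (\<Sum>f\<in>monics n. n)" by (simp add: card_monics)
  also have "\<dots> = (\<Sum>f\<in>monics n. \<Sum>p\<in>?A. \<Sum>e\<in>{1..n}. dg p * (if replicate_mset e p \<subseteq># f then 1 else 0))"
  proof (intro sum.cong refl)
    fix f assume f: "f \<in> monics n"
    show "n = (\<Sum>p\<in>?A. \<Sum>e\<in>{1..n}. dg p * (if replicate_mset e p \<subseteq># f then 1 else 0))"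
      by (subst deg[OF f], subst count[OF f]) (simp only: sum_distrib_left)
  qed
  also have "\<dots> = (\<Sum>p\<in>?A. \<Sum>f\<in>monics n. \<Sum>e\<in>{1..n}. dg p * (if replicate_mset e p \<subseteq># f then 1 else 0))"
    by (rule sum.swap)
  also have "\<dots> = (\<Sum>p\<in>?A. \<Sum>e\<in>{1..n}. \<Sum>f\<in>monics n. dg p * (if replicate_mset e p \<subseteq># f then 1 else 0))"
    by (intro sum.cong refl sum.swap)
  also have "\<dots> = (\<Sum>p\<in>?A. \<Sum>e\<in>{1..n}. dg p * (if e * dg p \<le> n then q ^ (n - e * dg p) else 0))"
  proof (intro sum.cong refl)
    fix p e assume p: "p \<in> ?A"
    have "set_mset (replicate_mset e p) \<subseteq> Irr" using p by (auto split: if_splits)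
    then have "card {f \<in> monics n. replicate_mset e p \<subseteq># f} = (if e * dg p \<le> n then q ^ (n - e * dg p) else 0)"
      by (simp only: card_multiples mdeg_replicate)
    moreover have "(\<Sum>f\<in>monics n. dg p * (if replicate_mset e p \<subseteq># f then 1 else 0))
        = dg p * card {f \<in> monics n. replicate_mset e p \<subseteq># f}"
      unfolding sum_distrib_left[symmetric] using finite_monics by (simp add: sum.If_cases Int_def)
    ultimately show "(\<Sum>f\<in>monics n. dg p * (if replicate_mset e p \<subseteq># f then 1 else 0))
        = dg p * (if e * dg p \<le> n then q ^ (n - e * dg p) else 0)"
      by (simp only:)
  qed
  also have "\<dots> = (\<Sum>j\<in>{1..n}. \<Sum>p | p \<in> ?A \<and> dg p = j. \<Sum>e\<in>{1..n}. dg p * (if e * dg p \<le> n then q ^ (n - e * dg p) else 0))"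
    by (rule sum.group[OF finA, symmetric]) auto
  also have "\<dots> = (\<Sum>j\<in>{1..n}. \<Sum>p\<in>irr j. \<Sum>e\<in>{1..n}. j * (if e * j \<le> n then q ^ (n - e * j) else 0))"
    by (intro sum.cong) (auto simp: irr_def)
  also have "\<dots> = (\<Sum>j\<in>{1..n}. \<Sum>e\<in>{1..n}. if e * j \<le> n then j * card (irr j) * q ^ (n - e * j) else 0)"
    by (intro sum.cong refl) (simp, simp only: sum_distrib_left, intro sum.cong refl, simp)
  finally show ?thesis .
qed

lemma degree_times_card_divisors:
  "n * q ^ n = (\<Sum>m\<in>{1..n}. q ^ (n - m) * (\<Sum>j | j dvd m. j * card (irr j)))"
proof -
  have "n * q ^ n = (\<Sum>(j, e)\<in>{1..n} \<times> {1..n}. if e * j \<le> n then j * card (irr j) * q ^ (n - e * j) else 0)"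
    by (subst degree_times_card) (rule sum.cartesian_product)
  also have "\<dots> = (\<Sum>(j, e)\<in>{(j, e)\<in>{1..n} \<times> {1..n}. e * j \<le> n}. j * card (irr j) * q ^ (n - e * j))"
    by (intro sum.mono_neutral_cong_right) (auto split: if_splits)
  also have "\<dots> = (\<Sum>(m, j)\<in>Sigma {1..n} (\<lambda>m. {j. j dvd m}). q ^ (n - m) * (j * card (irr j)))"
  proof (rule sum.reindex_bij_witness[where i = "\<lambda>(m, j). (j, m div j)" and j = "\<lambda>(j, e). (e * j, j)"], goal_cases)
    case (4 a)
    obtain m j where a: "a = (m, j)" by (cases a)
    then have "1 \<le> m" "m \<le> n" "j dvd m" using 4 by auto
    then have "1 \<le> j" "j \<le> n" "1 \<le> m div j" "m div j \<le> n" "m div j * j \<le> n"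
      by (auto simp: dvd_div_eq_0_iff Suc_le_eq dest: dvd_imp_le intro: order_trans[OF div_le_dividend] intro!: Nat.gr0I)
    then show ?case by (simp add: a)
  qed (auto simp: mult_ac)
  also have "\<dots> = (\<Sum>m\<in>{1..n}. \<Sum>j | j dvd m. q ^ (n - m) * (j * card (irr j)))"
    by (rule sum.Sigma[symmetric]) (auto intro: finite_divisors_nat)
  finally show ?thesis by (simp only: sum_distrib_left)
qed

text \<open>Gauss's formula. Subtracting \<open>q\<close> times the identity of degree
  \<open>n - 1\<close> from the one of degree \<open>n\<close> cancels every term but
  \<open>m = n\<close>.\<close>

lemma sum_irr_divisors:
  assumes "n \<ge> 1"
  shows "(\<Sum>j | j dvd n. j * card (irr j)) = q ^ n"
proof -
  define c where "c m = (\<Sum>j | j dvd m. j * card (irr j))" for m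
  obtain k where n: "n = Suc k" using assms by (cases n) auto
  have id: "m * q ^ m = (\<Sum>i\<in>{1..m}. q ^ (m - i) * c i)" for m
    using degree_times_card_divisors by (simp add: c_def)
  have "Suc k * q ^ Suc k = (\<Sum>i\<in>{1..k}. q ^ (Suc k - i) * c i) + c (Suc k)"
    using id[of "Suc k"] by simp
  also have "(\<Sum>i\<in>{1..k}. q ^ (Suc k - i) * c i) = (\<Sum>i\<in>{1..k}. q * (q ^ (k - i) * c i))"
    by (intro sum.cong refl) (auto simp: Suc_diff_le)
  also have "\<dots> = q * (k * q ^ k)"
    by (simp only: id sum_distrib_left)
  finally show ?thesis by (simp add: n c_def)
qed

lemma card_irr_le: "j \<ge> 1 \<Longrightarrow> j * card (irr j) \<le> q ^ j"
proof -
  assume j: "j \<ge> 1"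
  have "(\<Sum>i\<in>{j}. i * card (irr i)) \<le> (\<Sum>i | i dvd j. i * card (irr i))"
    using j by (intro sum_mono2) (auto intro: finite_divisors_nat)
  then show ?thesis using sum_irr_divisors[OF j] by simp
qed

text \<open>The proper divisors of \<open>j\<close> are at most \<open>j div 2\<close>, so the
  remaining terms of Gauss's formula stay below a geometric series.\<close>

lemma card_irr_ge:
  assumes j: "j \<ge> 1"
  shows "q ^ j \<le> j * card (irr j) + 2 * q ^ (j div 2)"
proof -
  have geo: "(\<Sum>i\<in>{1..m}. q ^ i) \<le> 2 * q ^ m" for m
  proof (induction m)
    case (Suc m)
    have "2 * q ^ m \<le> q * q ^ m" using q_ge_2 by (intro mult_right_mono) auto
    then have "(\<Sum>i\<in>{1..m}. q ^ i) \<le> q * q ^ m" using Suc by (rule order_trans[rotated])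
    then show ?case by simp
  qed simp
  have "{i. i dvd j} \<subseteq> insert j {1..j div 2}"
  proof
    fix i assume i: "i \<in> {i. i dvd j}"
    then obtain c where c: "j = i * c" by auto
    then have "i \<ge> 1" "c \<ge> 1" using j by (auto intro: Nat.gr0I simp: Suc_le_eq)
    then show "i \<in> insert j {1..j div 2}"
    proof (cases "c = 1")
      case False
      then have "i * 2 \<le> j" unfolding c using \<open>c \<ge> 1\<close> by (intro mult_left_mono) auto
      then show ?thesis using \<open>i \<ge> 1\<close> by auto
    qed (use c in auto)
  qed
  then have "(\<Sum>i | i dvd j. i * card (irr i)) \<le> (\<Sum>i\<in>insert j {1..j div 2}. i * card (irr i))"
    by (intro sum_mono2) auto
  also have "\<dots> = j * card (irr j) + (\<Sum>i\<in>{1..j div 2}. i * card (irr i))"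
    using j by (subst sum.insert) auto
  also have "(\<Sum>i\<in>{1..j div 2}. i * card (irr i)) \<le> (\<Sum>i\<in>{1..j div 2}. q ^ i)"
    by (intro sum_mono card_irr_le) auto
  also have "\<dots> \<le> 2 * q ^ (j div 2)" by (rule geo)
  finally show ?thesis using sum_irr_divisors[OF j] by simp
qed

end

lemma sum_inverse_le_ln:
  assumes "n \<ge> 1"
  shows "(\<Sum>j\<in>{1..n}. 1 / real j) \<le> 1 + ln (real n)"
  using assms
proof (induction n rule: nat_induct_at_least)
  case (Suc n)
  have "ln (real n / real (Suc n)) \<le> real n / real (Suc n) - 1"
    using Suc by (intro ln_le_minus_one) auto
  also have "ln (real n / real (Suc n)) = ln (real n) - ln (real (Suc n))"
    using Suc by (subst ln_div) auto
  also have "real n / real (Suc n) - 1 = - (1 / real (Suc n))"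
    by (simp add: field_simps)
  finally show ?case using Suc by simp
qed simp

lemma one_minus_ge_exp:
  fixes x :: real
  assumes "0 \<le> x" "x \<le> 1 / 2"
  shows "1 - x \<ge> exp (- x - 2 * x\<^sup>2)"
proof -
  have "- x - 2 * x\<^sup>2 \<le> ln (1 - x)" using ln_one_minus_pos_lower_bound[OF assms] .
  then have "exp (- x - 2 * x\<^sup>2) \<le> exp (ln (1 - x))" by simp
  then show ?thesis using assms by simp
qed

lemma prod_one_minus_ge_exp:
  fixes x :: "'a \<Rightarrow> real"
  assumes "finite A" "\<And>p. p \<in> A \<Longrightarrow> 0 \<le> x p \<and> x p \<le> 1 / 2"
  shows "(\<Prod>p\<in>A. 1 - x p) \<ge> exp (- (\<Sum>p\<in>A. x p) - 2 * (\<Sum>p\<in>A. (x p)\<^sup>2))"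
proof -
  have "exp (- (\<Sum>p\<in>A. x p) - 2 * (\<Sum>p\<in>A. (x p)\<^sup>2)) = exp (\<Sum>p\<in>A. - x p - 2 * (x p)\<^sup>2)"
    by (simp add: sum_subtractf sum_negf sum_distrib_left)
  also have "\<dots> = (\<Prod>p\<in>A. exp (- x p - 2 * (x p)\<^sup>2))" by (rule exp_sum[OF assms(1)])
  also have "\<dots> \<le> (\<Prod>p\<in>A. 1 - x p)"
    using assms(2) one_minus_ge_exp by (intro prod_mono) auto
  finally show ?thesis .
qed

text \<open>The truncation levels of the Brun--Hooley sieve: in the block of degrees about \<open>2 ^ t\<close> at most
  \<open>4 + 2 * (b - t)\<close> primes are sieved by, which keeps the total degree below \<open>13 * 2 ^ b\<close>.\<close>

lemma sum_truncation_levels: "(\<Sum>t\<le>b. 2 ^ t * (4 + 2 * (b - t))) + (2 * b + 8) = 12 * (2::nat) ^ b"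
proof (induction b)
  case (Suc b)
  have "(\<Sum>t\<le>Suc b. 2 ^ t * (4 + 2 * (Suc b - t))) = (4 + 2 * Suc b) + 2 * (\<Sum>t\<le>b. 2 ^ t * (4 + 2 * (b - t)))"
    by (subst sum.atMost_Suc_shift) (simp add: sum_distrib_left mult.assoc)
  then show ?case using Suc by simp
qed simp

text \<open>The factorials are at least \<open>120 * 2 ^ u\<close>, which leaves a geometric series.
  The value \<open>1 / 60\<close> has to beat a factor 9 that the correction terms of the sieve
  bring in.\<close>

lemma sum_inverse_fact_levels: "(\<Sum>t\<le>b. 1 / fact (Suc (4 + 2 * (b - t)))) \<le> (1 / 60 :: real)"
proof -
  have f: "fact (Suc (4 + 2 * u)) \<ge> 120 * (2::real) ^ u" for u
  proof (induction u)
    case 0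
    then show ?case by (simp add: fact_numeral)
  next
    case (Suc u)
    have "fact (Suc (4 + 2 * Suc u)) = real (7 + 2 * u) * (real (6 + 2 * u) * fact (Suc (4 + 2 * u)))"
    proof -
      have "Suc (4 + 2 * Suc u) = Suc (Suc (Suc (4 + 2 * u)))" by simp
      then show ?thesis by (simp only: fact_Suc of_nat_mult) (simp add: algebra_simps)
    qed
    also have "\<dots> \<ge> 2 * (1 * fact (Suc (4 + 2 * u)))"
      by (intro mult_mono) auto
    finally show ?case using Suc by simp
  qed
  have "(\<Sum>t\<le>b. 1 / fact (Suc (4 + 2 * (b - t)))) = (\<Sum>u\<le>b. 1 / fact (Suc (4 + 2 * u)) :: real)"
    by (rule sum.reindex_bij_witness[of _ "\<lambda>u. b - u" "\<lambda>t. b - t"]) auto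
  also have "\<dots> \<le> (\<Sum>u\<le>b. (1 / 120) * (1 / 2) ^ u)"
  proof (intro sum_mono)
    fix u
    have "1 / fact (Suc (4 + 2 * u)) \<le> 1 / (120 * (2::real) ^ u)"
      by (intro divide_left_mono f) auto
    then show "1 / fact (Suc (4 + 2 * u)) \<le> (1 / 120 :: real) * (1 / 2) ^ u"
      by (simp add: power_one_over field_simps)
  qed
  also have "\<dots> = (1 / 120) * (2 - (1 / 2) ^ b)"
  proof (induction b)
    case (Suc b)
    then show ?case by (simp add: field_simps)
  qed simp
  also have "\<dots> \<le> 1 / 60" by simp
  finally show ?thesis .
qed

section \<open>The Brun-Hooley sieve over dyadic blocks\<close>

context factorial_degree
begin

text \<open>Models a reduced residue class modulo a polynomial of degree \<open>m\<close> whose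
  prime divisors form \<open>Q\<close>: multiples of \<open>g\<close> have exactly the expected
  number, without error term, as soon as the degree leaves room for \<open>g\<close> and the
  modulus.\<close>

definition equidistributed :: "'p multiset set \<Rightarrow> nat \<Rightarrow> 'p set \<Rightarrow> bool" where
  "equidistributed R m Q \<longleftrightarrow> R \<subseteq> {f. set_mset f \<subseteq> Irr - Q} \<and>
     (\<forall>g k. set_mset g \<subseteq> Irr - Q \<longrightarrow> mdeg g + m \<le> k \<longrightarrow>
        card {f \<in> R. mdeg f = k \<and> g \<subseteq># f} = q ^ (k - mdeg g - m))"

definition rough :: "nat \<Rightarrow> 'p multiset \<Rightarrow> bool" where
  "rough z f \<longleftrightarrow> (\<forall>p\<in>#f. z < dg p)"

text \<open>The interval formula would be empty at \<open>t = 0\<close>; with \<open>{1}\<close>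
  there, the blocks up to \<open>b\<close> partition \<open>{1..2 ^ b}\<close>.\<close>

definition dyadic_degrees :: "nat \<Rightarrow> nat set" where
  "dyadic_degrees t = (if t = 0 then {1} else {2 ^ (t - 1)<..2 ^ t})"

lemma dyadic_degrees_pos: "j \<in> dyadic_degrees t \<Longrightarrow> j \<ge> 1"
  by (cases t) (auto simp: dyadic_degrees_def)

lemma dyadic_degrees_le: "j \<in> dyadic_degrees t \<Longrightarrow> j \<le> 2 ^ t"
  by (cases t) (auto simp: dyadic_degrees_def)

lemma finite_dyadic_degrees: "finite (dyadic_degrees t)"
  by (simp add: dyadic_degrees_def)

lemma dyadic_degrees_disjoint: "s < t \<Longrightarrow> dyadic_degrees s \<inter> dyadic_degrees t = {}"
proof (rule ccontr)
  assume st: "s < t" and "dyadic_degrees s \<inter> dyadic_degrees t \<noteq> {}"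
  then obtain j where j: "j \<in> dyadic_degrees s" "j \<in> dyadic_degrees t" by blast
  have "j \<le> 2 ^ s" using j(1) by (rule dyadic_degrees_le)
  also have "\<dots> \<le> 2 ^ (t - 1)" using st by (intro power_increasing) auto
  also have "\<dots> < j" using j(2) st by (simp add: dyadic_degrees_def)
  finally show False by simp
qed

lemma Union_dyadic_degrees: "(\<Union>t\<le>b. dyadic_degrees t) = {1..2 ^ b}"
proof (induction b)
  case (Suc b)
  have "(\<Union>t\<le>Suc b. dyadic_degrees t) = {1..2 ^ b} \<union> {2 ^ b<..2 ^ Suc b}"
    using Suc by (simp add: atMost_Suc dyadic_degrees_def Un_commute)
  also have "\<dots> = {1..2 ^ Suc b}"
    by (rule ivl_disj_un_two(8)) auto
  finally show ?case .
qed (simp add: dyadic_degrees_def)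

lemma sum_inverse_dyadic: "(\<Sum>j\<in>dyadic_degrees t. 1 / real j) \<le> 1"
proof (cases t)
  case (Suc s)
  have "(\<Sum>j\<in>dyadic_degrees t. 1 / real j) \<le> (\<Sum>j\<in>{2 ^ s<..2 ^ Suc s::nat}. 1 / 2 ^ s)"
  proof (subst Suc, simp only: dyadic_degrees_def if_False nat.distinct diff_Suc_1, intro sum_mono divide_left_mono)
    fix j :: nat assume "j \<in> {2 ^ s<..2 ^ Suc s}"
    then have "2 ^ s \<le> j" by simp
    then show "2 ^ s \<le> real j" by (metis of_nat_le_iff of_nat_numeral of_nat_power)
    show "0 < real j * 2 ^ s" using \<open>j \<in> _\<close> by auto
  qed auto
  also have "\<dots> = 1" by simp
  finally show ?thesis .
qed (simp add: dyadic_degrees_def)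

definition inv_norm :: "'p \<Rightarrow> real" where
  "inv_norm p = 1 / real q ^ dg p"

lemma inv_norm_bounds: "p \<in> Irr \<Longrightarrow> 0 \<le> inv_norm p \<and> inv_norm p \<le> 1 / 2"
proof -
  assume "p \<in> Irr"
  then have "real q ^ 1 \<le> real q ^ dg p" using dg_pos q_ge_2 by (intro power_increasing) auto
  moreover have "2 \<le> real q ^ 1" using q_ge_2 by simp
  ultimately have "2 \<le> real q ^ dg p" by linarith
  then have "1 / real q ^ dg p \<le> 1 / 2" by (intro frac_le) auto
  then show ?thesis by (simp add: inv_norm_def)
qed

lemma prod_inv_norm: "finite U \<Longrightarrow> (\<Prod>p\<in>U. inv_norm p) = 1 / real q ^ (\<Sum>p\<in>U. dg p)"
  by (simp add: inv_norm_def prod_dividef power_sum)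

lemma card_irr_div_le: "j \<ge> 1 \<Longrightarrow> real (card (irr j)) / real q ^ j \<le> 1 / real j"
proof -
  assume j: "j \<ge> 1"
  have "real (j * card (irr j)) \<le> real (q ^ j)" using card_irr_le[OF j] of_nat_le_iff by blast
  then show ?thesis using j q_ge_2 by (simp add: field_simps)
qed

lemma sum_inv_norm_le:
  assumes "A \<subseteq> Irr" "finite K" "\<And>j. j \<in> K \<Longrightarrow> j \<ge> 1"
  shows "(\<Sum>p\<in>{p\<in>A. dg p \<in> K}. inv_norm p) \<le> (\<Sum>j\<in>K. 1 / real j)"
proof -
  have "(\<Sum>p\<in>{p\<in>A. dg p \<in> K}. inv_norm p) = (\<Sum>j\<in>K. real (card (irr j \<inter> A)) * (1 / real q ^ j))"
    unfolding inv_norm_def by (rule sum_by_degree[OF assms(1,2)])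
  also have "\<dots> \<le> (\<Sum>j\<in>K. 1 / real j)"
  proof (intro sum_mono)
    fix j assume j: "j \<in> K"
    have "card (irr j \<inter> A) \<le> card (irr j)" using finite_irr by (intro card_mono) auto
    then have "real (card (irr j \<inter> A)) * (1 / real q ^ j) \<le> real (card (irr j)) * (1 / real q ^ j)"
      by (intro mult_right_mono) auto
    also have "\<dots> \<le> 1 / real j" using card_irr_div_le assms(3)[OF j] by simp
    finally show "real (card (irr j \<inter> A)) * (1 / real q ^ j) \<le> 1 / real j" .
  qed
  finally show ?thesis .
qed

lemma sum_inv_norm_sq_le:
  assumes "A \<subseteq> Irr"
  shows "(\<Sum>p\<in>{p\<in>A. dg p \<in> {1..n}}. (inv_norm p)\<^sup>2) \<le> 1"
proof -
  have "(\<Sum>p\<in>{p\<in>A. dg p \<in> {1..n}}. (inv_norm p)\<^sup>2)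
      = (\<Sum>j\<in>{1..n}. real (card (irr j \<inter> A)) * (1 / real q ^ j)\<^sup>2)"
    unfolding inv_norm_def by (rule sum_by_degree[OF assms]) simp
  also have "\<dots> \<le> (\<Sum>j\<in>{1..n}. (1 / 2) ^ j)"
  proof (intro sum_mono)
    fix j assume j: "j \<in> {1..n}"
    have "card (irr j \<inter> A) \<le> card (irr j)" using finite_irr by (intro card_mono) auto
    then have "real (card (irr j \<inter> A)) * (1 / real q ^ j)\<^sup>2 \<le> (real (card (irr j)) * (1 / real q ^ j)) * (1 / real q ^ j)"
      unfolding power2_eq_square mult.assoc by (intro mult_right_mono) auto
    also have "\<dots> \<le> 1 * (1 / 2) ^ j"
    proof (rule mult_mono)
      have "1 / real j \<le> 1" using j by (auto simp: field_simps)
      moreover have "real (card (irr j)) / real q ^ j \<le> 1 / real j" using card_irr_div_le j by simp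
      ultimately show "real (card (irr j)) * (1 / real q ^ j) \<le> 1" by simp
      have "(2::real) ^ j \<le> real q ^ j" using q_ge_2 by (intro power_mono) auto
      then show "1 / real q ^ j \<le> (1 / 2) ^ j" by (simp add: power_one_over frac_le)
    qed auto
    finally show "real (card (irr j \<inter> A)) * (1 / real q ^ j)\<^sup>2 \<le> (1 / 2) ^ j" by simp
  qed
  also have "\<dots> = 1 - (1 / 2) ^ n"
    by (induction n) (auto simp: field_simps)
  also have "\<dots> \<le> 1" by simp
  finally show ?thesis .
qed

text \<open>Only the upper bound \<open>q ^ j / j\<close> for the number of primes enters. In the
  exponent, 1 is the excess of the harmonic sum over the logarithm and 2 comes from the
  squares.\<close>

lemma mertens_lower:
  assumes "A \<subseteq> Irr"
  shows "(\<Prod>p\<in>{p\<in>A. dg p \<in> {1..2 ^ b}}. 1 - inv_norm p) \<ge> exp (-3) / 2 ^ b"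
proof -
  let ?A = "{p\<in>A. dg p \<in> {1..2 ^ b}}"
  have fin: "finite ?A"
    by (rule rev_finite_subset[OF finite_irr_Union[of "{1..2 ^ b}"]]) (use assms in auto)
  have "(\<Sum>p\<in>?A. inv_norm p) \<le> (\<Sum>j\<in>{1..2 ^ b}. 1 / real j)"
    by (rule sum_inv_norm_le) (use assms in auto)
  also have "\<dots> \<le> 1 + ln (real (2 ^ b))" by (rule sum_inverse_le_ln) simp
  finally have s: "(\<Sum>p\<in>?A. inv_norm p) \<le> 1 + ln (2 ^ b)" by simp
  have "exp (-3) / 2 ^ b = exp (-3) * exp (- ln (2 ^ b :: real))"
    by (simp add: exp_minus divide_inverse)
  also have "\<dots> = exp (- (1 + ln (2 ^ b :: real)) - 2)"
    by (simp add: exp_add[symmetric])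
  also have "\<dots> \<le> exp (- (\<Sum>p\<in>?A. inv_norm p) - 2 * (\<Sum>p\<in>?A. (inv_norm p)\<^sup>2))"
    using s sum_inv_norm_sq_le[OF assms, of "2 ^ b"] by simp
  also have "\<dots> \<le> (\<Prod>p\<in>?A. 1 - inv_norm p)"
    by (rule prod_one_minus_ge_exp[OF fin]) (use assms inv_norm_bounds in auto)
  finally show ?thesis .
qed

end

lemma sum_UNION_le_nat:
  fixes h :: "'a \<Rightarrow> nat"
  assumes "finite T" "\<And>t. t \<in> T \<Longrightarrow> finite (g t)"
  shows "(\<Sum>p\<in>(\<Union>t\<in>T. g t). h p) \<le> (\<Sum>t\<in>T. \<Sum>p\<in>g t. h p)"
  using assms
proof (induction T rule: finite_induct)
  case (insert t T)
  have "(\<Sum>p\<in>g t \<union> (\<Union>s\<in>T. g s). h p) \<le> (\<Sum>p\<in>g t. h p) + (\<Sum>p\<in>(\<Union>s\<in>T. g s). h p)"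
    using insert by (subst sum.union_inter[symmetric]) auto
  then show ?case using insert by fastforce
qed simp

context factorial_degree
begin

text \<open>Each block is sieved by inclusion-exclusion up to an even level, and the blocks are
  combined by \<open>prod_diff_le\<close>. Main term and corrections factorise exactly over the
  blocks, and the corrections amount to at most half of the main term.\<close>

lemma brun_hooley_lower:
  assumes R: "equidistributed R m Q" and d: "set_mset d \<subseteq> Irr - Q"
    and n: "13 * 2 ^ b + m + mdeg d \<le> n"
  shows "real (card {f \<in> R. mdeg f = n \<and> d \<subseteq># f \<and> rough (2 ^ b) (f - d)})
      \<ge> real q ^ (n - m - mdeg d) / (2 * exp 3 * 2 ^ b)"
proof -
  define S where "S = {f \<in> R. mdeg f = n \<and> d \<subseteq># f}"
  \<comment> \<open>Divisibility of the cofactor \<open>f - d\<close> is tested, not of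
    \<open>f\<close>: small primes of \<open>d\<close> itself are allowed.\<close>
  define ind where "ind f p = (if p \<in># f - d then 1 else 0 :: real)" for f p
  define B where "B t = {p \<in> Irr - Q. dg p \<in> dyadic_degrees t}" for t
  define r where "r t = 4 + 2 * (b - t)" for t
  define w where "w = real q ^ (n - m - mdeg d)"
  let ?T = "{..b}"
  have cardS: "card {f \<in> R. mdeg f = k \<and> g \<subseteq># f} = q ^ (k - mdeg g - m)"
    if "set_mset g \<subseteq> Irr - Q" "mdeg g + m \<le> k" for g k
    using R that by (auto simp: equidistributed_def)
  have "card S = q ^ (n - mdeg d - m)"
    unfolding S_def using n d by (intro cardS) auto
  then have finS: "finite S" using q_ge_2 by (metis card.infinite not_numeral_le_zero power_not_zero)
  have S_Irr: "set_mset f \<subseteq> Irr - Q" if "f \<in> S" for f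
    using that R by (auto simp: S_def equidistributed_def)
  have finB: "finite (B t)" for t
    unfolding B_def by (rule rev_finite_subset[OF finite_irr_Union[OF finite_dyadic_degrees[of t]]]) auto
  have B_Irr: "B t \<subseteq> Irr" for t by (auto simp: B_def)
  have B_le: "dg p \<le> 2 ^ t" if "p \<in> B t" for p t
    using that dyadic_degrees_le by (auto simp: B_def)
  have disjB: "disjoint_family_on B ?T"
    unfolding disjoint_family_on_def
  proof (intro ballI impI)
    fix s t :: nat assume "s \<noteq> t"
    then have "dyadic_degrees s \<inter> dyadic_degrees t = {}"
      using dyadic_degrees_disjoint[of s t] dyadic_degrees_disjoint[of t s] by (auto simp: nat_neq_iff)
    then show "B s \<inter> B t = {}" by (auto simp: B_def)
  qed
  have UB: "(\<Union>t\<le>b. B t) = {p \<in> Irr - Q. dg p \<in> {1..2 ^ b}}"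
    unfolding Union_dyadic_degrees[symmetric] B_def by auto

  \<comment> \<open>The hypothesis \<open>n\<close> leaves room for sieving primes of total degree
    \<open>13 * 2 ^ b\<close> besides \<open>d\<close> and the modulus.\<close>
  have dens: "(\<Sum>f\<in>S. \<Prod>p\<in>U. ind f p) = w * (\<Prod>p\<in>U. inv_norm p)"
    if U: "finite U" "U \<subseteq> Irr - Q" "(\<Sum>p\<in>U. dg p) \<le> 13 * 2 ^ b" for U
  proof -
    have prod_ind: "(\<Prod>p\<in>U. ind f p) = (if d + mset_set U \<subseteq># f then 1 else 0)" if f: "f \<in> S" for f
    proof -
      have "d \<subseteq># f" using f by (simp add: S_def)
      then have "d + mset_set U \<subseteq># f \<longleftrightarrow> mset_set U \<subseteq># f - d"
        by (metis add.commute subset_eq_diff_conv subset_mset.add_diff_assoc2 subset_mset.le_diff_conv2)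
      also have "\<dots> \<longleftrightarrow> U \<subseteq> set_mset (f - d)"
        using U(1) by (auto simp: subseteq_mset_def count_mset_set' Suc_le_eq in_diff_count subset_iff)
      finally show ?thesis
        using U(1) by (auto simp: ind_def prod_zero_iff subset_iff)
    qed
    have "(\<Sum>f\<in>S. \<Prod>p\<in>U. ind f p) = (\<Sum>f\<in>S. if d + mset_set U \<subseteq># f then 1 else 0)"
      by (intro sum.cong refl prod_ind)
    also have "\<dots> = real (card {f \<in> S. d + mset_set U \<subseteq># f})"
      using finS by (simp add: sum.If_cases Int_def)
    also have "{f \<in> S. d + mset_set U \<subseteq># f} = {f \<in> R. mdeg f = n \<and> d + mset_set U \<subseteq># f}"
      unfolding S_def by (blast intro: subset_mset.order_trans[OF mset_subset_eq_add_left])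
    also have "real (card \<dots>) = real (q ^ (n - mdeg (d + mset_set U) - m))"
      using U n d by (subst cardS) (auto simp: mdeg_mset_set)
    also have "\<dots> = w * (1 / real q ^ (\<Sum>p\<in>U. dg p))"
    proof -
      have "n - m - mdeg d = (n - mdeg (d + mset_set U) - m) + (\<Sum>p\<in>U. dg p)"
        using U n by (simp add: mdeg_mset_set)
      then show ?thesis using q_ge_2 by (simp add: w_def power_add)
    qed
    finally show ?thesis using prod_inv_norm[OF U(1)] by simp
  qed

  \<comment> \<open>One computation serves all terms: for \<open>s \<le> b\<close> the block
    \<open>s\<close> carries its error term, with one extra prime; for \<open>s = Suc b\<close> no
    block does, which gives the main product.\<close>
  define \<U> where "\<U> s t = (if t = s then {U. U \<subseteq> B t \<and> card U = Suc (r t)} else {U. U \<subseteq> B t \<and> card U \<le> r t})" for s t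
  define co where "co s t U = (if t = s then 1 else (-1) ^ card U :: real)" for s t :: nat and U :: "'p set"
  define y where "y z t = truncated_sieve (B t) (r t) z" for z :: "'p \<Rightarrow> real" and t
  define e where "e z t = esym (B t) (Suc (r t)) z" for z :: "'p \<Rightarrow> real" and t
  have block: "(\<Sum>U\<in>\<U> s t. co s t U * (\<Prod>p\<in>U. z p)) = (if t = s then e z t else y z t)" for s t :: nat and z :: "'p \<Rightarrow> real"
    by (simp add: \<U>_def co_def e_def y_def esym_def truncated_sieve_def)
  have mean: "(\<Sum>f\<in>S. \<Prod>t\<le>b. if t = s then e (ind f) t else y (ind f) t)
      = w * (\<Prod>t\<le>b. if t = s then e inv_norm t else y inv_norm t)" for s :: nat
  proof -
    have "(\<Sum>f\<in>S. \<Prod>t\<in>?T. \<Sum>U\<in>\<U> s t. co s t U * (\<Prod>p\<in>U. ind f p))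
       = w * (\<Prod>t\<in>?T. \<Sum>U\<in>\<U> s t. co s t U * (\<Prod>p\<in>U. inv_norm p))"
    proof (rule mean_prod_block_sums[OF _ finB disjB])
      show "\<U> s t \<subseteq> Pow (B t)" for t by (auto simp: \<U>_def)
      fix g assume g: "g \<in> (\<Pi>\<^sub>E t\<in>?T. \<U> s t)"
      have gB: "g t \<subseteq> B t" and gc: "card (g t) \<le> r t + (if t = s then 1 else 0)" if "t \<le> b" for t
        using g that by (auto simp: \<U>_def PiE_iff split: if_splits)
      have "(\<Sum>p\<in>(\<Union>t\<in>?T. g t). dg p) \<le> (\<Sum>t\<le>b. \<Sum>p\<in>g t. dg p)"
        by (rule sum_UNION_le_nat) (use gB finB finite_subset in blast)+
      \<comment> \<open>The extra prime of block \<open>s\<close> has degree at most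
        \<open>2 ^ b\<close>, which raises the budget from \<open>12 * 2 ^ b\<close> to
        \<open>13 * 2 ^ b\<close>.\<close>
      also have "\<dots> \<le> (\<Sum>t\<le>b. 2 ^ t * r t + (if t = s then 2 ^ b else 0))"
      proof (intro sum_mono)
        fix t assume t: "t \<in> {..b}"
        have "(\<Sum>p\<in>g t. dg p) \<le> card (g t) * 2 ^ t"
          using sum_bounded_above[of "g t" dg "2 ^ t"] gB[of t] B_le t by auto
        also have "\<dots> \<le> (r t + (if t = s then 1 else 0)) * 2 ^ t"
          using gc t by (intro mult_right_mono) auto
        also have "\<dots> \<le> 2 ^ t * r t + (if t = s then 2 ^ b else 0)"
          using t by (auto simp: algebra_simps)
        finally show "(\<Sum>p\<in>g t. dg p) \<le> 2 ^ t * r t + (if t = s then 2 ^ b else 0)" .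
      qed
      also have "\<dots> \<le> (\<Sum>t\<le>b. 2 ^ t * r t) + 2 ^ b"
        by (simp add: sum.distrib)
      also have "\<dots> \<le> 13 * 2 ^ b"
        using sum_truncation_levels[of b] by (simp add: r_def)
      finally have deg: "(\<Sum>p\<in>(\<Union>t\<in>?T. g t). dg p) \<le> 13 * 2 ^ b" .
      show "(\<Sum>f\<in>S. \<Prod>p\<in>(\<Union>t\<in>?T. g t). ind f p) = w * (\<Prod>p\<in>(\<Union>t\<in>?T. g t). inv_norm p)"
      proof (rule dens[OF _ _ deg])
        show "finite (\<Union>t\<in>?T. g t)" using gB finB finite_subset by blast
        show "(\<Union>t\<in>?T. g t) \<subseteq> Irr - Q" using gB by (auto simp: B_def)
      qed
    qed auto
    then show ?thesis by (simp only: block)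
  qed
  have split_l: "(\<Prod>t\<le>b. if t = l then e z t else y z t) = e z l * (\<Prod>t\<in>?T - {l}. y z t)" if "l \<le> b" for l z
    using that by (subst prod.remove[of _ l]) (auto intro!: prod.cong)
  have split_main: "(\<Prod>t\<le>b. if t = Suc b then e z t else y z t) = (\<Prod>t\<le>b. y z t)" for z
    by (intro prod.cong) auto

  \<comment> \<open>On each \<open>f\<close> the product of all \<open>v t\<close> is the indicator
    of a rough cofactor, and every \<open>y (ind f) t\<close> is an upper bound for its factor
    \<open>v t\<close>.\<close>
  have pointwise: "(\<Prod>t\<le>b. y (ind f) t) - (\<Sum>l\<le>b. e (ind f) l * (\<Prod>t\<in>?T - {l}. y (ind f) t))
      \<le> (if rough (2 ^ b) (f - d) then 1 else 0)" if f: "f \<in> S" for f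
  proof -
    define v where "v t = (\<Prod>p\<in>B t. 1 - ind f p)" for t
    have ind01: "0 \<le> ind f p \<and> ind f p \<le> 1" for p by (simp add: ind_def)
    have v: "0 \<le> v t \<and> v t \<le> y (ind f) t" for t
      unfolding v_def y_def using ind01 finB truncated_sieve_ge[of "B t" "ind f" "r t"]
      by (auto intro!: prod_nonneg simp: r_def)
    have ve: "y (ind f) t - v t \<le> e (ind f) t" for t
      unfolding v_def y_def e_def using ind01 finB by (intro truncated_sieve_le) (auto simp: r_def)
    have "(\<Prod>t\<le>b. y (ind f) t) - (\<Prod>t\<le>b. v t)
        \<le> (\<Sum>l\<le>b. (y (ind f) l - v l) * (\<Prod>t\<in>?T - {l}. y (ind f) t))"
      using v by (intro prod_diff_le) auto
    also have "\<dots> \<le> (\<Sum>l\<le>b. e (ind f) l * (\<Prod>t\<in>?T - {l}. y (ind f) t))"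
      using v ve by (intro sum_mono mult_right_mono prod_nonneg) (auto intro: order_trans)
    finally have "(\<Prod>t\<le>b. y (ind f) t) - (\<Sum>l\<le>b. e (ind f) l * (\<Prod>t\<in>?T - {l}. y (ind f) t)) \<le> (\<Prod>t\<le>b. v t)"
      by linarith
    also have "(\<Prod>t\<le>b. v t) \<le> (if rough (2 ^ b) (f - d) then 1 else 0)"
    proof (cases "rough (2 ^ b) (f - d)")
      case True
      have "v t \<le> 1" for t unfolding v_def using ind01 by (intro prod_le_1) auto
      then show ?thesis using True v by (auto intro!: prod_le_1)
    next
      case False
      then obtain p where p: "p \<in># f - d" "dg p \<le> 2 ^ b" by (auto simp: rough_def not_less)
      then have "p \<in> Irr - Q" using S_Irr[OF f] by (auto dest: in_diffD)
      then have "p \<in> (\<Union>t\<le>b. B t)" unfolding UB using p dg_pos by auto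
      then obtain t where t: "t \<le> b" "p \<in> B t" by auto
      then have "v t = 0" unfolding v_def using finB p by (auto simp: ind_def intro!: prod_zero)
      then have "(\<Prod>t\<le>b. v t) = 0" using t by (intro prod_zero) auto
      then show ?thesis by (simp only: False if_False order_refl)
    qed
    finally show ?thesis .
  qed

  have inv: "0 \<le> inv_norm p \<and> inv_norm p \<le> 1 / 2" if "p \<in> B t" for p t
    using that B_Irr inv_norm_bounds by blast
  have V_le: "(\<Prod>p\<in>B t. 1 - inv_norm p) \<le> y inv_norm t" for t
    unfolding y_def
  proof (rule truncated_sieve_ge[OF finB])
    show "0 \<le> inv_norm p \<and> inv_norm p \<le> 1" if "p \<in> B t" for p using inv[OF that] by linarith
  qed (simp add: r_def)
  have mass: "(\<Sum>p\<in>B t. inv_norm p) \<le> 1" for t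
    using sum_inv_norm_le[of "Irr - Q" "dyadic_degrees t"] finite_dyadic_degrees dyadic_degrees_pos
      sum_inverse_dyadic[of t] unfolding B_def by fastforce
  \<comment> \<open>A lower bound for a single block is needed because a correction term lacks the
    factor of its own block; restoring it costs at most 9.\<close>
  have V_ge: "(\<Prod>p\<in>B t. 1 - inv_norm p) \<ge> 1 / 9" for t
  proof -
    have "(\<Sum>p\<in>B t. (inv_norm p)\<^sup>2) \<le> (\<Sum>p\<in>B t. inv_norm p * (1 / 2))"
      unfolding power2_eq_square using inv by (intro sum_mono mult_left_mono) auto
    also have "\<dots> \<le> 1 / 2" using mass[of t] by (simp add: sum_divide_distrib[symmetric])
    finally have sq: "(\<Sum>p\<in>B t. (inv_norm p)\<^sup>2) \<le> 1 / 2" .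
    have "exp 2 \<le> (9::real)"
    proof -
      have "exp (1 + 1) = exp 1 * (exp 1 :: real)" by (rule exp_add)
      also have "\<dots> \<le> 3 * 3" using exp_le by (intro mult_mono) auto
      finally show ?thesis by simp
    qed
    then have "1 / 9 \<le> exp (-2 :: real)" by (simp add: exp_minus field_simps)
    also have "\<dots> \<le> exp (- (\<Sum>p\<in>B t. inv_norm p) - 2 * (\<Sum>p\<in>B t. (inv_norm p)\<^sup>2))"
      using mass[of t] sq by simp
    also have "\<dots> \<le> (\<Prod>p\<in>B t. 1 - inv_norm p)"
      using inv by (intro prod_one_minus_ge_exp finB)
    finally show ?thesis .
  qed
  have y_ge: "y inv_norm t \<ge> 1 / 9" for t using V_le[of t] V_ge[of t] by linarith
  have y_0: "y inv_norm t \<ge> 0" for t using y_ge[of t] by linarith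
  have e_le: "e inv_norm t \<le> 1 / fact (Suc (r t))" for t
  proof -
    have "e inv_norm t \<le> (\<Sum>p\<in>B t. inv_norm p) ^ Suc (r t) / fact (Suc (r t))"
      unfolding e_def using inv finB by (intro esym_le_power) auto
    also have "\<dots> \<le> 1 ^ Suc (r t) / fact (Suc (r t))"
      using mass[of t] inv by (intro divide_right_mono power_mono sum_nonneg) auto
    finally show ?thesis by simp
  qed
  define E where "E = (\<Prod>t\<le>b. y inv_norm t)"
  have E_ge: "E \<ge> exp (-3) / 2 ^ b"
  proof -
    have "exp (-3) / 2 ^ b \<le> (\<Prod>p\<in>(\<Union>t\<le>b. B t). 1 - inv_norm p)"
      unfolding UB by (rule mertens_lower) auto
    also have "\<dots> = (\<Prod>t\<le>b. \<Prod>p\<in>B t. 1 - inv_norm p)"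
      using disjB finB by (intro prod.UNION_disjoint) (auto simp: disjoint_family_on_def)
    also have "\<dots> \<le> E"
      unfolding E_def using V_le inv by (intro prod_mono) (force intro!: prod_nonneg)
    finally show ?thesis .
  qed
  then have E0: "E \<ge> 0" by (rule order_trans[rotated]) simp
  have "(\<Sum>l\<le>b. e inv_norm l * (\<Prod>t\<in>?T - {l}. y inv_norm t)) \<le> (\<Sum>l\<le>b. 1 / fact (Suc (r l)) * (9 * E))"
  proof (intro sum_mono mult_mono e_le)
    fix l assume l: "l \<in> {..b}"
    have P0: "(\<Prod>t\<in>?T - {l}. y inv_norm t) \<ge> 0"
      using y_0 by (intro prod_nonneg) auto
    then show "(\<Prod>t\<in>?T - {l}. y inv_norm t) \<ge> 0" .
    have "1 * (\<Prod>t\<in>?T - {l}. y inv_norm t) \<le> (9 * y inv_norm l) * (\<Prod>t\<in>?T - {l}. y inv_norm t)"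
      using y_ge[of l] P0 by (intro mult_right_mono) auto
    also have "\<dots> = 9 * E" unfolding E_def using l by (subst (2) prod.remove[of _ l]) auto
    finally show "(\<Prod>t\<in>?T - {l}. y inv_norm t) \<le> 9 * E" by simp
  qed auto
  also have "\<dots> = (\<Sum>l\<le>b. 1 / fact (Suc (4 + 2 * (b - l)))) * (9 * E)"
    unfolding r_def by (rule sum_distrib_right[symmetric])
  also have "\<dots> \<le> 1 / 60 * (9 * E)"
    using sum_inverse_fact_levels E0 by (intro mult_right_mono) auto
  \<comment> \<open>Here \<open>9 / 60\<close> is compared with \<open>1 / 2\<close>.\<close>
  also have "\<dots> \<le> E / 2" using E0 by simp
  finally have err: "(\<Sum>l\<le>b. e inv_norm l * (\<Prod>t\<in>?T - {l}. y inv_norm t)) \<le> E / 2" .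

  have "w * (exp (-3) / 2 ^ b / 2) \<le> w * (E - E / 2)"
    using E_ge by (intro mult_left_mono) (auto simp: w_def)
  also have "\<dots> \<le> w * (E - (\<Sum>l\<le>b. e inv_norm l * (\<Prod>t\<in>?T - {l}. y inv_norm t)))"
    using err by (intro mult_left_mono) (auto simp: w_def)
  also have "\<dots> = (\<Sum>f\<in>S. \<Prod>t\<le>b. y (ind f) t) - (\<Sum>l\<le>b. \<Sum>f\<in>S. e (ind f) l * (\<Prod>t\<in>?T - {l}. y (ind f) t))"
  proof -
    have "(\<Sum>f\<in>S. \<Prod>t\<le>b. y (ind f) t) = w * E"
      using mean[of "Suc b"] unfolding split_main E_def .
    moreover have "(\<Sum>f\<in>S. e (ind f) l * (\<Prod>t\<in>?T - {l}. y (ind f) t))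
        = w * (e inv_norm l * (\<Prod>t\<in>?T - {l}. y inv_norm t))" if "l \<le> b" for l
      using mean[of l] unfolding split_l[OF that] .
    ultimately show ?thesis by (simp add: right_diff_distrib sum_distrib_left)
  qed
  also have "\<dots> = (\<Sum>f\<in>S. (\<Prod>t\<le>b. y (ind f) t) - (\<Sum>l\<le>b. e (ind f) l * (\<Prod>t\<in>?T - {l}. y (ind f) t)))"
    by (simp add: sum_subtractf sum.swap[of _ S])
  also have "\<dots> \<le> (\<Sum>f\<in>S. if rough (2 ^ b) (f - d) then 1 else 0)"
    by (intro sum_mono pointwise)
  also have "\<dots> = real (card {f \<in> S. rough (2 ^ b) (f - d)})"
    using finS by (simp add: sum.If_cases Int_def)
  also have "{f \<in> S. rough (2 ^ b) (f - d)} = {f \<in> R. mdeg f = n \<and> d \<subseteq># f \<and> rough (2 ^ b) (f - d)}"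
    by (auto simp: S_def)
  finally show ?thesis by (simp add: w_def exp_minus field_simps)
qed

end

section \<open>Degrees of divisors: the second moment\<close>

lemma sum_PiE_insert:
  assumes "l \<notin> A"
  shows "(\<Sum>t\<in>Pi\<^sub>E (insert l A) B. h t) = (\<Sum>g\<in>Pi\<^sub>E A B. \<Sum>p\<in>B l. h (g(l := p)))"
proof -
  have "(\<Sum>t\<in>Pi\<^sub>E (insert l A) B. h t) = (\<Sum>(p, g)\<in>B l \<times> Pi\<^sub>E A B. h (g(l := p)))"
    unfolding PiE_insert_eq by (subst sum.reindex[OF inj_combinator[OF assms]]) (simp add: case_prod_unfold comp_def)
  also have "\<dots> = (\<Sum>p\<in>B l. \<Sum>g\<in>Pi\<^sub>E A B. h (g(l := p)))"
    by (rule sum.cartesian_product[symmetric])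
  also have "\<dots> = (\<Sum>g\<in>Pi\<^sub>E A B. \<Sum>p\<in>B l. h (g(l := p)))"
    by (rule sum.swap)
  finally show ?thesis .
qed

lemma crowding_ge_1: "J > 0 \<Longrightarrow> crowding J f \<ge> 1"
proof -
  assume J: "J > 0"
  have "1 \<le> (2::real) ^ num_below J f 0 / 2 ^ 0" by simp
  also have "\<dots> \<le> crowding J f"
    unfolding crowding_def using J by (intro member_le_sum) auto
  finally show ?thesis .
qed

context factorial_degree
begin

text \<open>Once all coordinates other than \<open>l\<close> are fixed, the equation determines the
  degree of the prime at \<open>l\<close>; the primes of one degree \<open>s\<close> have total mass
  at most \<open>1 / s\<close>, and only degrees from \<open>c\<close> on occur.\<close>

lemma degree_coincidence_mass:
  assumes I: "finite I" "Y \<subseteq> I" "Y' \<subseteq> I" "l \<in> Y" "l \<notin> Y'"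
    and B: "\<And>k. k \<in> I \<Longrightarrow> finite (B k) \<and> B k \<subseteq> Irr"
    and big: "\<And>p. p \<in> B l \<Longrightarrow> c \<le> dg p" and c: "c > 0"
  shows "(\<Sum>t\<in>Pi\<^sub>E I B. if (\<Sum>k\<in>Y. dg (t k)) = (\<Sum>k\<in>Y'. dg (t k)) then \<Prod>k\<in>I. inv_norm (t k) else 0)
      \<le> 1 / real c * (\<Prod>k\<in>I - {l}. \<Sum>p\<in>B k. inv_norm p)"
proof -
  define A where "A = I - {l}"
  have lA: "l \<notin> A" and IA: "I = insert l A" and finA: "finite A" using I by (auto simp: A_def)
  have w0: "0 \<le> inv_norm p" for p by (simp add: inv_norm_def)
  have inner: "(\<Sum>p\<in>B l. if (\<Sum>k\<in>Y. dg ((g(l := p)) k)) = (\<Sum>k\<in>Y'. dg ((g(l := p)) k))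
        then \<Prod>k\<in>I. inv_norm ((g(l := p)) k) else 0) \<le> 1 / real c * (\<Prod>k\<in>A. inv_norm (g k))" for g
  proof -
    \<comment> \<open>If the subtraction truncates, then \<open>s = 0\<close>, a degree that no
      prime of \<open>B l\<close> has.\<close>
    define s where "s = (\<Sum>k\<in>Y'. dg (g k)) - (\<Sum>k\<in>Y - {l}. dg (g k))"
    have finY: "finite Y" using I finite_subset by blast
    have "(\<Sum>p\<in>B l. if (\<Sum>k\<in>Y. dg ((g(l := p)) k)) = (\<Sum>k\<in>Y'. dg ((g(l := p)) k))
        then \<Prod>k\<in>I. inv_norm ((g(l := p)) k) else 0)
      \<le> (\<Sum>p\<in>B l. if dg p = s then inv_norm p * (\<Prod>k\<in>A. inv_norm (g k)) else 0)"
    proof (intro sum_mono)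
      fix p assume p: "p \<in> B l"
      have e1: "(\<Sum>k\<in>Y. dg ((g(l := p)) k)) = dg p + (\<Sum>k\<in>Y - {l}. dg (g k))"
        using finY I by (subst sum.remove[of Y l]) (auto intro!: sum.cong)
      have e2: "(\<Sum>k\<in>Y'. dg ((g(l := p)) k)) = (\<Sum>k\<in>Y'. dg (g k))"
        using I by (intro sum.cong) auto
      have e3: "(\<Prod>k\<in>I. inv_norm ((g(l := p)) k)) = inv_norm p * (\<Prod>k\<in>A. inv_norm (g k))"
        unfolding IA using finA lA by (subst prod.insert) (auto intro!: prod.cong)
      have "dg p = s" if "dg p + (\<Sum>k\<in>Y - {l}. dg (g k)) = (\<Sum>k\<in>Y'. dg (g k))"
        using that by (simp add: s_def)
      then show "(if (\<Sum>k\<in>Y. dg ((g(l := p)) k)) = (\<Sum>k\<in>Y'. dg ((g(l := p)) k))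
          then \<Prod>k\<in>I. inv_norm ((g(l := p)) k) else 0)
        \<le> (if dg p = s then inv_norm p * (\<Prod>k\<in>A. inv_norm (g k)) else 0)"
        unfolding e1 e2 e3 using w0 by (auto intro!: mult_nonneg_nonneg prod_nonneg)
    qed
    also have "\<dots> = (\<Sum>p\<in>{p\<in>B l. dg p \<in> {s}}. inv_norm p) * (\<Prod>k\<in>A. inv_norm (g k))"
    proof -
      have "finite (B l)" using B[of l] I by auto
      then show ?thesis
        by (simp only: singleton_iff sum.inter_filter sum_distrib_right) (intro sum.cong, auto)
    qed
    also have "\<dots> \<le> 1 / real c * (\<Prod>k\<in>A. inv_norm (g k))"
    proof (rule mult_right_mono)
      show "(\<Sum>p\<in>{p\<in>B l. dg p \<in> {s}}. inv_norm p) \<le> 1 / real c"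
      proof (cases "c \<le> s")
        case True
        have "(\<Sum>p\<in>{p\<in>B l. dg p \<in> {s}}. inv_norm p) \<le> (\<Sum>j\<in>{s}. 1 / real j)"
          using B[of l] I True c by (intro sum_inv_norm_le) auto
        also have "\<dots> \<le> 1 / real c" using True c by (simp add: frac_le)
        finally show ?thesis .
      next
        case False
        then have "{p\<in>B l. dg p \<in> {s}} = {}" using big by auto
        then show ?thesis by (simp only: sum.empty) simp
      qed
    qed (use w0 in \<open>auto intro: prod_nonneg\<close>)
    finally show ?thesis .
  qed
  have "(\<Sum>t\<in>Pi\<^sub>E I B. if (\<Sum>k\<in>Y. dg (t k)) = (\<Sum>k\<in>Y'. dg (t k)) then \<Prod>k\<in>I. inv_norm (t k) else 0)
     = (\<Sum>g\<in>Pi\<^sub>E A B. \<Sum>p\<in>B l. if (\<Sum>k\<in>Y. dg ((g(l := p)) k)) = (\<Sum>k\<in>Y'. dg ((g(l := p)) k))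
        then \<Prod>k\<in>I. inv_norm ((g(l := p)) k) else 0)"
    by (subst (1) IA) (rule sum_PiE_insert[OF lA])
  also have "\<dots> \<le> (\<Sum>g\<in>Pi\<^sub>E A B. 1 / real c * (\<Prod>k\<in>A. inv_norm (g k)))"
    by (intro sum_mono inner)
  also have "\<dots> = 1 / real c * (\<Sum>g\<in>Pi\<^sub>E A B. \<Prod>k\<in>A. inv_norm (g k))"
    by (rule sum_distrib_left[symmetric])
  also have "(\<Sum>g\<in>Pi\<^sub>E A B. \<Prod>k\<in>A. inv_norm (g k)) = (\<Prod>k\<in>A. \<Sum>p\<in>B k. inv_norm p)"
    by (rule prod_sum_PiE[symmetric]) (use B IA finA in auto)
  finally show ?thesis by (simp add: A_def)
qed

definition subset_degrees :: "nat \<Rightarrow> (nat \<Rightarrow> 'p) \<Rightarrow> nat set" where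
  "subset_degrees J t = (\<lambda>Y. \<Sum>l\<in>Y. dg (t l)) ` Pow {..<J}"

text \<open>Second moment method: the pairs \<open>(Y, Y')\<close> of index sets with equal degree sums are counted by the
  largest bin in which \<open>Y\<close> and \<open>Y'\<close> differ. Instead of the Cauchy--Schwarz inequality we use
  \<open>(1 - \<kappa> * c)\<^sup>2 \<ge> 0\<close> with one \<open>\<kappa>\<close> for all tuples.\<close>

lemma subset_degrees_moment:
  assumes J: "J > 0" and \<phi>: "\<phi> \<in> placements J"
    and B: "\<And>i. i < J \<Longrightarrow> finite (B i) \<and> B i \<subseteq> Irr"
    and big: "\<And>i p. i < J \<Longrightarrow> p \<in> B i \<Longrightarrow> 2 * 2 ^ i \<le> dg p"
    and mass: "\<And>i. i < J \<Longrightarrow> (\<Sum>p\<in>B i. inv_norm p) \<ge> 1 / 2"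
  shows "(\<Sum>t\<in>(\<Pi>\<^sub>E l\<in>{..<J}. B (\<phi> l)). (\<Prod>l<J. inv_norm (t l)) * real (card (subset_degrees J t)))
      \<ge> 2 ^ J * (\<Prod>l<J. \<Sum>p\<in>B (\<phi> l). inv_norm p) / (2 * crowding J \<phi>)"
proof -
  define I where "I = {..<J}"
  define \<P> where "\<P> = (\<Pi>\<^sub>E l\<in>I. B (\<phi> l))"
  define w where "w t = (\<Prod>l\<in>I. inv_norm (t l))" for t
  define M where "M = (\<Prod>l\<in>I. \<Sum>p\<in>B (\<phi> l). inv_norm p)"
  define D where "D Y t = (\<Sum>l\<in>Y. dg (t l))" for Y :: "nat set" and t
  define S where "S = crowding J \<phi>"
  define \<W> where "\<W> = Pow I \<times> Pow I"
  have finI: "finite I" and finW: "finite \<W>" by (auto simp: I_def \<W>_def)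
  have \<phi>J: "\<phi> l < J" if "l \<in> I" for l using placements_less[OF \<phi>] that by (simp add: I_def)
  have B\<phi>: "finite (B (\<phi> l)) \<and> B (\<phi> l) \<subseteq> Irr" if "l \<in> I" for l using B \<phi>J that by blast
  have S1: "S \<ge> 1" unfolding S_def by (rule crowding_ge_1[OF J])
  have w0: "w t \<ge> 0" for t by (auto simp: w_def inv_norm_def intro: prod_nonneg)
  have sumw: "(\<Sum>t\<in>\<P>. w t) = M"
    unfolding \<P>_def w_def M_def by (rule prod_sum_PiE[symmetric]) (use B\<phi> finI in auto)
  then have M0: "M \<ge> 0" using w0 sum_nonneg by metis

  have coinc_l: "(\<Sum>t\<in>\<P>. if D Y t = D Y' t then w t else 0) \<le> M / 2 ^ \<phi> l"
    if Y: "Y \<subseteq> I" "Y' \<subseteq> I" "l \<in> Y" "l \<notin> Y'" for Y Y' l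
  proof -
    have l: "l \<in> I" using Y by auto
    have "(\<Sum>t\<in>\<P>. if D Y t = D Y' t then w t else 0)
       \<le> 1 / real (2 * 2 ^ \<phi> l) * (\<Prod>k\<in>I - {l}. \<Sum>p\<in>B (\<phi> k). inv_norm p)"
      unfolding \<P>_def D_def w_def
      by (rule degree_coincidence_mass[OF finI Y]) (use B\<phi> big[OF \<phi>J[OF l]] in auto)
    \<comment> \<open>The factor \<open>1 / 2\<close>, gained from the lower bound
      \<open>2 * 2 ^ \<phi> l\<close> for the degrees, is traded for the block mass at
      \<open>l\<close>, so that the full product \<open>M\<close> reappears.\<close>
    also have "\<dots> = (1 / 2) * (\<Prod>k\<in>I - {l}. \<Sum>p\<in>B (\<phi> k). inv_norm p) / 2 ^ \<phi> l"
      by simp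
    also have "\<dots> \<le> (\<Sum>p\<in>B (\<phi> l). inv_norm p) * (\<Prod>k\<in>I - {l}. \<Sum>p\<in>B (\<phi> k). inv_norm p) / 2 ^ \<phi> l"
      by (intro divide_right_mono mult_right_mono mass[OF \<phi>J[OF l]] prod_nonneg sum_nonneg ballI)
        (auto simp: inv_norm_def)
    also have "\<dots> = M / 2 ^ \<phi> l"
      unfolding M_def using finI l by (subst (2) prod.remove[of _ l]) auto
    finally show ?thesis .
  qed

  \<comment> \<open>The term of the largest differing bin is bounded by a sum over all bins
    \<open>i\<close> whose set \<open>Z i\<close> contains the whole difference. This overcounts,
    but makes the number of pairs for each \<open>i\<close> easy to bound.\<close>
  define Z where "Z i = {l \<in> I. \<phi> l \<le> i}" for i
  have coinc: "(\<Sum>t\<in>\<P>. if D Y t = D Y' t then w t else 0)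
      \<le> M * ((if Y = Y' then 1 else 0) + (\<Sum>i<J. if (Y - Y') \<union> (Y' - Y) \<subseteq> Z i then 1 / 2 ^ i else 0))"
    if Y: "(Y, Y') \<in> \<W>" for Y Y'
  proof (cases "Y = Y'")
    case True
    have "(\<Sum>i<J. if (Y - Y') \<union> (Y' - Y) \<subseteq> Z i then 1 / 2 ^ i else (0::real)) \<ge> 0"
      by (intro sum_nonneg) auto
    then show ?thesis using True sumw M0 by (simp add: ring_distribs)
  next
    case False
    let ?\<Delta> = "(Y - Y') \<union> (Y' - Y)"
    have fin: "finite ?\<Delta>" "?\<Delta> \<noteq> {}" using Y False finI finite_subset by (auto simp: \<W>_def)
    have "Max (\<phi> ` ?\<Delta>) \<in> \<phi> ` ?\<Delta>"
      by (rule Max_in) (use fin in auto)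
    then obtain l where l: "l \<in> ?\<Delta>" "\<phi> l = Max (\<phi> ` ?\<Delta>)"
      by (metis imageE)
    have sub: "?\<Delta> \<subseteq> Z (\<phi> l)"
      using Y fin by (auto simp: Z_def l(2) \<W>_def)
    have "l \<in> I" using l(1) Y by (auto simp: \<W>_def)
    then have lJ: "\<phi> l < J" by (rule \<phi>J)
    have "(\<Sum>t\<in>\<P>. if D Y t = D Y' t then w t else 0) \<le> M / 2 ^ \<phi> l"
    proof (cases "l \<in> Y")
      case True
      then show ?thesis using coinc_l[of Y Y' l] Y l(1) by (auto simp: \<W>_def)
    next
      case False
      then have "(\<Sum>t\<in>\<P>. if D Y' t = D Y t then w t else 0) \<le> M / 2 ^ \<phi> l"
        using coinc_l[of Y' Y l] Y l(1) by (auto simp: \<W>_def)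
      then show ?thesis by (simp only: eq_commute[of "D Y' _"])
    qed
    also have "\<dots> = M * (if ?\<Delta> \<subseteq> Z (\<phi> l) then 1 / 2 ^ \<phi> l else 0)" using sub by simp
    also have "\<dots> \<le> M * (\<Sum>i<J. if ?\<Delta> \<subseteq> Z i then 1 / 2 ^ i else 0)"
      using lJ M0 by (intro mult_left_mono member_le_sum) auto
    finally show ?thesis using False by simp
  qed
  have pairs: "real (card {(Y, Y') \<in> \<W>. (Y - Y') \<union> (Y' - Y) \<subseteq> Z i}) \<le> 2 ^ J * 2 ^ num_below J \<phi> i" for i
  proof -
    have finZ: "finite (Z i)" using finI by (simp add: Z_def)
    \<comment> \<open>A pair is determined by \<open>Y\<close> and the symmetric difference, and the
      latter is an arbitrary subset of \<open>Z i\<close>.\<close>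
    have "card {(Y, Y') \<in> \<W>. (Y - Y') \<union> (Y' - Y) \<subseteq> Z i} \<le> card (Pow I \<times> Pow (Z i))"
    proof (rule card_inj_on_le[where f = "\<lambda>(Y, Y'). (Y, (Y - Y') \<union> (Y' - Y))"])
      show "inj_on (\<lambda>(Y, Y'). (Y, (Y - Y') \<union> (Y' - Y))) {(Y, Y') \<in> \<W>. (Y - Y') \<union> (Y' - Y) \<subseteq> Z i}"
        by (rule inj_onI) (clarsimp simp: set_eq_iff, blast)
    qed (use finI finZ in \<open>auto simp: \<W>_def\<close>)
    also have "\<dots> = 2 ^ J * 2 ^ num_below J \<phi> i"
      using finI finZ by (simp add: card_cartesian_product card_Pow num_below_def Z_def I_def)
    finally have "real (card {(Y, Y') \<in> \<W>. (Y - Y') \<union> (Y' - Y) \<subseteq> Z i}) \<le> real (2 ^ J * 2 ^ num_below J \<phi> i)"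
      by (rule of_nat_mono)
    then show ?thesis by simp
  qed

  define R2 where "R2 t = (\<Sum>(Y, Y')\<in>\<W>. if D Y t = D Y' t then 1 else 0 :: real)" for t
  have R2: "(\<Sum>t\<in>\<P>. w t * R2 t) \<le> 2 ^ J * M * (2 * S)"
  proof -
    have "(\<Sum>t\<in>\<P>. w t * R2 t) = (\<Sum>t\<in>\<P>. \<Sum>(Y, Y')\<in>\<W>. if D Y t = D Y' t then w t else 0)"
      unfolding R2_def sum_distrib_left by (intro sum.cong refl) auto
    also have "\<dots> = (\<Sum>(Y, Y')\<in>\<W>. \<Sum>t\<in>\<P>. if D Y t = D Y' t then w t else 0)"
      by (simp add: case_prod_unfold sum.swap[of _ \<P>])
    also have "\<dots> \<le> (\<Sum>(Y, Y')\<in>\<W>. M * ((if Y = Y' then 1 else 0)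
        + (\<Sum>i<J. if (Y - Y') \<union> (Y' - Y) \<subseteq> Z i then 1 / 2 ^ i else 0)))"
      using coinc by (intro sum_mono) auto
    also have "\<dots> = M * ((\<Sum>(Y, Y')\<in>\<W>. if Y = Y' then 1 else 0)
        + (\<Sum>i<J. \<Sum>(Y, Y')\<in>\<W>. if (Y - Y') \<union> (Y' - Y) \<subseteq> Z i then 1 / 2 ^ i else 0))"
      by (simp add: case_prod_unfold sum_distrib_left[symmetric] sum.distrib sum.swap[of _ \<W>])
    also have "\<dots> \<le> M * (2 ^ J + (\<Sum>i<J. 2 ^ J * (2 ^ num_below J \<phi> i / 2 ^ i)))"
    proof (intro mult_left_mono add_mono sum_mono M0)
      have "(\<Sum>(Y, Y')\<in>\<W>. if Y = Y' then 1 else 0 :: real) = real (card {(Y, Y') \<in> \<W>. Y = Y'})"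
        using finW by (simp add: case_prod_unfold sum.If_cases Int_def)
      also have "{(Y, Y') \<in> \<W>. Y = Y'} = (\<lambda>Y. (Y, Y)) ` Pow I" by (auto simp: \<W>_def)
      also have "card \<dots> \<le> card (Pow I)" using finI by (intro card_image_le) auto
      also have "card (Pow I) = 2 ^ J" using finI by (simp add: card_Pow I_def)
      finally show "(\<Sum>(Y, Y')\<in>\<W>. if Y = Y' then 1 else 0 :: real) \<le> 2 ^ J" by simp
    next
      fix i
      have "(\<Sum>(Y, Y')\<in>\<W>. if (Y - Y') \<union> (Y' - Y) \<subseteq> Z i then 1 / 2 ^ i else (0::real))
         = real (card {(Y, Y') \<in> \<W>. (Y - Y') \<union> (Y' - Y) \<subseteq> Z i}) * (1 / 2 ^ i)"
        using finW by (simp add: case_prod_unfold sum.If_cases Int_def)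
      also have "\<dots> \<le> 2 ^ J * 2 ^ num_below J \<phi> i * (1 / 2 ^ i)"
        by (intro mult_right_mono pairs) auto
      finally show "(\<Sum>(Y, Y')\<in>\<W>. if (Y - Y') \<union> (Y' - Y) \<subseteq> Z i then 1 / 2 ^ i else (0::real))
         \<le> 2 ^ J * (2 ^ num_below J \<phi> i / 2 ^ i)" by simp
    qed
    also have "\<dots> = M * (2 ^ J * (1 + S))"
      by (simp add: S_def crowding_def sum_distrib_left ring_distribs)
    also have "\<dots> \<le> M * (2 ^ J * (2 * S))"
      using S1 M0 by (intro mult_left_mono) auto
    finally show ?thesis by (simp add: mult_ac)
  qed

  have card_D: "real (card (subset_degrees J t)) \<ge> 2 * (1 / (2 * S)) * 2 ^ J - (1 / (2 * S))\<^sup>2 * R2 t" for t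
  proof -
    define c where "c y = real (card {Y \<in> Pow I. D Y t = y})" for y
    have sd: "subset_degrees J t = (\<lambda>Y. D Y t) ` Pow I" by (simp add: subset_degrees_def D_def I_def)
    have finsd: "finite (subset_degrees J t)" using finI by (simp add: sd)
    have sumc: "(\<Sum>y\<in>subset_degrees J t. c y) = 2 ^ J"
    proof -
      have "(\<Sum>y\<in>subset_degrees J t. \<Sum>Y | Y \<in> Pow I \<and> D Y t = y. 1) = (\<Sum>Y\<in>Pow I. 1 :: real)"
        using finI finsd by (intro sum.group) (auto simp: sd)
      then show ?thesis using finI by (simp add: c_def card_Pow I_def)
    qed
    have sumc2: "(\<Sum>y\<in>subset_degrees J t. (c y)\<^sup>2) = R2 t"
    proof -
      have "R2 t = (\<Sum>Y\<in>Pow I. \<Sum>Y'\<in>Pow I. if D Y t = D Y' t then 1 else 0)"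
        unfolding R2_def \<W>_def by (rule sum.cartesian_product[symmetric])
      also have "\<dots> = (\<Sum>Y\<in>Pow I. c (D Y t))"
      proof (intro sum.cong refl)
        fix Y
        have "(\<Sum>Y'\<in>Pow I. if D Y t = D Y' t then 1 else 0 :: real) = real (card {Y' \<in> Pow I. D Y t = D Y' t})"
          using finI by (simp add: sum.If_cases Int_def)
        then show "(\<Sum>Y'\<in>Pow I. if D Y t = D Y' t then 1 else 0) = c (D Y t)"
          by (simp add: c_def eq_commute[of "D Y t"])
      qed
      also have "\<dots> = (\<Sum>y\<in>subset_degrees J t. \<Sum>Y | Y \<in> Pow I \<and> D Y t = y. c (D Y t))"
        using finI finsd by (intro sum.group[symmetric]) (auto simp: sd)
      also have "\<dots> = (\<Sum>y\<in>subset_degrees J t. \<Sum>Y | Y \<in> Pow I \<and> D Y t = y. c y)"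
        by (intro sum.cong refl) auto
      also have "\<dots> = (\<Sum>y\<in>subset_degrees J t. (c y)\<^sup>2)"
        by (intro sum.cong refl) (simp add: c_def power2_eq_square)
      finally show ?thesis by simp
    qed
    \<comment> \<open>The optimal choice for the bound \<open>R2\<close>: the second moment is at
      most \<open>2 * S\<close> times the first, so a typical value of \<open>c\<close> is taken to
      be \<open>2 * S\<close>.\<close>
    define \<kappa> where "\<kappa> = 1 / (2 * S)"
    have "0 \<le> (\<Sum>y\<in>subset_degrees J t. (1 - \<kappa> * c y)\<^sup>2)" by (intro sum_nonneg) auto
    also have "\<dots> = (\<Sum>y\<in>subset_degrees J t. 1 - 2 * \<kappa> * c y + \<kappa>\<^sup>2 * (c y)\<^sup>2)"
      by (intro sum.cong refl) (simp add: power2_eq_square algebra_simps)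
    also have "\<dots> = real (card (subset_degrees J t)) - 2 * \<kappa> * 2 ^ J + \<kappa>\<^sup>2 * R2 t"
      by (simp add: sum.distrib sum_subtractf sum_distrib_left[symmetric] sumc sumc2)
    finally show ?thesis by (simp add: \<kappa>_def)
  qed

  have "2 ^ J * M / (2 * S) = 2 * (1 / (2 * S)) * 2 ^ J * M - (1 / (2 * S))\<^sup>2 * (2 ^ J * M * (2 * S))"
    using S1 by (simp add: power2_eq_square field_simps)
  also have "\<dots> \<le> 2 * (1 / (2 * S)) * 2 ^ J * M - (1 / (2 * S))\<^sup>2 * (\<Sum>t\<in>\<P>. w t * R2 t)"
    using R2 by (intro diff_left_mono mult_left_mono) auto
  also have "\<dots> = (\<Sum>t\<in>\<P>. w t * (2 * (1 / (2 * S)) * 2 ^ J - (1 / (2 * S))\<^sup>2 * R2 t))"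
    by (simp add: right_diff_distrib sum_subtractf sum_distrib_left sum_distrib_right sum_divide_distrib sumw[symmetric] mult_ac)
  also have "\<dots> \<le> (\<Sum>t\<in>\<P>. w t * real (card (subset_degrees J t)))"
    using card_D w0 by (intro sum_mono mult_left_mono)
  finally show ?thesis
    by (simp add: M_def S_def w_def \<P>_def I_def)
qed

end

section \<open>Masses of the blocks and density of coprime polynomials\<close>

lemma sum_inverse_ge_ln2:
  assumes "m \<ge> 1"
  shows "(\<Sum>j\<in>{m<..2 * m}. 1 / real j) \<ge> ln 2 - 1 / real m"
proof -
  have tel: "(\<Sum>j\<in>{m<..m + k}. 1 / real j) \<ge> ln (real (m + k + 1)) - ln (real (m + 1))" for k
  proof (induction k)
    case (Suc k)
    have "ln (real (m + Suc k + 1) / real (m + Suc k)) \<le> real (m + Suc k + 1) / real (m + Suc k) - 1"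
      by (rule ln_le_minus_one) simp
    also have "\<dots> = 1 / real (m + Suc k)" by (simp add: field_simps)
    finally have "ln (real (m + Suc k + 1)) - ln (real (m + k + 1)) \<le> 1 / real (m + Suc k)"
      by (subst (asm) ln_div) auto
    moreover have "{m<..m + Suc k} = insert (m + Suc k) {m<..m + k}" by auto
    ultimately show ?case using Suc by simp
  qed simp
  have "ln (real (m + 1) / real m) \<le> real (m + 1) / real m - 1"
    using assms by (intro ln_le_minus_one) simp
  also have "\<dots> = 1 / real m" using assms by (simp add: field_simps)
  finally have a: "ln (real (m + 1)) - ln (real m) \<le> 1 / real m"
    using assms by (subst (asm) ln_div) auto
  have "ln 2 + ln (real m) = ln (real (2 * m))" using assms by (simp add: ln_mult)
  also have "\<dots> \<le> ln (real (m + m + 1))" using assms by (subst ln_le_cancel_iff) auto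
  finally show ?thesis using tel[of m] a unfolding mult_2 by linarith
qed

text \<open>Cauchy condensation: the dyadic block from \<open>2 ^ T\<close> contributes at most
  \<open>\<rho> ^ T\<close>. The explicit bound depends on \<open>\<epsilon>\<close> only, as the
  constants of the theorem must.\<close>

lemma sum_powr_dyadic_le:
  fixes \<epsilon> :: real
  assumes "\<epsilon> > 0"
  shows "(\<Sum>j\<in>{1..n}. 1 / real j powr (1 + \<epsilon>)) \<le> 1 + 1 / (1 - 2 powr (-\<epsilon>))"
proof -
  define \<rho> where "\<rho> = 2 powr (-\<epsilon>)"
  have \<rho>: "0 < \<rho>" "\<rho> < 1" using assms by (auto simp: \<rho>_def powr_less_one)
  have step: "(\<Sum>j\<in>{2 ^ T<..2 ^ Suc T}. 1 / real j powr (1 + \<epsilon>)) \<le> \<rho> ^ T" for T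
  proof -
    have "(\<Sum>j\<in>{2 ^ T<..2 ^ Suc T}. 1 / real j powr (1 + \<epsilon>))
        \<le> (\<Sum>j\<in>{2 ^ T<..2 ^ Suc T :: nat}. 1 / (2 ^ T) powr (1 + \<epsilon>))"
    proof (intro sum_mono divide_left_mono powr_mono2)
      fix j :: nat assume j: "j \<in> {2 ^ T<..2 ^ Suc T}"
      then have "2 ^ T \<le> j" by simp
      then have "real (2 ^ T) \<le> real j" by (rule of_nat_mono)
      then show "2 ^ T \<le> real j" by simp
      show "0 < real j powr (1 + \<epsilon>) * (2 ^ T) powr (1 + \<epsilon>)" using j by auto
    qed (use assms in auto)
    also have "\<dots> = 2 ^ T / (2 ^ T) powr (1 + \<epsilon>)" by simp
    also have "\<dots> = \<rho> ^ T"
      by (simp add: \<rho>_def powr_add powr_minus powr_powr powr_realpow[symmetric] mult.commute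
          power_one_over divide_simps)
    finally show ?thesis .
  qed
  have dy: "(\<Sum>j\<in>{1..2 ^ T}. 1 / real j powr (1 + \<epsilon>)) \<le> 1 + (\<Sum>t<T. \<rho> ^ t)" for T
  proof (induction T)
    case (Suc T)
    have "{1..2 ^ Suc T} = {1..2 ^ T} \<union> {2 ^ T<..2 ^ Suc T :: nat}"
      by (rule ivl_disj_un_two(8)[symmetric]) auto
    then have "(\<Sum>j\<in>{1..2 ^ Suc T}. 1 / real j powr (1 + \<epsilon>))
        = (\<Sum>j\<in>{1..2 ^ T}. 1 / real j powr (1 + \<epsilon>)) + (\<Sum>j\<in>{2 ^ T<..2 ^ Suc T}. 1 / real j powr (1 + \<epsilon>))"
      by (simp only:) (intro sum.union_disjoint, auto)
    then show ?case using Suc step[of T] by simp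
  qed simp
  have "n \<le> 2 ^ n" by (simp add: less_imp_le)
  then have "(\<Sum>j\<in>{1..n}. 1 / real j powr (1 + \<epsilon>)) \<le> (\<Sum>j\<in>{1..2 ^ n}. 1 / real j powr (1 + \<epsilon>))"
    by (intro sum_mono2) auto
  also have "\<dots> \<le> 1 + (\<Sum>t<n. \<rho> ^ t)" by (rule dy)
  also have "(\<Sum>t<n. \<rho> ^ t) = (1 - \<rho> ^ n) / (1 - \<rho>)"
    using \<rho> by (simp add: sum_gp_strict)
  also have "\<dots> \<le> 1 / (1 - \<rho>)" using \<rho> by (intro divide_right_mono) auto
  finally show ?thesis by (simp add: \<rho>_def)
qed

context factorial_degree
begin

text \<open>Per degree, the prime count loses \<open>4 / m ^ 2\<close> and the removal of
  \<open>Q\<close> loses \<open>K / m powr (1 + \<epsilon>)\<close>. Over \<open>m\<close> degrees,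
  together with the loss \<open>1 / m\<close> in the harmonic sum, this is \<open>5 / m\<close> plus
  the part from \<open>Q\<close>; \<open>\<epsilon> \<le> 1\<close> lets \<open>1 / m\<close> be
  bounded by \<open>m powr (-\<epsilon>)\<close>.\<close>

lemma block_mass_ge:
  fixes \<epsilon> K :: real
  assumes m: "m \<ge> 1" and \<epsilon>: "0 < \<epsilon>" "\<epsilon> \<le> 1" and K: "K \<ge> 0"
    and Q: "\<And>j. j \<ge> 1 \<Longrightarrow> real (card (irr j \<inter> Q)) \<le> K * (real q ^ j / real j powr (1 + \<epsilon>))"
  shows "(\<Sum>p\<in>{p \<in> Irr - Q. dg p \<in> {m<..2 * m}}. inv_norm p) \<ge> ln 2 - (5 + K) * real m powr (-\<epsilon>)"
proof -
  have term_ge: "real (card (irr j \<inter> (Irr - Q))) * (1 / real q ^ j)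
      \<ge> 1 / real j - (4 / (real m * real m) + K / real m powr (1 + \<epsilon>))" if j: "j \<in> {m<..2 * m}" for j
  proof -
    have j1: "j \<ge> 1" "m \<le> j" using j m by auto
    have q0: "real q ^ j > 0" using q_ge_2 by simp
    have "irr j \<inter> (Irr - Q) = irr j - irr j \<inter> Q" by (auto simp: irr_def)
    then have c: "real (card (irr j \<inter> (Irr - Q))) = real (card (irr j)) - real (card (irr j \<inter> Q))"
      using finite_irr by (simp add: card_Diff_subset card_mono of_nat_diff)
    \<comment> \<open>The square-root saving is weakened to \<open>2 / j\<close>. This suffices for
      summability over the blocks and holds for every \<open>q \<ge> 2\<close>.\<close>
    have half: "real q ^ (j div 2) / real q ^ j \<le> 2 / real j"
    proof -
      have "real q ^ j = real q ^ (j div 2) * real q ^ (j - j div 2)"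
        by (simp add: power_add[symmetric])
      then have "real q ^ (j div 2) / real q ^ j = 1 / real q ^ (j - j div 2)"
        using q_ge_2 by simp
      also have "\<dots> \<le> 1 / (real j / 2)"
      proof (intro divide_left_mono)
        have "j div 2 * 2 \<le> j" by simp
        then have "real (j - j div 2) \<ge> real j / 2" by linarith
        moreover have "real (j - j div 2) \<le> real (2 ^ (j - j div 2))"
          by (intro of_nat_mono) (simp add: less_imp_le)
        moreover have "(2::real) ^ (j - j div 2) \<le> real q ^ (j - j div 2)"
          using q_ge_2 by (intro power_mono) auto
        ultimately show "real j / 2 \<le> real q ^ (j - j div 2)" by simp
      qed (use j1 q_ge_2 in auto)
      finally show ?thesis by simp
    qed
    have "real (q ^ j) \<le> real (j * card (irr j) + 2 * q ^ (j div 2))"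
      using card_irr_ge[OF j1(1)] by (rule of_nat_mono)
    then have "real q ^ j \<le> real j * real (card (irr j)) + 2 * real q ^ (j div 2)" by simp
    then have "real q ^ j / real q ^ j \<le> (real j * real (card (irr j)) + 2 * real q ^ (j div 2)) / real q ^ j"
      using q0 by (intro divide_right_mono) auto
    also have "\<dots> = real j * (real (card (irr j)) / real q ^ j) + 2 * (real q ^ (j div 2) / real q ^ j)"
      by (simp add: add_divide_distrib)
    also have "\<dots> \<le> real j * (real (card (irr j)) / real q ^ j) + 2 * (2 / real j)"
      using half by simp
    finally have "1 \<le> real j * (real (card (irr j)) / real q ^ j) + 4 / real j"
      using q0 by (subst (asm) divide_self) auto
    then have "1 / real j \<le> (real j * (real (card (irr j)) / real q ^ j) + 4 / real j) / real j"
      using j1 by (intro divide_right_mono) auto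
    also have "\<dots> = real (card (irr j)) / real q ^ j + 4 / (real j * real j)"
      using j1 by (simp add: field_simps)
    finally have a: "real (card (irr j)) / real q ^ j \<ge> 1 / real j - 4 / (real j * real j)" by simp
    have b: "4 / (real j * real j) \<le> 4 / (real m * real m)"
      using j1 m by (intro divide_left_mono mult_mono mult_pos_pos) auto
    have "real (card (irr j \<inter> Q)) / real q ^ j \<le> K * (real q ^ j / real j powr (1 + \<epsilon>)) / real q ^ j"
      using Q[OF j1(1)] q0 by (intro divide_right_mono) auto
    also have "\<dots> = K / real j powr (1 + \<epsilon>)" using q0 by simp
    also have "\<dots> \<le> K / real m powr (1 + \<epsilon>)"
      using j1 m \<epsilon> K by (intro divide_left_mono powr_mono2 mult_pos_pos) auto
    finally have "real (card (irr j \<inter> Q)) / real q ^ j \<le> K / real m powr (1 + \<epsilon>)" .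
    then show ?thesis using a b by (simp add: c diff_divide_distrib)
  qed
  have mp: "1 / real m \<le> real m powr (-\<epsilon>)"
  proof -
    have "real m powr (-1) \<le> real m powr (-\<epsilon>)" using m \<epsilon> by (intro powr_mono) auto
    then show ?thesis using m by (simp add: powr_minus_divide)
  qed
  have "(\<Sum>p\<in>{p \<in> Irr - Q. dg p \<in> {m<..2 * m}}. inv_norm p)
      = (\<Sum>j\<in>{m<..2 * m}. real (card (irr j \<inter> (Irr - Q))) * (1 / real q ^ j))"
    unfolding inv_norm_def by (rule sum_by_degree) auto
  also have "\<dots> \<ge> (\<Sum>j\<in>{m<..2 * m}. 1 / real j - (4 / (real m * real m) + K / real m powr (1 + \<epsilon>)))"
    by (rule sum_mono[OF term_ge])
  also have "(\<Sum>j\<in>{m<..2 * m}. 1 / real j - (4 / (real m * real m) + K / real m powr (1 + \<epsilon>)))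
      = (\<Sum>j\<in>{m<..2 * m}. 1 / real j) - real m * (4 / (real m * real m) + K / real m powr (1 + \<epsilon>))"
    by (simp add: sum_subtractf)
  also have "real m * (4 / (real m * real m) + K / real m powr (1 + \<epsilon>)) = 4 / real m + K * real m powr (-\<epsilon>)"
    using m by (simp add: ring_distribs powr_add powr_minus field_simps)
  finally show ?thesis
    using sum_inverse_ge_ln2[OF m] mp by (simp add: ring_distribs)
qed

text \<open>Primes of \<open>Q\<close> are removed one at a time, and the multiples of
  \<open>p\<close> are counted by the same formula in degree \<open>k - dg p\<close>. The Euler
  product is exact because \<open>k\<close> leaves room for all primes of \<open>Q\<close>.\<close>

lemma card_coprime_eq:
  assumes "finite Q" "Q \<subseteq> Irr" "(\<Sum>p\<in>Q. dg p) \<le> k"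
  shows "real (card {f \<in> monics k. set_mset f \<inter> Q = {}}) = real q ^ k * (\<Prod>p\<in>Q. 1 - inv_norm p)"
  using assms
proof (induction Q arbitrary: k rule: finite_induct)
  case empty
  then show ?case by (simp add: card_monics)
next
  case (insert p Q)
  let ?A = "\<lambda>k. {f \<in> monics k. set_mset f \<inter> Q = {}}"
  have k: "dg p \<le> k" "(\<Sum>p\<in>Q. dg p) \<le> k - dg p" "(\<Sum>p\<in>Q. dg p) \<le> k" using insert by auto
  have "bij_betw (\<lambda>f. f - {#p#}) {f \<in> ?A k. p \<in># f} (?A (k - dg p))"
  proof (rule bij_betw_byWitness[where f' = "\<lambda>f. f + {#p#}"])
    show "(\<lambda>f. f - {#p#}) ` {f \<in> ?A k. p \<in># f} \<subseteq> ?A (k - dg p)"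
      by (auto simp: monics_def mdeg_diff dest: in_diffD)
    show "(\<lambda>f. f + {#p#}) ` ?A (k - dg p) \<subseteq> {f \<in> ?A k. p \<in># f}"
      using insert k by (auto simp: monics_def)
  qed auto
  then have c: "card {f \<in> ?A k. p \<in># f} = card (?A (k - dg p))" by (rule bij_betw_same_card)
  have "{f \<in> monics k. set_mset f \<inter> insert p Q = {}} = ?A k - {f \<in> ?A k. p \<in># f}" by auto
  then have "real (card {f \<in> monics k. set_mset f \<inter> insert p Q = {}}) = real (card (?A k)) - real (card {f \<in> ?A k. p \<in># f})"
  proof (simp only:, subst card_Diff_subset)
    show "finite {f \<in> ?A k. p \<in># f}" using finite_monics[of k] by simp
    have "card {f \<in> ?A k. p \<in># f} \<le> card (?A k)"
      using finite_monics[of k] by (intro card_mono) auto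
    then show "real (card (?A k) - card {f \<in> ?A k. p \<in># f}) = real (card (?A k)) - real (card {f \<in> ?A k. p \<in># f})"
      by (rule of_nat_diff)
  qed auto
  also have "\<dots> = real q ^ k * (\<Prod>p\<in>Q. 1 - inv_norm p) - real q ^ (k - dg p) * (\<Prod>p\<in>Q. 1 - inv_norm p)"
    using insert.IH[of k] insert.IH[of "k - dg p"] insert.prems k c by simp
  also have "real q ^ (k - dg p) = real q ^ k * inv_norm p"
    using k q_ge_2 by (simp add: inv_norm_def power_diff)
  finally show ?case using insert by (simp add: algebra_simps)
qed

text \<open>The hypothesis on \<open>Q\<close> bounds the sum of the inverse norms over
  \<open>Q\<close> by a constant, hence the Euler product from below. With the primes dividing
  \<open>M\<close> and \<open>k = degree M\<close>, this gives a lower bound for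
  \<open>\<Phi>(M)\<close>.\<close>

lemma card_coprime_ge:
  fixes \<epsilon> C :: real
  assumes "finite Q" "Q \<subseteq> Irr" "(\<Sum>p\<in>Q. dg p) \<le> k" and \<epsilon>: "\<epsilon> > 0" and C: "C \<ge> 0"
    and Q: "\<And>j. j \<ge> 1 \<Longrightarrow> real (card (irr j \<inter> Q)) \<le> C * (real q ^ j / real j powr (1 + \<epsilon>))"
  shows "real (card {f \<in> monics k. set_mset f \<inter> Q = {}})
      \<ge> exp (- 2 * C * (1 + 1 / (1 - 2 powr (-\<epsilon>)))) * real q ^ k"
proof -
  have inv: "0 \<le> inv_norm p \<and> inv_norm p \<le> 1 / 2" if "p \<in> Q" for p
    using inv_norm_bounds assms(2) that by auto
  have Qk: "{p\<in>Q. dg p \<in> {1..k}} = Q"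
  proof -
    have "dg p \<le> k" if "p \<in> Q" for p
      using member_le_sum[OF that, of dg] assms(1,3) by auto
    then show ?thesis using dg_pos assms(2) by auto
  qed
  have "(\<Sum>p\<in>Q. inv_norm p) = (\<Sum>j\<in>{1..k}. real (card (irr j \<inter> Q)) * (1 / real q ^ j))"
    using sum_by_degree[OF assms(2), of "{1..k}" "\<lambda>j. 1 / real q ^ j"] unfolding Qk
    by (simp add: inv_norm_def)
  also have "\<dots> \<le> (\<Sum>j\<in>{1..k}. C * (1 / real j powr (1 + \<epsilon>)))"
  proof (intro sum_mono)
    fix j assume j: "j \<in> {1..k}"
    have "real (card (irr j \<inter> Q)) * (1 / real q ^ j) \<le> C * (real q ^ j / real j powr (1 + \<epsilon>)) * (1 / real q ^ j)"
      using Q[of j] j by (intro mult_right_mono) auto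
    then show "real (card (irr j \<inter> Q)) * (1 / real q ^ j) \<le> C * (1 / real j powr (1 + \<epsilon>))"
      using q_ge_2 by simp
  qed
  also have "\<dots> \<le> C * (1 + 1 / (1 - 2 powr (-\<epsilon>)))"
    unfolding sum_distrib_left[symmetric] using C by (intro mult_left_mono sum_powr_dyadic_le \<epsilon>)
  finally have s: "(\<Sum>p\<in>Q. inv_norm p) \<le> C * (1 + 1 / (1 - 2 powr (-\<epsilon>)))" .
  have "(\<Sum>p\<in>Q. (inv_norm p)\<^sup>2) \<le> (\<Sum>p\<in>Q. inv_norm p * (1 / 2))"
    unfolding power2_eq_square using inv by (intro sum_mono mult_left_mono) auto
  then have sq: "2 * (\<Sum>p\<in>Q. (inv_norm p)\<^sup>2) \<le> (\<Sum>p\<in>Q. inv_norm p)"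
    by (simp add: sum_divide_distrib[symmetric])
  have "exp (- 2 * C * (1 + 1 / (1 - 2 powr (-\<epsilon>)))) \<le> exp (- (\<Sum>p\<in>Q. inv_norm p) - 2 * (\<Sum>p\<in>Q. (inv_norm p)\<^sup>2))"
    unfolding exp_le_cancel_iff using s sq by linarith
  also have "\<dots> \<le> (\<Prod>p\<in>Q. 1 - inv_norm p)"
    using inv by (intro prod_one_minus_ge_exp assms(1))
  finally have "exp (- 2 * C * (1 + 1 / (1 - 2 powr (-\<epsilon>)))) \<le> (\<Prod>p\<in>Q. 1 - inv_norm p)" .
  then have "real q ^ k * exp (- 2 * C * (1 + 1 / (1 - 2 powr (-\<epsilon>)))) \<le> real q ^ k * (\<Prod>p\<in>Q. 1 - inv_norm p)"
    by (intro mult_left_mono) auto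
  then show ?thesis using card_coprime_eq[OF assms(1-3)] by (simp only: mult.commute)
qed

end

section \<open>From degrees of divisors to distinct products\<close>

lemma finite_submultisets: "finite {h. h \<subseteq># g}"
  and card_submultisets_le: "card {h. h \<subseteq># g} \<le> 2 ^ size g"
proof (induction g)
  case (add p g)
  have sub: "{h. h \<subseteq># add_mset p g} \<subseteq> {h. h \<subseteq># g} \<union> add_mset p ` {h. h \<subseteq># g}"
  proof
    fix h assume "h \<in> {h. h \<subseteq># add_mset p g}"
    then have h: "h \<subseteq># add_mset p g" by simp
    show "h \<in> {h. h \<subseteq># g} \<union> add_mset p ` {h. h \<subseteq># g}"
    proof (cases "p \<in># h")
      case True
      then obtain h' where "h = add_mset p h'" by (auto dest: multi_member_split)
      then show ?thesis using h by auto
    next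
      case False
      have "count h x \<le> count g x" for x
        using mset_subset_eq_count[OF h, of x] False by (cases "x = p") (auto simp: not_in_iff)
      then have "h \<subseteq># g" by (simp add: subseteq_mset_def)
      then show ?thesis by simp
    qed
  qed
  {
    case 1
    show ?case using add(1) by (intro finite_subset[OF sub]) auto
  next
    case 2
    have "card {h. h \<subseteq># add_mset p g} \<le> card ({h. h \<subseteq># g} \<union> add_mset p ` {h. h \<subseteq># g})"
      using add(1) by (intro card_mono sub) auto
    also have "\<dots> \<le> card {h. h \<subseteq># g} + card (add_mset p ` {h. h \<subseteq># g})" by (rule card_Un_le)
    also have "\<dots> \<le> card {h. h \<subseteq># g} + card {h. h \<subseteq># g}"
      using add(1) by (intro add_left_mono card_image_le)
    finally show ?case using add(2) by simp
  }
qed auto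

lemma filter_mset_all: "\<forall>p\<in>#a. P p \<Longrightarrow> filter_mset P a = a"
  by (subst filter_mset_eq_conv) auto

context factorial_degree
begin

definition product_set :: "nat \<Rightarrow> 'p multiset set \<Rightarrow> 'p multiset set \<Rightarrow> 'p multiset set" where
  "product_set n R1 R2 = {f1 + f2 | f1 f2. f1 \<in> R1 \<and> f2 \<in> R2 \<and> mdeg f1 = n \<and> mdeg f2 = n}"

definition divisor_degrees :: "'p multiset \<Rightarrow> nat set" where
  "divisor_degrees a = mdeg ` {d. d \<subseteq># a}"

lemma finite_divisor_degrees: "finite (divisor_degrees a)"
  by (simp add: divisor_degrees_def finite_submultisets)

lemma finite_product_set:
  assumes "equidistributed R1 m1 Q1" "equidistributed R2 m2 Q2"
  shows "finite (product_set n R1 R2)"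
proof (rule finite_subset[OF _ finite_monics[of "2 * n"]])
  have "R1 \<subseteq> {f. set_mset f \<subseteq> Irr}" "R2 \<subseteq> {f. set_mset f \<subseteq> Irr}"
    using assms unfolding equidistributed_def by blast+
  then show "product_set n R1 R2 \<subseteq> monics (2 * n)"
    by (auto simp: product_set_def monics_def subset_iff)
qed

lemma size_rough_part:
  assumes "mdeg f = 2 * n" "n \<le> 52 * 2 ^ b"
  shows "size (filter_mset (\<lambda>p. 2 ^ b < dg p) f) \<le> 104"
proof -
  have "2 ^ b * size (filter_mset (\<lambda>p. 2 ^ b < dg p) g) \<le> mdeg g" for g
    by (induction g) auto
  from this[of f] have "2 ^ b * size (filter_mset (\<lambda>p. 2 ^ b < dg p) f) \<le> 2 ^ b * 104"
    using assms by linarith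
  then show ?thesis by simp
qed

text \<open>The factor \<open>a\<close> is recovered from a product \<open>f\<close> as its part of small degrees, and the rough part of \<open>f\<close>
  has at most \<open>104\<close> prime factors, hence at most \<open>2 ^ 104\<close> splittings.\<close>

lemma count_products:
  assumes R1: "equidistributed R1 m1 Q1" and R2: "equidistributed R2 m2 Q2"
    and finA: "finite \<A>"
    and A: "\<And>a. a \<in> \<A> \<Longrightarrow> set_mset a \<subseteq> Irr - (Q1 \<union> Q2)"
    and smooth: "\<And>a p. a \<in> \<A> \<Longrightarrow> p \<in># a \<Longrightarrow> dg p \<le> 2 ^ b"
    and n1: "\<And>a. a \<in> \<A> \<Longrightarrow> 13 * 2 ^ b + m1 + mdeg a \<le> n"
    and n2: "\<And>a. a \<in> \<A> \<Longrightarrow> 13 * 2 ^ b + m2 + mdeg a \<le> n"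
    and n: "n \<le> 52 * 2 ^ b"
  shows "real q ^ (2 * n - m1 - m2) / (2 * exp 3 * 2 ^ b)\<^sup>2
      * (\<Sum>a\<in>\<A>. real (card (divisor_degrees a)) / real q ^ mdeg a)
      \<le> 2 ^ 104 * real (card (product_set n R1 R2))"
proof -
  \<comment> \<open>One divisor is fixed for each degree. Since \<open>y\<close> then determines the
    divisor, the factorisation can be decoded from degrees.\<close>
  define dv where "dv a y = (SOME d. d \<subseteq># a \<and> mdeg d = y)" for a y
  have dv: "dv a y \<subseteq># a" "mdeg (dv a y) = y" if "y \<in> divisor_degrees a" for a y
  proof -
    have "\<exists>d. d \<subseteq># a \<and> mdeg d = y" using that by (auto simp: divisor_degrees_def)
    then have "dv a y \<subseteq># a \<and> mdeg (dv a y) = y" unfolding dv_def by (rule someI_ex)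
    then show "dv a y \<subseteq># a" "mdeg (dv a y) = y" by auto
  qed
  define G where "G R d = {f \<in> R. mdeg f = n \<and> d \<subseteq># f \<and> rough (2 ^ b) (f - d)}" for R d
  define \<S> where "\<S> = Sigma \<A> (\<lambda>a. Sigma (divisor_degrees a) (\<lambda>y. G R1 (dv a y) \<times> G R2 (a - dv a y)))"
  have finG: "finite (G R d)" if "R \<subseteq> {f. set_mset f \<subseteq> Irr - Q}" for R d Q
    by (rule finite_subset[OF _ finite_monics[of n]]) (use that in \<open>auto simp: G_def monics_def\<close>)
  have finG1: "finite (G R1 d)" and finG2: "finite (G R2 d)" for d
    using finG R1 R2 by (auto simp: equidistributed_def)
  let ?E = "2 * exp 3 * 2 ^ b :: real"

  have "real q ^ (2 * n - m1 - m2) / ?E\<^sup>2 * (\<Sum>a\<in>\<A>. real (card (divisor_degrees a)) / real q ^ mdeg a)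
      = (\<Sum>a\<in>\<A>. \<Sum>y\<in>divisor_degrees a. real q ^ (2 * n - m1 - m2) / ?E\<^sup>2 / real q ^ mdeg a)"
    unfolding sum_distrib_left by (intro sum.cong refl) simp
  also have "\<dots> \<le> (\<Sum>a\<in>\<A>. \<Sum>y\<in>divisor_degrees a. real (card (G R1 (dv a y) \<times> G R2 (a - dv a y))))"
  proof (intro sum_mono)
    fix a y assume a: "a \<in> \<A>" and y: "y \<in> divisor_degrees a"
    have d: "dv a y \<subseteq># a" "mdeg (dv a y) = y" using dv[OF y] by auto
    have ya: "y \<le> mdeg a" using mdeg_mono[OF d(1)] d(2) by simp
    have d2: "mdeg (a - dv a y) = mdeg a - y" using mdeg_diff[OF d(1)] d(2) by simp
    have s1: "set_mset (dv a y) \<subseteq> Irr - Q1" using A[OF a] set_mset_mono[OF d(1)] by auto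
    have s2: "set_mset (a - dv a y) \<subseteq> Irr - Q2" using A[OF a] by (auto dest: in_diffD)
    have c1: "real q ^ (n - m1 - y) / ?E \<le> real (card (G R1 (dv a y)))"
      using brun_hooley_lower[OF R1 s1, of b n] n1[OF a] ya d(2) unfolding G_def by simp
    have c2: "real q ^ (n - m2 - (mdeg a - y)) / ?E \<le> real (card (G R2 (a - dv a y)))"
      using brun_hooley_lower[OF R2 s2, of b n] n2[OF a] ya d2 unfolding G_def by simp
    \<comment> \<open>The powers of \<open>q\<close> from the two sieves combine to a value that
      does not depend on how \<open>a\<close> is split, so every degree \<open>y\<close> contributes
      equally.\<close>
    have "2 * n - m1 - m2 = (n - m1 - y) + (n - m2 - (mdeg a - y)) + mdeg a"
      using n1[OF a] n2[OF a] ya by simp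
    then have "real q ^ (2 * n - m1 - m2) / ?E\<^sup>2 / real q ^ mdeg a
        = (real q ^ (n - m1 - y) / ?E) * (real q ^ (n - m2 - (mdeg a - y)) / ?E)"
      using q_ge_2 by (simp add: power_add power2_eq_square)
    also have "\<dots> \<le> real (card (G R1 (dv a y))) * real (card (G R2 (a - dv a y)))"
      using c1 c2 by (intro mult_mono) auto
    finally show "real q ^ (2 * n - m1 - m2) / ?E\<^sup>2 / real q ^ mdeg a
        \<le> real (card (G R1 (dv a y) \<times> G R2 (a - dv a y)))"
      by (simp add: card_cartesian_product)
  qed
  also have "\<dots> = real (card \<S>)"
    unfolding \<S>_def using finA finG1 finG2 finite_divisor_degrees
    by (subst card_SigmaI; simp add: finite_SigmaI card_SigmaI)
  also have "card \<S> \<le> card (Sigma (product_set n R1 R2) (\<lambda>f. {h. h \<subseteq># filter_mset (\<lambda>p. 2 ^ b < dg p) f}))"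
  proof (rule card_inj_on_le)
    \<comment> \<open>Decoding: the small primes of \<open>f1 + f2\<close> give \<open>a\<close>,
      the degree of the rough part of \<open>f1\<close> gives \<open>y\<close>, hence
      \<open>dv a y\<close> and \<open>f1\<close>, and finally \<open>f2\<close>.\<close>
    let ?F = "\<lambda>(a, y, f1, f2). (f1 + f2, filter_mset (\<lambda>p. 2 ^ b < dg p) f1)"
    let ?sm = "filter_mset (\<lambda>p. dg p \<le> 2 ^ b)" and ?bg = "filter_mset (\<lambda>p. 2 ^ b < dg p)"
    have parts: "?sm f = d" "f = d + ?bg f" if f: "f \<in> G R d" and d: "\<And>p. p \<in># d \<Longrightarrow> dg p \<le> 2 ^ b" for f R d
    proof -
      have df: "f = d + (f - d)" using f by (simp add: G_def)
      have rough: "\<forall>p\<in>#f - d. 2 ^ b < dg p" using f by (simp add: G_def rough_def)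
      have s: "?sm d = d" "?bg d = {#}"
        using d by (auto simp: not_less intro!: filter_mset_all)
      have r: "?sm (f - d) = {#}" "?bg (f - d) = f - d"
        using rough by (simp_all only: filter_mset_eq_mempty_iff filter_mset_all) (auto simp: not_le)
      show "?sm f = d" by (subst df, simp only: filter_union_mset s r) simp
      have "?bg f = f - d" by (subst df, simp only: filter_union_mset s r) simp
      then show "f = d + ?bg f" using df by simp
    qed
    have rec: "a = ?sm (f1 + f2)" "n = y + mdeg (?bg f1)" "f1 = dv a y + ?bg f1"
      if x: "(a, y, f1, f2) \<in> \<S>" for a y f1 f2
    proof -
      have a: "a \<in> \<A>" and y: "y \<in> divisor_degrees a" and f1: "f1 \<in> G R1 (dv a y)" and f2: "f2 \<in> G R2 (a - dv a y)"
        using x by (auto simp: \<S>_def)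
      have d: "dv a y \<subseteq># a" "mdeg (dv a y) = y" using dv[OF y] by auto
      have p1: "?sm f1 = dv a y" "f1 = dv a y + ?bg f1"
        using parts[OF f1] smooth[OF a] mset_subset_eqD[OF d(1)] by blast+
      have p2: "?sm f2 = a - dv a y"
        using parts(1)[OF f2] smooth[OF a] by (meson in_diffD)
      show "a = ?sm (f1 + f2)" using p1 p2 d(1) by simp
      show "f1 = dv a y + ?bg f1" by (rule p1)
      have "n = mdeg f1" using f1 by (simp add: G_def)
      also have "\<dots> = mdeg (dv a y) + mdeg (?bg f1)" by (subst p1(2)) simp
      finally show "n = y + mdeg (?bg f1)" using d by simp
    qed
    show "inj_on ?F \<S>"
    proof (rule inj_onI)
      fix s s' assume s: "s \<in> \<S>" "s' \<in> \<S>" "?F s = ?F s'"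
      obtain a y f1 f2 where e: "s = (a, y, f1, f2)" by (cases s)
      obtain a' y' f1' f2' where e': "s' = (a', y', f1', f2')" by (cases s')
      have eq: "f1 + f2 = f1' + f2'" "?bg f1 = ?bg f1'" using s(3) by (auto simp: e e')
      note r = rec[OF s(1)[unfolded e]] and r' = rec[OF s(2)[unfolded e']]
      have a: "a = a'" using r(1) r'(1) eq(1) by simp
      have y: "y = y'" using r(2) r'(2) eq(2) by simp
      have f1: "f1 = f1'" using r(3) r'(3) eq(2) a y by simp
      then have "f2 = f2'" using eq(1) by simp
      then show "s = s'" using a y f1 by (simp add: e e')
    qed
    show "?F ` \<S> \<subseteq> Sigma (product_set n R1 R2) (\<lambda>f. {h. h \<subseteq># filter_mset (\<lambda>p. 2 ^ b < dg p) f})"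
      by (fastforce simp: \<S>_def G_def product_set_def intro: multiset_filter_mono)
    show "finite (Sigma (product_set n R1 R2) (\<lambda>f. {h. h \<subseteq># filter_mset (\<lambda>p. 2 ^ b < dg p) f}))"
      using finite_product_set[OF R1 R2] finite_submultisets by (intro finite_SigmaI)
  qed
  also have "\<dots> = (\<Sum>f\<in>product_set n R1 R2. card {h. h \<subseteq># filter_mset (\<lambda>p. 2 ^ b < dg p) f})"
    using finite_product_set[OF R1 R2] finite_submultisets by (intro card_SigmaI) auto
  also have "\<dots> \<le> (\<Sum>f\<in>product_set n R1 R2. 2 ^ 104)"
  proof (intro sum_mono)
    fix f assume f: "f \<in> product_set n R1 R2"
    then have "mdeg f = 2 * n" by (auto simp: product_set_def)
    then have "(2::nat) ^ size (filter_mset (\<lambda>p. 2 ^ b < dg p) f) \<le> 2 ^ 104"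
      using size_rough_part[OF _ n] by (intro power_increasing) auto
    then show "card {h. h \<subseteq># filter_mset (\<lambda>p. 2 ^ b < dg p) f} \<le> 2 ^ 104"
      using card_submultisets_le order_trans by blast
  qed
  finally show ?thesis by simp
qed

text \<open>Tuples that yield the same multiset are rearrangements of each other. This is where the
  factor \<open>1 / fact J\<close> comes from.\<close>

lemma sum_tuples_le:
  fixes h :: "'p multiset \<Rightarrow> real"
  assumes fin: "finite \<P>" and \<P>: "\<P> \<subseteq> {..<J} \<rightarrow>\<^sub>E Irr" and h: "\<And>a. h a \<ge> 0"
  shows "(\<Sum>t\<in>\<P>. h (image_mset t (mset_set {..<J}))) \<le> fact J * (\<Sum>a\<in>(\<lambda>t. image_mset t (mset_set {..<J})) ` \<P>. h a)"
proof -
  let ?m = "\<lambda>t. image_mset t (mset_set {..<J})"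
  have fibre: "card {t \<in> \<P>. ?m t = a} \<le> fact J" for a
  proof (cases "{t \<in> \<P>. ?m t = a} = {}")
    case True
    then show ?thesis by (simp only: card.empty zero_le)
  next
    case False
    then have "size a = J" by auto
    have "card {t \<in> \<P>. ?m t = a} \<le> card (permutations_of_multiset a)"
    proof (rule card_inj_on_le[where f = "\<lambda>t. map t [0..<J]"])
      show "inj_on (\<lambda>t. map t [0..<J]) {t \<in> \<P>. ?m t = a}"
      proof (rule inj_onI)
        fix t t' assume t: "t \<in> {t \<in> \<P>. ?m t = a}" "t' \<in> {t \<in> \<P>. ?m t = a}" "map t [0..<J] = map t' [0..<J]"
        then have "t \<in> {..<J} \<rightarrow>\<^sub>E Irr" "t' \<in> {..<J} \<rightarrow>\<^sub>E Irr" using \<P> by auto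
        then show "t = t'" using t(3) by (intro PiE_ext[of t "{..<J}" "\<lambda>_. Irr" t']) auto
      qed
      show "(\<lambda>t. map t [0..<J]) ` {t \<in> \<P>. ?m t = a} \<subseteq> permutations_of_multiset a"
        by (auto simp: permutations_of_multiset_def lessThan_atLeast0)
    qed auto
    also have "\<dots> \<le> fact (size a)"
      unfolding card_permutations_of_multiset by (rule div_le_dividend)
    finally show ?thesis using \<open>size a = J\<close> by simp
  qed
  have "(\<Sum>t\<in>\<P>. h (?m t)) = (\<Sum>a\<in>?m ` \<P>. \<Sum>t | t \<in> \<P> \<and> ?m t = a. h (?m t))"
    using fin by (intro sum.group[symmetric]) auto
  also have "\<dots> = (\<Sum>a\<in>?m ` \<P>. real (card {t \<in> \<P>. ?m t = a}) * h a)"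
    by (intro sum.cong refl) simp
  also have "\<dots> \<le> (\<Sum>a\<in>?m ` \<P>. fact J * h a)"
  proof (intro sum_mono mult_right_mono h)
    fix a
    have "real (card {t \<in> \<P>. ?m t = a}) \<le> real (fact J)" using fibre by (rule of_nat_mono)
    then show "real (card {t \<in> \<P>. ?m t = a}) \<le> fact J" by simp
  qed
  finally show ?thesis by (simp only: sum_distrib_left)
qed

lemma mdeg_image_mset: "finite Y \<Longrightarrow> mdeg (image_mset t (mset_set Y)) = (\<Sum>l\<in>Y. dg (t l))"
  by (simp add: mdeg_def sum_unfold_sum_mset image_mset.compositionality comp_def)

lemma card_subset_degrees_le:
  "card (subset_degrees J t) \<le> card (divisor_degrees (image_mset t (mset_set {..<J})))"
proof (rule card_mono[OF finite_divisor_degrees])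
  show "subset_degrees J t \<subseteq> divisor_degrees (image_mset t (mset_set {..<J}))"
  proof
    fix y assume "y \<in> subset_degrees J t"
    then obtain Y where Y: "Y \<subseteq> {..<J}" "y = (\<Sum>l\<in>Y. dg (t l))" by (auto simp: subset_degrees_def)
    then have "y = mdeg (image_mset t (mset_set Y))"
      using mdeg_image_mset finite_subset by (metis finite_lessThan)
    moreover have "image_mset t (mset_set Y) \<subseteq># image_mset t (mset_set {..<J})"
      using Y by (intro image_mset_subseteq_mono subset_imp_msubset_mset_set) auto
    ultimately show "y \<in> divisor_degrees (image_mset t (mset_set {..<J}))"
      by (auto simp: divisor_degrees_def)
  qed
qed

end

section \<open>Stirling's bound and the lower bound for the product set\<close>

text \<open>The difference has derivative \<open>y ^ 2 / ((1 + y) * (2 + y) ^ 2)\<close>. At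
  \<open>1 / x\<close> this is the inductive step of Stirling's bound; at \<open>1\<close> it serves
  as \<open>ln 2 \<ge> 2 / 3\<close>.\<close>

lemma ln_one_plus_ge:
  fixes x :: real
  assumes "x \<ge> 0"
  shows "ln (1 + x) \<ge> 2 * x / (2 + x)"
proof -
  let ?f = "\<lambda>x::real. ln (1 + x) - 2 * x / (2 + x)"
  have "?f 0 \<le> ?f x"
  proof (rule DERIV_nonneg_imp_nondecreasing[OF assms])
    fix y :: real assume y: "0 \<le> y" "y \<le> x"
    have "(?f has_real_derivative (1 / (1 + y) - (2 * (2 + y) - 2 * y) / ((2 + y) * (2 + y)))) (at y)"
      using y by (auto intro!: derivative_eq_intros)
    moreover have "1 / (1 + y) - (2 * (2 + y) - 2 * y) / ((2 + y) * (2 + y)) \<ge> 0"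
    proof -
      have "4 * (1 + y) \<le> (2 + y) * (2 + y)" using zero_le_square[of y] by (simp add: algebra_simps)
      then have "4 \<le> (2 + y) * (2 + y) / (1 + y)" using y by (intro mult_imp_le_div_pos) auto
      then have "4 / ((2 + y) * (2 + y)) \<le> 1 / (1 + y)" using y by (intro mult_imp_div_pos_le) auto
      moreover have "2 * (2 + y) - 2 * y = 4" by simp
      ultimately show ?thesis by simp
    qed
    ultimately show "\<exists>z. (?f has_real_derivative z) (at y) \<and> 0 \<le> z" by blast
  qed
  then show ?thesis by simp
qed

text \<open>The quotient of consecutive right-hand sides has to exceed
  \<open>(x + 1) * exp 1\<close>, which amounts to
  \<open>(x + 1 / 2) * ln (1 + 1 / x) \<ge> 1\<close>. The constant \<open>exp 1\<close> gives
  equality at \<open>J = 1\<close>.\<close>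

lemma fact_le_stirling:
  assumes "J \<ge> 1"
  shows "fact J * exp (real J) \<le> exp 1 * sqrt (real J) * real J ^ J"
  using assms
proof (induction J rule: nat_induct_at_least)
  case (Suc J)
  define x where "x = real J"
  have x: "x \<ge> 1" using Suc by (simp add: x_def)
  have pw: "sqrt y * y ^ J = exp ((x + 1 / 2) * ln y)" if "y > 0" for y
  proof -
    have "exp ((x + 1 / 2) * ln y) = y powr (x + 1 / 2)" using that by (simp add: powr_def)
    also have "\<dots> = y powr x * y powr (1 / 2)" by (rule powr_add)
    finally show ?thesis using that by (simp add: x_def powr_half_sqrt powr_realpow mult.commute)
  qed
  have "ln (1 + 1 / x) \<ge> 2 * (1 / x) / (2 + 1 / x)" using x by (intro ln_one_plus_ge) auto
  also have "2 * (1 / x) / (2 + 1 / x) = 1 / (x + 1 / 2)" using x by (simp add: field_simps)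
  finally have "(x + 1 / 2) * ln (1 + 1 / x) \<ge> 1" using x by (simp add: field_simps)
  moreover have "ln (1 + 1 / x) = ln (x + 1) - ln x"
  proof -
    have "1 + 1 / x = (x + 1) / x" using x by (simp add: field_simps)
    then show ?thesis using x by (simp add: ln_div)
  qed
  ultimately have key: "1 + (x + 1 / 2) * ln x \<le> (x + 1 / 2) * ln (x + 1)" by (simp add: algebra_simps)
  have "exp 1 * (sqrt x * x ^ J) = exp (1 + (x + 1 / 2) * ln x)"
    using x pw[of x] by (simp add: exp_add)
  also have "\<dots> \<le> exp ((x + 1 / 2) * ln (x + 1))" using key by simp
  also have "\<dots> = sqrt (x + 1) * (x + 1) ^ J" using x pw[of "x + 1"] by simp
  finally have step: "exp 1 * (sqrt x * x ^ J) \<le> sqrt (x + 1) * (x + 1) ^ J" .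
  have "fact (Suc J) * exp (real (Suc J)) = (x + 1) * exp 1 * (fact J * exp x)"
    by (simp add: x_def exp_add algebra_simps)
  also have "\<dots> \<le> (x + 1) * exp 1 * (exp 1 * sqrt x * x ^ J)"
    using Suc.IH x by (intro mult_left_mono) (auto simp: x_def)
  also have "\<dots> = (x + 1) * exp 1 * (exp 1 * (sqrt x * x ^ J))" by simp
  also have "\<dots> \<le> (x + 1) * exp 1 * (sqrt (x + 1) * (x + 1) ^ J)"
    using step x by (intro mult_left_mono) auto
  also have "\<dots> = exp 1 * sqrt (real (Suc J)) * real (Suc J) ^ Suc J"
    by (simp add: x_def algebra_simps)
  finally show ?case .
qed simp

context factorial_degree
begin

text \<open>Indexed from 0 to match the bins; the shift \<open>i0\<close> skips the small degrees,
  where too much of the mass may be missing.\<close>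

definition free_block :: "'p set \<Rightarrow> nat \<Rightarrow> nat \<Rightarrow> 'p set" where
  "free_block Q i0 i = {p \<in> Irr - Q. dg p \<in> dyadic_degrees (Suc (i + i0))}"

lemma finite_free_block: "finite (free_block Q i0 i)"
  unfolding free_block_def
  by (rule rev_finite_subset[OF finite_irr_Union[OF finite_dyadic_degrees[of "Suc (i + i0)"]]]) auto

text \<open>The range of \<open>n\<close> is a budget: half of \<open>n\<close> covers the
  \<open>13 * 2 ^ b\<close> of the sieve, a quarter covers each modulus, and the last quarter, at
  least \<open>6 * 2 ^ b\<close>, has room for the factors \<open>a\<close>, of degree at most
  \<open>4 * 2 ^ b\<close>.\<close>

lemma product_set_lower:
  fixes \<eta> :: "nat \<Rightarrow> real"
  assumes R1: "equidistributed R1 m1 Q1" and R2: "equidistributed R2 m2 Q2"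
    and i0: "i0 \<ge> 1" and J: "J > 0" and b: "b = J + i0 + 2"
    and n: "26 * 2 ^ b \<le> n" "n \<le> 52 * 2 ^ b" and m: "4 * m1 \<le> n" "4 * m2 \<le> n"
    and \<eta>: "\<And>i. 0 \<le> \<eta> i \<and> \<eta> i \<le> 1 / 4" "(\<Sum>i<J. \<eta> i) \<le> 1"
    and mass: "\<And>i. i < J \<Longrightarrow> (\<Sum>p\<in>free_block (Q1 \<union> Q2) i0 i. inv_norm p) \<ge> ln 2 * (1 - \<eta> i)"
  shows "2 ^ 104 * real (card (product_set n R1 R2))
    \<ge> real q ^ (2 * n - m1 - m2) / (2 * exp 3 * 2 ^ b)\<^sup>2
       * ((2 * ln 2) ^ J * exp (-16) * (real J ^ J / (8 * real J)) / fact J)"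
proof -
  define B where "B = free_block (Q1 \<union> Q2) i0"
  \<comment> \<open>Both conditions on a placement, small total defect of the masses and small total
    degree, are merged into one weight. Each part sums to at most 1 over the bins.\<close>
  define \<tau> where "\<tau> i = \<eta> i + 2 ^ i / 2 ^ J" for i
  define light where "light = {f \<in> placements J. (\<Sum>l<J. \<tau> (f l)) \<le> 8}"
  define tuples where "tuples \<phi> = (\<Pi>\<^sub>E l\<in>{..<J}. B (\<phi> l))" for \<phi>
  define \<P> where "\<P> = (\<Union>\<phi>\<in>light. tuples \<phi>)"
  define tm where "tm t = image_mset t (mset_set {..<J})" for t :: "nat \<Rightarrow> 'p"
  define h where "h a = real (card (divisor_degrees a)) / real q ^ mdeg a" for a
  have \<tau>0: "\<tau> i \<ge> 0" for i using \<eta>(1)[of i] by (simp add: \<tau>_def)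
  have sum\<tau>: "(\<Sum>i<J. \<tau> i) \<le> 2"
  proof -
    have "(\<Sum>i<J. 2 ^ i / 2 ^ J) = (2 ^ J - 1) / (2 ^ J :: real)"
      by (simp add: sum_divide_distrib[symmetric] sum_gp_strict)
    also have "\<dots> \<le> 1" by simp
    finally show ?thesis using \<eta>(2) by (simp add: \<tau>_def sum.distrib)
  qed
  have finlight: "finite light" using finite_placements by (simp add: light_def)
  have lightP: "\<phi> \<in> placements J" if "\<phi> \<in> light" for \<phi> using that by (simp add: light_def)
  have B_props: "finite (B i)" "B i \<subseteq> Irr - (Q1 \<union> Q2)"
    and B_gt: "\<And>p. p \<in> B i \<Longrightarrow> 2 ^ (i + i0) < dg p" and B_le: "\<And>p. p \<in> B i \<Longrightarrow> dg p \<le> 2 ^ Suc (i + i0)" for i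
    using finite_free_block[of "Q1 \<union> Q2" i0 i] by (auto simp: B_def free_block_def dyadic_degrees_def)
  have B_disj: "i = k" if "p \<in> B i" "p \<in> B k" for p i k
  proof (rule ccontr)
    assume "i \<noteq> k"
    then have "dyadic_degrees (Suc (i + i0)) \<inter> dyadic_degrees (Suc (k + i0)) = {}"
      using dyadic_degrees_disjoint[of "Suc (i + i0)" "Suc (k + i0)"]
        dyadic_degrees_disjoint[of "Suc (k + i0)" "Suc (i + i0)"] by (auto simp: nat_neq_iff)
    then show False using that by (auto simp: B_def free_block_def)
  qed
  have fintup: "finite (tuples \<phi>)" for \<phi>
    unfolding tuples_def using B_props by (intro finite_PiE) auto
  have fin\<P>: "finite \<P>" unfolding \<P>_def using finlight fintup by blast
  have \<P>_Irr: "\<P> \<subseteq> {..<J} \<rightarrow>\<^sub>E Irr"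
    unfolding \<P>_def tuples_def using B_props by (fastforce simp: PiE_iff)
  have disj: "tuples \<phi> \<inter> tuples \<psi> = {}" if "\<phi> \<in> light" "\<psi> \<in> light" "\<phi> \<noteq> \<psi>" for \<phi> \<psi>
  proof (rule ccontr)
    assume "tuples \<phi> \<inter> tuples \<psi> \<noteq> {}"
    then obtain t where t: "t \<in> tuples \<phi>" "t \<in> tuples \<psi>" by blast
    have "\<phi> l = \<psi> l" if "l < J" for l
      using t that B_disj[of "t l" "\<phi> l" "\<psi> l"] by (auto simp: tuples_def PiE_iff)
    then have "\<phi> = \<psi>"
      using lightP[OF that(1)] lightP[OF that(2)] unfolding placements_def
      by (intro PiE_ext[of \<phi> _ _ \<psi>]) auto
    then show False using that by simp
  qed
  have mdeg_tm: "mdeg (tm t) = (\<Sum>l<J. dg (t l))" for t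
    unfolding tm_def by (rule mdeg_image_mset) simp
  have elem: "\<exists>\<phi>\<in>light. \<exists>t\<in>tuples \<phi>. a = tm t" if "a \<in> tm ` \<P>" for a
    using that by (auto simp: \<P>_def)
  have mdeg_a: "mdeg a \<le> 4 * 2 ^ b" if a: "a \<in> tm ` \<P>" for a
  proof -
    obtain \<phi> t where \<phi>: "\<phi> \<in> light" and t: "t \<in> tuples \<phi>" and at: "a = tm t" using elem[OF a] by blast
    have "(\<Sum>l<J. 2 ^ \<phi> l / 2 ^ J) \<le> (\<Sum>l<J. \<tau> (\<phi> l))"
      using \<eta>(1) by (intro sum_mono) (simp add: \<tau>_def)
    also have "\<dots> \<le> 8" using \<phi> by (simp add: light_def)
    finally have "(\<Sum>l<J. 2 ^ \<phi> l) \<le> 8 * (2 ^ J :: real)"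
      by (simp add: sum_divide_distrib[symmetric] field_simps)
    then have "real (\<Sum>l<J. 2 ^ \<phi> l) \<le> real (8 * 2 ^ J)" by simp
    then have s: "(\<Sum>l<J. 2 ^ \<phi> l) \<le> 8 * (2 ^ J :: nat)" by (simp only: of_nat_le_iff)
    \<comment> \<open>With \<open>b = J + i0 + 2\<close>, the bound 8 for a light placement becomes
      \<open>2 ^ Suc i0 * 8 * 2 ^ J = 4 * 2 ^ b\<close>.\<close>
    have "mdeg a \<le> (\<Sum>l<J. 2 ^ Suc (\<phi> l + i0))"
      unfolding at mdeg_tm using t B_le by (intro sum_mono) (auto simp: tuples_def PiE_iff)
    also have "\<dots> = 2 ^ Suc i0 * (\<Sum>l<J. 2 ^ \<phi> l)"
      by (simp add: sum_distrib_left power_add mult_ac)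
    also have "\<dots> \<le> 2 ^ Suc i0 * (8 * 2 ^ J)" by (intro mult_left_mono s) simp
    also have "\<dots> = 4 * 2 ^ b" by (simp add: b power_add)
    finally show ?thesis .
  qed
  have count: "real q ^ (2 * n - m1 - m2) / (2 * exp 3 * 2 ^ b)\<^sup>2 * (\<Sum>a\<in>tm ` \<P>. h a)
      \<le> 2 ^ 104 * real (card (product_set n R1 R2))"
    unfolding h_def
  proof (rule count_products[OF R1 R2])
    show "finite (tm ` \<P>)" using fin\<P> by simp
    show "n \<le> 52 * 2 ^ b" by (rule n(2))
    fix a assume a: "a \<in> tm ` \<P>"
    show "13 * 2 ^ b + m1 + mdeg a \<le> n" "13 * 2 ^ b + m2 + mdeg a \<le> n"
      using mdeg_a[OF a] n m by linarith+
    obtain \<phi> t where \<phi>: "\<phi> \<in> light" and t: "t \<in> tuples \<phi>" and at: "a = tm t" using elem[OF a] by blast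
    have tB: "t l \<in> B (\<phi> l)" if "l < J" for l using t that by (auto simp: tuples_def PiE_iff)
    then show "set_mset a \<subseteq> Irr - (Q1 \<union> Q2)"
      unfolding at tm_def using B_props by fastforce
    fix p assume "p \<in># a"
    then obtain l where l: "l < J" "p = t l" by (auto simp: at tm_def)
    then have "dg p \<le> 2 ^ Suc (\<phi> l + i0)" using tB B_le by blast
    also have "\<dots> \<le> 2 ^ b"
      using placements_less[OF lightP[OF \<phi>] l(1)] by (intro power_increasing) (auto simp: b)
    finally show "dg p \<le> 2 ^ b" .
  qed
  have prod_mass: "(\<Prod>l<J. \<Sum>p\<in>B (\<phi> l). inv_norm p) \<ge> ln 2 ^ J * exp (-16)" if \<phi>: "\<phi> \<in> light" for \<phi>
  proof -
    have "(\<Sum>l<J. \<eta> (\<phi> l)) \<le> (\<Sum>l<J. \<tau> (\<phi> l))" by (intro sum_mono) (simp add: \<tau>_def)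
    also have "\<dots> \<le> 8" using \<phi> by (simp add: light_def)
    finally have T: "(\<Sum>l<J. \<eta> (\<phi> l)) \<le> 8" .
    have "(\<Sum>l<J. (\<eta> (\<phi> l))\<^sup>2) \<le> (\<Sum>l<J. \<eta> (\<phi> l) * (1 / 4))"
      unfolding power2_eq_square using \<eta>(1) by (intro sum_mono mult_left_mono) auto
    also have "\<dots> \<le> 2" using T by (simp add: sum_divide_distrib[symmetric])
    finally have T2: "(\<Sum>l<J. (\<eta> (\<phi> l))\<^sup>2) \<le> 2" .
    \<comment> \<open>The exponent is at most \<open>8 + 2 * 2\<close>, which is below 16.\<close>
    have "exp (-16) \<le> exp (- (\<Sum>l<J. \<eta> (\<phi> l)) - 2 * (\<Sum>l<J. (\<eta> (\<phi> l))\<^sup>2))"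
      using T T2 by simp
    also have "\<dots> \<le> (\<Prod>l<J. 1 - \<eta> (\<phi> l))"
    proof (rule prod_one_minus_ge_exp)
      fix l
      show "0 \<le> \<eta> (\<phi> l) \<and> \<eta> (\<phi> l) \<le> 1 / 2" using \<eta>(1)[of "\<phi> l"] by linarith
    qed simp
    finally have "ln 2 ^ J * exp (-16) \<le> ln 2 ^ J * (\<Prod>l<J. 1 - \<eta> (\<phi> l))"
      by (intro mult_left_mono) auto
    also have "\<dots> = (\<Prod>l<J. ln 2 * (1 - \<eta> (\<phi> l)))" by (simp add: prod.distrib)
    also have "\<dots> \<le> (\<Prod>l<J. \<Sum>p\<in>B (\<phi> l). inv_norm p)"
    proof (intro prod_mono conjI)
      fix l assume "l \<in> {..<J}"
      then have "\<phi> l < J" using placements_less[OF lightP[OF \<phi>]] by simp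
      then show "ln 2 * (1 - \<eta> (\<phi> l)) \<le> (\<Sum>p\<in>B (\<phi> l). inv_norm p)" unfolding B_def by (rule mass)
      show "0 \<le> ln 2 * (1 - \<eta> (\<phi> l))" using \<eta>(1)[of "\<phi> l"] by (intro mult_nonneg_nonneg) auto
    qed
    finally show ?thesis .
  qed
  have tuple_sum: "(\<Sum>t\<in>tuples \<phi>. h (tm t)) \<ge> (2 * ln 2) ^ J * exp (-16) / 2 * (1 / crowding J \<phi>)" if \<phi>: "\<phi> \<in> light" for \<phi>
  proof -
    have S: "crowding J \<phi> > 0" by (rule crowding_pos[OF J])
    have "(2 * ln 2) ^ J * exp (-16) / 2 * (1 / crowding J \<phi>) = 2 ^ J * (ln 2 ^ J * exp (-16)) / (2 * crowding J \<phi>)"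
      by (simp add: power_mult_distrib)
    also have "\<dots> \<le> 2 ^ J * (\<Prod>l<J. \<Sum>p\<in>B (\<phi> l). inv_norm p) / (2 * crowding J \<phi>)"
      using prod_mass[OF \<phi>] S by (intro divide_right_mono mult_left_mono) auto
    also have "\<dots> \<le> (\<Sum>t\<in>tuples \<phi>. (\<Prod>l<J. inv_norm (t l)) * real (card (subset_degrees J t)))"
      unfolding tuples_def
    proof (rule subset_degrees_moment[OF J lightP[OF \<phi>]])
      show "finite (B i) \<and> B i \<subseteq> Irr" for i using B_props by auto
      show "2 * 2 ^ i \<le> dg p" if "p \<in> B i" for i p
      proof -
        \<comment> \<open>The hypothesis \<open>i0 \<ge> 1\<close> supplies the factor 2 that the
          second moment bound trades for a block mass.\<close>
        have "2 * 2 ^ i \<le> (2::nat) ^ (i + i0)"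
          using i0 power_increasing[of "Suc i" "i + i0" "2::nat"] by simp
        then show ?thesis using B_gt[OF that] by simp
      qed
      show "1 / 2 \<le> (\<Sum>p\<in>B i. inv_norm p)" if "i < J" for i
      proof -
        have "2 / 3 * (3 / 4) \<le> ln 2 * (1 - \<eta> i)"
          using ln_one_plus_ge[of 1] \<eta>(1)[of i] by (intro mult_mono) auto
        then show ?thesis using mass[OF that] by (simp add: B_def)
      qed
    qed
    also have "\<dots> \<le> (\<Sum>t\<in>tuples \<phi>. h (tm t))"
    proof (intro sum_mono)
      fix t
      have "(\<Prod>l<J. inv_norm (t l)) = 1 / real q ^ mdeg (tm t)"
        by (simp add: inv_norm_def mdeg_tm prod_dividef power_sum)
      moreover have "card (subset_degrees J t) \<le> card (divisor_degrees (tm t))"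
        unfolding tm_def by (rule card_subset_degrees_le)
      ultimately show "(\<Prod>l<J. inv_norm (t l)) * real (card (subset_degrees J t)) \<le> h (tm t)"
        by (simp add: h_def divide_right_mono)
    qed
    finally show ?thesis .
  qed
  have "(2 * ln 2) ^ J * exp (-16) / 2 * (real J ^ J / (4 * real J))
      \<le> (2 * ln 2) ^ J * exp (-16) / 2 * (\<Sum>\<phi>\<in>light. 1 / crowding J \<phi>)"
    unfolding light_def by (intro mult_left_mono sum_light_inverse_crowding[OF J \<tau>0 sum\<tau>]) auto
  also have "\<dots> \<le> (\<Sum>\<phi>\<in>light. \<Sum>t\<in>tuples \<phi>. h (tm t))"
    unfolding sum_distrib_left by (intro sum_mono tuple_sum)
  \<comment> \<open>The blocks are disjoint, so a tuple determines its placement.\<close>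
  also have "\<dots> = (\<Sum>t\<in>\<P>. h (tm t))"
    unfolding \<P>_def using finlight fintup disj by (intro sum.UNION_disjoint[symmetric]) auto
  also have "\<dots> \<le> fact J * (\<Sum>a\<in>tm ` \<P>. h a)"
    unfolding tm_def by (rule sum_tuples_le[OF fin\<P> \<P>_Irr]) (simp add: h_def)
  also have "(2 * ln 2) ^ J * exp (-16) / 2 * (real J ^ J / (4 * real J))
      = (2 * ln 2) ^ J * exp (-16) * (real J ^ J / (8 * real J))"
    by simp
  finally have "(2 * ln 2) ^ J * exp (-16) * (real J ^ J / (8 * real J)) / fact J \<le> (\<Sum>a\<in>tm ` \<P>. h a)"
    by (intro mult_imp_div_pos_le) (simp_all only: mult.commute fact_gt_zero)
  then have "real q ^ (2 * n - m1 - m2) / (2 * exp 3 * 2 ^ b)\<^sup>2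
       * ((2 * ln 2) ^ J * exp (-16) * (real J ^ J / (8 * real J)) / fact J)
     \<le> real q ^ (2 * n - m1 - m2) / (2 * exp 3 * 2 ^ b)\<^sup>2 * (\<Sum>a\<in>tm ` \<P>. h a)"
    by (intro mult_left_mono) auto
  then show ?thesis using count by (rule order_trans)
qed

text \<open>A pair is recovered from its product and the submultiset \<open>f1\<close>; the product
  has at most \<open>2 * n\<close> prime factors. This settles bounded \<open>n\<close>, with a loss
  that does not depend on \<open>q\<close>.\<close>

lemma product_set_trivial_lower:
  assumes R1: "equidistributed R1 m1 Q1" and R2: "equidistributed R2 m2 Q2" and m: "m1 \<le> n" "m2 \<le> n"
  shows "real q ^ (2 * n - m1 - m2) \<le> 2 ^ (2 * n) * real (card (product_set n R1 R2))"
proof -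
  define G where "G R = {f \<in> R. mdeg f = n}" for R
  have c1: "card (G R1) = q ^ (n - m1)" and c2: "card (G R2) = q ^ (n - m2)"
    using R1 R2 m unfolding equidistributed_def G_def
    by (auto dest!: spec[of _ "{#}"] spec[of _ n])
  have "2 * n - m1 - m2 = (n - m1) + (n - m2)" using m by simp
  then have "q ^ (2 * n - m1 - m2) = q ^ (n - m1) * q ^ (n - m2)"
    by (simp only: power_add)
  also have "\<dots> = card (G R1 \<times> G R2)" by (simp add: card_cartesian_product c1 c2)
  also have "\<dots> \<le> card (Sigma (product_set n R1 R2) (\<lambda>f. {h. h \<subseteq># f}))"
  proof (rule card_inj_on_le[where f = "\<lambda>(f1, f2). (f1 + f2, f1)"])
    show "inj_on (\<lambda>(f1, f2). (f1 + f2, f1)) (G R1 \<times> G R2)" by (auto simp: inj_on_def)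
    show "(\<lambda>(f1, f2). (f1 + f2, f1)) ` (G R1 \<times> G R2) \<subseteq> Sigma (product_set n R1 R2) (\<lambda>f. {h. h \<subseteq># f})"
      by (auto simp: G_def product_set_def)
    show "finite (Sigma (product_set n R1 R2) (\<lambda>f. {h. h \<subseteq># f}))"
      using finite_product_set[OF R1 R2] finite_submultisets by (intro finite_SigmaI)
  qed
  also have "\<dots> = (\<Sum>f\<in>product_set n R1 R2. card {h. h \<subseteq># f})"
    using finite_product_set[OF R1 R2] finite_submultisets by (intro card_SigmaI) auto
  also have "\<dots> \<le> (\<Sum>f\<in>product_set n R1 R2. 2 ^ (2 * n))"
  proof (intro sum_mono)
    fix f assume f: "f \<in> product_set n R1 R2"
    then obtain f1 f2 where fs: "f = f1 + f2" "f1 \<in> R1" "f2 \<in> R2" "mdeg f1 = n" "mdeg f2 = n"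
      by (auto simp: product_set_def)
    then have "set_mset f1 \<subseteq> Irr" "set_mset f2 \<subseteq> Irr"
      using R1 R2 unfolding equidistributed_def by blast+
    then have "size f \<le> 2 * n" using size_le_mdeg[of f1] size_le_mdeg[of f2] fs by simp
    then have "(2::nat) ^ size f \<le> 2 ^ (2 * n)" by (intro power_increasing) auto
    then show "card {h. h \<subseteq># f} \<le> 2 ^ (2 * n)"
      using card_submultisets_le[of f] by linarith
  qed
  finally have "real (q ^ (2 * n - m1 - m2)) \<le> real (card (product_set n R1 R2) * 2 ^ (2 * n))"
    by (intro of_nat_mono) simp
  then show ?thesis by (simp add: mult.commute)
qed

end

section \<open>The exponent delta and the asymptotic form\<close>

lemma ford_delta_nonneg: "ford_delta \<ge> 0"
proof -
  have "ln (ln 2) \<le> ln 2 - (1::real)" by (rule ln_le_minus_one) simp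
  then show ?thesis by (simp add: ford_delta_def divide_le_eq)
qed

text \<open>This identity explains \<open>\<delta>\<close>: \<open>2 - \<delta>\<close> is
  \<open>(1 + ln 2 + ln (ln 2)) / ln 2\<close>, the logarithm of \<open>2 * exp 1 * ln 2\<close> to
  base 2.\<close>

lemma ford_delta_power:
  "(2 * ln 2) ^ J * exp (real J) = (2 ^ J) powr (2 - ford_delta)"
proof -
  have l2: "ln (2::real) > 0" by simp
  have "(2 * ln 2) ^ J * exp (real J) = exp (real J * (ln 2 + ln (ln 2))) * exp (real J)"
    using l2 by (simp add: exp_of_nat_mult exp_add)
  also have "\<dots> = exp (real J * (ln 2 + ln (ln 2) + 1))" by (simp add: exp_add[symmetric] ring_distribs)
  also have "ln 2 + ln (ln 2) + 1 = (2 - ford_delta) * ln (2::real)"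
    using l2 by (simp add: ford_delta_def field_simps)
  also have "exp (real J * ((2 - ford_delta) * ln (2::real))) = (2 ^ J) powr (2 - ford_delta)"
    by (simp add: powr_def ln_realpow mult_ac)
  finally show ?thesis .
qed

text \<open>\<open>exp (-23)\<close> collects \<open>exp (-16)\<close>, the \<open>exp 1\<close> of
  Stirling's bound and the square of the sieve's \<open>exp 3\<close>. The power of
  \<open>2 ^ (i0 + 2)\<close> comes from \<open>2 ^ J = 2 ^ b / 2 ^ (i0 + 2)\<close>, and
  \<open>2 powr (3 / 2)\<close> from \<open>J \<le> 2 * (1 + ln n)\<close>.\<close>

definition large_const :: "nat \<Rightarrow> real" where
  "large_const i0 = exp (-23) / (64 * 2 powr (3 / 2) * (2 ^ (i0 + 2)) powr (2 - ford_delta))"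

text \<open>The two sieves cost \<open>(2 ^ b)\<^sup>2\<close>, which turns the power
  \<open>2 - \<delta>\<close> into \<open>-\<delta>\<close>; since \<open>\<delta> \<ge> 0\<close>,
  \<open>2 ^ b\<close> may then be enlarged to \<open>n\<close>. Of \<open>J powr (3 / 2)\<close>,
  one factor \<open>J\<close> is due to the rotation and \<open>sqrt J\<close> to Stirling.\<close>

lemma asymptotic_lower:
  assumes J: "J \<ge> 1" and b: "b = J + i0 + 2" and n: "2 ^ b \<le> n"
  shows "(2 * ln 2) ^ J * exp (-16) * (real J ^ J / (8 * real J)) / fact J / (2 * exp 3 * 2 ^ b)\<^sup>2
    \<ge> large_const i0 / (real n powr ford_delta * (1 + ln (real n)) powr (3 / 2))"
proof -
  define L where "L = 1 + ln (real n)"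
  define K where "K = (2 ^ (i0 + 2) :: real)"
  have K: "K > 0" by (simp add: K_def)
  have bn: "(2::real) ^ b \<le> real n" using n by (metis of_nat_le_iff of_nat_numeral of_nat_power)
  have n1: "real n \<ge> 1" using bn one_le_power[of "2::real" b] by linarith
  have L1: "L \<ge> 1" using n1 by (simp add: L_def)
  have JL: "real J \<le> 2 * L"
  proof -
    have "real b * ln 2 = ln (2 ^ b)" by (simp add: ln_realpow)
    also have "\<dots> \<le> ln (real n)" using bn n1 by (subst ln_le_cancel_iff) auto
    finally have "real b * ln 2 \<le> L" by (simp add: L_def)
    moreover have "real b * (1 / 2) \<le> real b * ln 2"
      using ln_one_plus_ge[of 1] by (intro mult_left_mono) auto
    moreover have "real J \<le> real b" using b by simp
    ultimately show ?thesis by linarith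
  qed
  have "real J * sqrt (real J) = real J powr (3 / 2)"
  proof -
    have "real J powr (3 / 2) = real J powr (1 + 1 / 2)" by simp
    also have "\<dots> = real J powr 1 * real J powr (1 / 2)" by (rule powr_add)
    finally show ?thesis using J by (simp add: powr_half_sqrt)
  qed
  also have "\<dots> \<le> (2 * L) powr (3 / 2)" using JL by (intro powr_mono2) auto
  also have "\<dots> = 2 powr (3 / 2) * L powr (3 / 2)" using L1 by (simp add: powr_mult)
  finally have JJ: "real J * sqrt (real J) \<le> 2 powr (3 / 2) * L powr (3 / 2)" .
  have J0: "real J * sqrt (real J) > 0" using J by simp
  have stir: "real J ^ J / fact J \<ge> exp (real J) / (exp 1 * sqrt (real J))"
    using fact_le_stirling[OF J] J by (simp add: field_simps)
  have pw: "(2 ^ J) powr (2 - ford_delta) / (2 ^ b)\<^sup>2 \<ge> 1 / (K powr (2 - ford_delta) * real n powr ford_delta)"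
  proof -
    have JK: "2 ^ J = 2 ^ b / K" by (simp add: b K_def power_add)
    have "(2 ^ J) powr (2 - ford_delta) / (2 ^ b)\<^sup>2
        = (2 ^ b) powr (2 - ford_delta) / K powr (2 - ford_delta) / (2 ^ b) powr 2"
      unfolding JK using K by (simp add: powr_divide)
    also have "\<dots> = 1 / (K powr (2 - ford_delta) * (2 ^ b) powr ford_delta)"
      by (simp add: powr_diff)
    also have "\<dots> \<ge> 1 / (K powr (2 - ford_delta) * real n powr ford_delta)"
      using K bn n1 ford_delta_nonneg
      by (intro divide_left_mono mult_left_mono powr_mono2 mult_pos_pos) auto
    finally show ?thesis .
  qed
  let ?a = "(2 * ln 2) ^ J :: real" and ?s = "real J * sqrt (real J)"
  have e: "exp (-23) = exp (-16) / (exp 1 * exp 6 :: real)"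
    by (simp add: exp_minus exp_add[symmetric] field_simps)
  have e3: "(exp 3)\<^sup>2 = (exp 6 :: real)" by (simp add: exp_double[symmetric])
  have "large_const i0 / (real n powr ford_delta * L powr (3 / 2))
      = exp (-23) / 64 * (1 / (K powr (2 - ford_delta) * real n powr ford_delta)) / (2 powr (3 / 2) * L powr (3 / 2))"
    unfolding large_const_def K_def[symmetric] by simp
  also have "\<dots> \<le> exp (-23) / 32 * ((2 ^ J) powr (2 - ford_delta) / (2 ^ b)\<^sup>2) / ?s"
    by (rule frac_le[OF _ mult_mono[OF _ pw] J0 JJ]) auto
  also have "\<dots> = exp (-16) / (32 * exp 6) * (?a * (exp (real J) / (exp 1 * sqrt (real J))) / real J) / (2 ^ b)\<^sup>2"
    unfolding ford_delta_power[symmetric] e by simp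
  also have "\<dots> \<le> exp (-16) / (32 * exp 6) * (?a * (real J ^ J / fact J) / real J) / (2 ^ b)\<^sup>2"
    using stir by (intro divide_right_mono mult_left_mono) auto
  also have "\<dots> = ?a * exp (-16) * (real J ^ J / (8 * real J)) / fact J / (2 * exp 3 * 2 ^ b)\<^sup>2"
    by (simp add: power_mult_distrib e3 mult_ac)
  finally show ?thesis by (simp add: L_def)
qed

context factorial_degree
begin

text \<open>The parameter \<open>i0\<close> is chosen so large that all blocks of primes have almost full mass.\<close>

lemma product_set_asymptotic_lower:
  fixes \<epsilon> C :: real
  assumes R1: "equidistributed R1 m1 Q1" and R2: "equidistributed R2 m2 Q2"
    and \<epsilon>: "0 < \<epsilon>" "\<epsilon> \<le> 1" and C: "C \<ge> 0"
    and Q1: "\<And>j. j \<ge> 1 \<Longrightarrow> real (card (irr j \<inter> Q1)) \<le> C * (real q ^ j / real j powr (1 + \<epsilon>))"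
    and Q2: "\<And>j. j \<ge> 1 \<Longrightarrow> real (card (irr j \<inter> Q2)) \<le> C * (real q ^ j / real j powr (1 + \<epsilon>))"
    and i0: "i0 \<ge> 1" "(10 + 4 * C) * (2 powr (-\<epsilon>)) ^ i0 / (1 - 2 powr (-\<epsilon>)) \<le> 1 / 4"
    and n: "n \<ge> 26 * 2 ^ (i0 + 3)" and m: "4 * m1 \<le> n" "4 * m2 \<le> n"
  shows "real (card (product_set n R1 R2)) \<ge> large_const i0 / 2 ^ 104
      * (real q ^ (2 * n - m1 - m2) / (real n powr ford_delta * (1 + ln (real n)) powr (3 / 2)))"
proof -
  define \<rho> where "\<rho> = 2 powr (-\<epsilon>)"
  have \<rho>: "0 < \<rho>" "\<rho> < 1" using \<epsilon> by (auto simp: \<rho>_def powr_less_one)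
  \<comment> \<open>Maximality yields both ends of the range from \<open>26 * 2 ^ b\<close> to
    \<open>52 * 2 ^ b\<close>.\<close>
  define b where "b = (GREATEST b. 26 * 2 ^ b \<le> n)"
  have bound: "b' \<le> n" if "26 * 2 ^ b' \<le> n" for b' :: nat
  proof -
    have "b' < 2 ^ b'" by simp
    then show ?thesis using that by linarith
  qed
  have b1: "26 * 2 ^ b \<le> n" unfolding b_def
    by (rule GreatestI_nat[where P = "\<lambda>b. 26 * 2 ^ b \<le> n", OF n bound])
  have b2: "i0 + 3 \<le> b" unfolding b_def
    by (rule Greatest_le_nat[where P = "\<lambda>b. 26 * 2 ^ b \<le> n", OF n bound])
  have b3: "n \<le> 52 * 2 ^ b"
  proof (rule ccontr)
    assume "\<not> n \<le> 52 * 2 ^ b"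
    then have "26 * 2 ^ Suc b \<le> n" by simp
    then have "Suc b \<le> b" unfolding b_def
      by (rule Greatest_le_nat[where P = "\<lambda>b. 26 * 2 ^ b \<le> n", OF _ bound])
    then show False by simp
  qed
  define J where "J = b - i0 - 2"
  have J: "J \<ge> 1" "b = J + i0 + 2" using b2 by (auto simp: J_def)
  \<comment> \<open>The defect of a block free of \<open>Q1 \<union> Q2\<close> is at most
    \<open>5 + 2 * C\<close> times a power of \<open>\<rho>\<close>, because the two bounds
    \<open>C\<close> add up; dividing by \<open>ln 2\<close>, which is at least
    \<open>1 / 2\<close>, doubles this.\<close>
  define \<eta> where "\<eta> i = (10 + 4 * C) * \<rho> ^ (i + i0)" for i
  have sum\<eta>: "(\<Sum>i<k. \<eta> i) \<le> 1 / 4" for k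
  proof -
    have "(\<Sum>i<k. \<eta> i) = (10 + 4 * C) * \<rho> ^ i0 * (\<Sum>i<k. \<rho> ^ i)"
      unfolding sum_distrib_left by (intro sum.cong refl) (simp add: \<eta>_def power_add)
    also have "(\<Sum>i<k. \<rho> ^ i) = (1 - \<rho> ^ k) / (1 - \<rho>)" using \<rho> by (simp add: sum_gp_strict)
    also have "(10 + 4 * C) * \<rho> ^ i0 * \<dots> \<le> (10 + 4 * C) * \<rho> ^ i0 * (1 / (1 - \<rho>))"
      using \<rho> C by (intro mult_left_mono divide_right_mono) auto
    also have "\<dots> \<le> 1 / 4" using i0(2) by (simp add: \<rho>_def)
    finally show ?thesis .
  qed
  have \<eta>: "0 \<le> \<eta> i \<and> \<eta> i \<le> 1 / 4" for i
  proof -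
    have nn: "\<eta> i \<ge> 0" for i using \<rho> C by (simp add: \<eta>_def)
    have "\<eta> i \<le> (\<Sum>i<Suc i. \<eta> i)" using nn by (intro member_le_sum) auto
    then show ?thesis using nn sum\<eta>[of "Suc i"] by (meson order_trans)
  qed
  have mass: "(\<Sum>p\<in>free_block (Q1 \<union> Q2) i0 i. inv_norm p) \<ge> ln 2 * (1 - \<eta> i)" for i
  proof -
    define M where "M = (2::nat) ^ (i + i0)"
    have Q: "real (card (irr j \<inter> (Q1 \<union> Q2))) \<le> 2 * C * (real q ^ j / real j powr (1 + \<epsilon>))" if "j \<ge> 1" for j
    proof -
      have "card (irr j \<inter> (Q1 \<union> Q2)) \<le> card (irr j \<inter> Q1) + card (irr j \<inter> Q2)"
        unfolding Int_Un_distrib by (rule card_Un_le)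
      then have "real (card (irr j \<inter> (Q1 \<union> Q2))) \<le> real (card (irr j \<inter> Q1)) + real (card (irr j \<inter> Q2))"
        by (simp only: of_nat_add[symmetric] of_nat_le_iff)
      then show ?thesis using Q1[OF that] Q2[OF that] by simp
    qed
    have "real M powr (-\<epsilon>) = \<rho> ^ (i + i0)"
      by (simp add: M_def \<rho>_def powr_powr powr_realpow[symmetric] mult.commute)
    then have "ln 2 - (5 + 2 * C) * \<rho> ^ (i + i0) \<le> (\<Sum>p\<in>{p \<in> Irr - (Q1 \<union> Q2). dg p \<in> {M<..2 * M}}. inv_norm p)"
      using block_mass_ge[of M \<epsilon> "2 * C" "Q1 \<union> Q2"] \<epsilon> C Q by (simp add: M_def)
    also have "{p \<in> Irr - (Q1 \<union> Q2). dg p \<in> {M<..2 * M}} = free_block (Q1 \<union> Q2) i0 i"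
      by (simp add: free_block_def dyadic_degrees_def M_def)
    finally have a: "ln 2 - (5 + 2 * C) * \<rho> ^ (i + i0) \<le> (\<Sum>p\<in>free_block (Q1 \<union> Q2) i0 i. inv_norm p)" .
    have "1 / 2 * \<eta> i \<le> ln 2 * \<eta> i"
      using ln_one_plus_ge[of 1] \<eta>[of i] by (intro mult_right_mono) auto
    also have "1 / 2 * \<eta> i = (5 + 2 * C) * \<rho> ^ (i + i0)" by (simp add: \<eta>_def algebra_simps)
    finally show ?thesis using a by (simp add: algebra_simps)
  qed
  let ?N = "real q ^ (2 * n - m1 - m2)" and ?D = "real n powr ford_delta * (1 + ln (real n)) powr (3 / 2)"
  have "2 ^ b \<le> n" using b1 by simp
  have "large_const i0 * (?N / ?D) = ?N * (large_const i0 / ?D)" by simp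
  also have "\<dots> \<le> ?N * ((2 * ln 2) ^ J * exp (-16) * (real J ^ J / (8 * real J)) / fact J / (2 * exp 3 * 2 ^ b)\<^sup>2)"
    by (intro mult_left_mono asymptotic_lower[OF J \<open>2 ^ b \<le> n\<close>]) auto
  also have "\<dots> = ?N / (2 * exp 3 * 2 ^ b)\<^sup>2 * ((2 * ln 2) ^ J * exp (-16) * (real J ^ J / (8 * real J)) / fact J)"
    by simp
  also have "\<dots> \<le> 2 ^ 104 * real (card (product_set n R1 R2))"
    by (rule product_set_lower[OF R1 R2 i0(1) _ J(2) b1 b3 m \<eta> _ mass])
      (use J sum\<eta>[of J] in auto)
  finally have "large_const i0 * (?N / ?D) \<le> real (card (product_set n R1 R2)) * 2 ^ 104"
    by (simp only: mult.commute)
  then show ?thesis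
    by (subst times_divide_eq_left) (rule mult_imp_div_pos_le, simp)
qed

end

section \<open>Transfer to polynomials over a finite field\<close>

locale finite_field = field +
  assumes finite_carrier: "finite (carrier R)"

text \<open>\<^term>\<open>Polynomials.degree\<close> is an abbreviation, hence no suitable parameter for a locale instance.\<close>

definition poly_degree :: "'a list \<Rightarrow> nat" where
  "poly_degree p = Polynomials.degree p"

sublocale finite_field \<subseteq> FD: factorial_degree "card (carrier R)" monic_irreducibles poly_degree
proof
  have "{\<zero>, \<one>} \<subseteq> carrier R" by auto
  then have "card {\<zero>, \<one>} \<le> card (carrier R)" using finite_carrier by (intro card_mono)
  then show "2 \<le> card (carrier R)" by simp
  show "1 \<le> poly_degree p" if "p \<in> monic_irreducibles" for p
    unfolding poly_degree_def by (rule monic_irreducible_degree_pos[OF that])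
  show "card {a. set_mset a \<subseteq> monic_irreducibles \<and> (\<Sum>p\<in>#a. poly_degree p) = k} = card (carrier R) ^ k" for k
    unfolding poly_degree_def
    using bij_betw_same_card[OF bij_betw_mset_prod[of k]] card_monic_polys(2)[OF finite_carrier, of k] by (simp only:)
qed

context finite_field
begin

interpretation UP: principal_domain "poly_ring R"
  by (rule univ_poly_is_principal[OF carrier_is_subfield])

definition residue_class :: "'a list \<Rightarrow> 'a list \<Rightarrow> 'a list multiset set" where
  "residue_class A M = {a. set_mset a \<subseteq> monic_irreducibles \<and> poly_cong R (mset_prod a) A M}"

definition irreducible_divisors :: "'a list \<Rightarrow> 'a list set" where
  "irreducible_divisors M = {p \<in> monic_irreducibles. p pdivides M}"

lemma mset_prod_carrier: "set_mset a \<subseteq> monic_irreducibles \<Longrightarrow> mset_prod a \<in> carrier (poly_ring R)"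
  by (intro mset_prod_closed) (use monic_irreducibles_carrier in blast)

lemma degree_mset_prod: "set_mset a \<subseteq> monic_irreducibles \<Longrightarrow> degree (mset_prod a) = FD.mdeg a"
  unfolding FD.mdeg_def poly_degree_def by (rule mset_prod_monic(2))

lemma mset_prod_in_monic_polys: "a \<in> FD.monics k \<Longrightarrow> mset_prod a \<in> monic_polys R k"
  unfolding FD.monics_def monic_polys_eq using mset_prod_monic(1) degree_mset_prod by blast

lemma monic_polys_image_mset_prod:
  assumes "f \<in> monic_polys R k"
  shows "\<exists>a\<in>FD.monics k. mset_prod a = f"
proof -
  have f: "is_monic f" "degree f = k" using assms unfolding monic_polys_eq by blast+
  obtain a where a: "set_mset a \<subseteq> monic_irreducibles" "mset_prod a = f"
    using exists_mset_prod[OF f(1)] by blast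
  have "FD.mdeg a = k" using degree_mset_prod[OF a(1)] a(2) f(2) by (simp only:)
  then show ?thesis using a unfolding FD.monics_def by blast
qed

lemma coprime_mset_prod:
  assumes M: "M \<in> carrier (poly_ring R)" "M \<noteq> []"
    and g: "set_mset g \<subseteq> monic_irreducibles - irreducible_divisors M"
  shows "poly_coprime R (mset_prod g) M"
proof -
  have g': "set_mset g \<subseteq> monic_irreducibles" using g by blast
  show ?thesis
    unfolding poly_coprime_iff[OF mset_prod_carrier[OF g'] M]
    using monic_irreducible_divides_mset_prod[OF _ g'] g by (auto simp: irreducible_divisors_def)
qed

text \<open>A prime dividing both \<open>M\<close> and an element of the class would divide
  \<open>A\<close>. A factor \<open>g\<close> coprime to \<open>M\<close> can be inverted modulo
  \<open>M\<close>, so the cofactors again run through one residue class, whose size is known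
  exactly.\<close>

lemma equidistributed_residue_class:
  assumes A: "A \<in> carrier (poly_ring R)" and M: "M \<in> carrier (poly_ring R)" "M \<noteq> []"
    and cop: "poly_coprime R A M"
  shows "FD.equidistributed (residue_class A M) (degree M) (irreducible_divisors M)"
  unfolding FD.equidistributed_def
proof (intro conjI allI impI)
  show "residue_class A M \<subseteq> {f. set_mset f \<subseteq> monic_irreducibles - irreducible_divisors M}"
  proof
    fix f assume "f \<in> residue_class A M"
    then have f: "set_mset f \<subseteq> monic_irreducibles" "M pdivides (mset_prod f \<ominus>\<^bsub>poly_ring R\<^esub> A)"
      by (auto simp: residue_class_def poly_cong_def)
    have fc: "mset_prod f \<in> carrier (poly_ring R)" by (rule mset_prod_carrier[OF f(1)])
    have "p \<notin> irreducible_divisors M" if p: "p \<in># f" for p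
    proof
      assume "p \<in> irreducible_divisors M"
      then have pI: "p \<in> monic_irreducibles" and pM: "p pdivides M" by (auto simp: irreducible_divisors_def)
      have pc: "p \<in> carrier (poly_ring R)" using pI monic_irreducibles_carrier by blast
      obtain f' where f': "f = add_mset p f'" using p by (auto dest: multi_member_split)
      have "set_mset f \<subseteq> carrier (poly_ring R)" using f(1) monic_irreducibles_carrier by blast
      then have "mset_prod f = p \<otimes>\<^bsub>poly_ring R\<^esub> mset_prod f'" "mset_prod f' \<in> carrier (poly_ring R)"
        using mset_prod_add[of p f'] mset_prod_closed[of f'] by (auto simp: f')
      then have pf: "p pdivides mset_prod f" unfolding pdivides_def factor_def by blast
      have D: "p pdivides (mset_prod f \<ominus>\<^bsub>poly_ring R\<^esub> A)" by (rule pdivides_trans[OF pc pM f(2)])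
      \<comment> \<open>\<open>A\<close> is written as a difference of two multiples of
        \<open>p\<close>.\<close>
      have "A = mset_prod f \<oplus>\<^bsub>poly_ring R\<^esub> (\<ominus>\<^bsub>poly_ring R\<^esub> (mset_prod f \<ominus>\<^bsub>poly_ring R\<^esub> A))"
        using fc A by algebra
      also have "p pdivides \<dots>"
        using fc A by (intro pdivides_add[OF pc _ _ pf] pdivides_uminus[OF pc _ D]) auto
      finally have "p pdivides A" .
      then show False using cop pI pM unfolding poly_coprime_iff[OF A M] by blast
    qed
    then show "f \<in> {f. set_mset f \<subseteq> monic_irreducibles - irreducible_divisors M}" using f(1) by blast
  qed
next
  fix g k assume g: "set_mset g \<subseteq> monic_irreducibles - irreducible_divisors M" and k: "FD.mdeg g + degree M \<le> k"
  have gI: "set_mset g \<subseteq> monic_irreducibles" using g by blast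
  have gc: "set_mset g \<subseteq> carrier (poly_ring R)" using gI monic_irreducibles_carrier by blast
  obtain B where B: "B \<in> carrier (poly_ring R)"
    "\<And>h. h \<in> carrier (poly_ring R) \<Longrightarrow> poly_cong R (mset_prod g \<otimes>\<^bsub>poly_ring R\<^esub> h) A M \<longleftrightarrow> poly_cong R h B M"
    using poly_cong_solve[OF mset_prod_carrier[OF gI] A M(1) coprime_mset_prod[OF M g]] by blast
  have cong: "poly_cong R (mset_prod (g + e)) A M \<longleftrightarrow> poly_cong R (mset_prod e) B M"
    if e: "set_mset e \<subseteq> monic_irreducibles" for e
  proof -
    have "set_mset e \<subseteq> carrier (poly_ring R)" using e monic_irreducibles_carrier by blast
    then show ?thesis using mset_prod_union[OF gc] B(2)[OF mset_prod_carrier[OF e]] by simp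
  qed
  have "bij_betw (\<lambda>f. mset_prod (f - g)) {f \<in> residue_class A M. FD.mdeg f = k \<and> g \<subseteq># f}
      {h \<in> monic_polys R (k - FD.mdeg g). poly_cong R h B M}"
    unfolding bij_betw_def
  proof
    show "inj_on (\<lambda>f. mset_prod (f - g)) {f \<in> residue_class A M. FD.mdeg f = k \<and> g \<subseteq># f}"
    proof (rule inj_onI)
      fix f f' assume ff: "f \<in> {f \<in> residue_class A M. FD.mdeg f = k \<and> g \<subseteq># f}"
        "f' \<in> {f \<in> residue_class A M. FD.mdeg f = k \<and> g \<subseteq># f}" "mset_prod (f - g) = mset_prod (f' - g)"
      then have "set_mset (f - g) \<subseteq> monic_irreducibles" "set_mset (f' - g) \<subseteq> monic_irreducibles"
        by (auto simp: residue_class_def dest: in_diffD)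
      then have "f - g = f' - g" using mset_prod_inj ff(3) by blast
      then show "f = f'" using ff(1,2) by (metis (mono_tags, lifting) mem_Collect_eq subset_mset.diff_add)
    qed
    show "(\<lambda>f. mset_prod (f - g)) ` {f \<in> residue_class A M. FD.mdeg f = k \<and> g \<subseteq># f}
        = {h \<in> monic_polys R (k - FD.mdeg g). poly_cong R h B M}"
    proof (intro equalityI subsetI)
      fix h assume "h \<in> (\<lambda>f. mset_prod (f - g)) ` {f \<in> residue_class A M. FD.mdeg f = k \<and> g \<subseteq># f}"
      then obtain f where f: "f \<in> residue_class A M" "FD.mdeg f = k" "g \<subseteq># f" "h = mset_prod (f - g)" by blast
      have e: "set_mset (f - g) \<subseteq> monic_irreducibles" using f(1) by (auto simp: residue_class_def dest: in_diffD)
      have "f - g \<in> FD.monics (k - FD.mdeg g)"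
        using e FD.mdeg_diff[OF f(3)] f(2) by (simp add: FD.monics_def)
      moreover have "poly_cong R (mset_prod (f - g)) B M"
        using cong[OF e] f by (simp add: residue_class_def)
      ultimately show "h \<in> {h \<in> monic_polys R (k - FD.mdeg g). poly_cong R h B M}"
        using mset_prod_in_monic_polys f(4) by blast
    next
      fix h assume "h \<in> {h \<in> monic_polys R (k - FD.mdeg g). poly_cong R h B M}"
      then obtain e where e: "e \<in> FD.monics (k - FD.mdeg g)" "mset_prod e = h" "poly_cong R h B M"
        using monic_polys_image_mset_prod by blast
      then have eI: "set_mset e \<subseteq> monic_irreducibles" "FD.mdeg e = k - FD.mdeg g" by (auto simp: FD.monics_def)
      have "g + e \<in> {f \<in> residue_class A M. FD.mdeg f = k \<and> g \<subseteq># f}"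
        using cong[OF eI(1)] e eI gI k by (simp add: residue_class_def)
      then show "h \<in> (\<lambda>f. mset_prod (f - g)) ` {f \<in> residue_class A M. FD.mdeg f = k \<and> g \<subseteq># f}"
        by (rule rev_image_eqI) (simp add: e(2))
    qed
  qed
  then have "card {f \<in> residue_class A M. FD.mdeg f = k \<and> g \<subseteq># f}
      = card {h \<in> monic_polys R (k - FD.mdeg g). poly_cong R h B M}" by (rule bij_betw_same_card)
  also have "\<dots> = card (carrier R) ^ (k - FD.mdeg g - degree M)"
    using k by (intro card_monic_residue_class finite_carrier M B(1)) linarith
  finally show "card {f \<in> residue_class A M. FD.mdeg f = k \<and> g \<subseteq># f} = card (carrier R) ^ (k - FD.mdeg g - degree M)" .
qed

lemma card_irr_Int_irreducible_divisors:
  "card (FD.irr j \<inter> irreducible_divisors M) = num_irred_divisors R j M"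
proof -
  have "FD.irr j \<inter> irreducible_divisors M
      = {P \<in> monic_polys R j. pirreducible (carrier R) P \<and> P pdivides M}"
    unfolding FD.irr_def irreducible_divisors_def poly_degree_def monic_polys_eq by (auto simp: monic_irreducibles_def)
  then show ?thesis by (simp only: num_irred_divisors_def)
qed

text \<open>The distinct primes dividing \<open>M\<close> all occur in the factorisation of its
  monic associate, which has degree \<open>degree M\<close>. This is the room that
  \<open>card_coprime_eq\<close> asks for.\<close>

lemma sum_degree_irreducible_divisors:
  assumes M: "M \<in> carrier (poly_ring R)" "M \<noteq> []"
  shows "finite (irreducible_divisors M)" "(\<Sum>p\<in>irreducible_divisors M. poly_degree p) \<le> degree M"
proof -
  obtain M' where M': "is_monic M'" "degree M' = degree M"
    "\<And>f. f \<in> carrier (poly_ring R) \<Longrightarrow> f pdivides M' \<longleftrightarrow> f pdivides M"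
    using monic_associate[OF M] by metis
  obtain \<mu> where \<mu>: "set_mset \<mu> \<subseteq> monic_irreducibles" "mset_prod \<mu> = M'"
    using exists_mset_prod[OF M'(1)] by blast
  have sub: "irreducible_divisors M \<subseteq> set_mset \<mu>"
  proof
    fix p assume "p \<in> irreducible_divisors M"
    then have p: "p \<in> monic_irreducibles" "p pdivides M" by (auto simp: irreducible_divisors_def)
    then have "p pdivides mset_prod \<mu>" using M'(3) \<mu>(2) monic_irreducibles_carrier by blast
    then show "p \<in># \<mu>" using monic_irreducible_divides_mset_prod[OF p(1) \<mu>(1)] by blast
  qed
  show "finite (irreducible_divisors M)" using sub finite_subset by blast
  have "(\<Sum>p\<in>irreducible_divisors M. poly_degree p) \<le> (\<Sum>p\<in>set_mset \<mu>. poly_degree p)"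
    using sub by (intro sum_mono2) auto
  also have "\<dots> \<le> (\<Sum>p\<in>set_mset \<mu>. poly_degree p * count \<mu> p)"
  proof (intro sum_mono)
    fix p assume "p \<in> set_mset \<mu>"
    then have "1 \<le> count \<mu> p" by (simp add: Suc_le_eq)
    then have "poly_degree p * 1 \<le> poly_degree p * count \<mu> p" by (rule mult_le_mono2)
    then show "poly_degree p \<le> poly_degree p * count \<mu> p" by simp
  qed
  also have "\<dots> = FD.mdeg \<mu>" using FD.mdeg_sum_count[of "set_mset \<mu>" \<mu>] by simp
  also have "\<dots> = degree M" using degree_mset_prod[OF \<mu>(1)] \<mu>(2) M'(2) by simp
  finally show "(\<Sum>p\<in>irreducible_divisors M. poly_degree p) \<le> degree M" .
qed

text \<open>Reduction modulo \<open>M\<close> maps monic polynomials of degree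
  \<open>degree M\<close> to residues; it is injective because each class contains exactly one of
  them, and it preserves coprimality to \<open>M\<close>.\<close>

lemma poly_phi_ge:
  assumes M: "M \<in> carrier (poly_ring R)" "M \<noteq> []"
  shows "card {f \<in> FD.monics (degree M). set_mset f \<inter> irreducible_divisors M = {}} \<le> poly_phi R M"
  unfolding poly_phi_def
proof (rule card_inj_on_le[where f = "\<lambda>f. mset_prod f pmod M"])
  let ?S = "{f \<in> FD.monics (degree M). set_mset f \<inter> irreducible_divisors M = {}}"
  have S: "set_mset f \<subseteq> monic_irreducibles" "set_mset f \<subseteq> monic_irreducibles - irreducible_divisors M"
    "mset_prod f \<in> monic_polys R (degree M)" "mset_prod f \<in> carrier (poly_ring R)" if "f \<in> ?S" for f
    using that mset_prod_in_monic_polys[of f "degree M"] mset_prod_carrier[of f] unfolding FD.monics_def by blast+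
  show "inj_on (\<lambda>f. mset_prod f pmod M) ?S"
  proof (rule inj_onI)
    fix f g assume f: "f \<in> ?S" and g: "g \<in> ?S" and eq: "mset_prod f pmod M = mset_prod g pmod M"
    let ?C = "{h \<in> monic_polys R (degree M). poly_cong R h (mset_prod f) M}"
    have "card ?C = card (carrier R) ^ (degree M - degree M)"
      by (rule card_monic_residue_class[OF finite_carrier M S(4)[OF f]]) simp
    then have "card ?C = 1" by simp
    then obtain h where h: "?C = {h}" by (rule card_1_singletonE)
    have "mset_prod f \<in> ?C" "mset_prod g \<in> ?C"
      using S(3)[OF f] S(3)[OF g] eq same_pmod_iff_pdivides[OF carrier_is_subfield S(4)[OF f] S(4)[OF f] M(1)]
        same_pmod_iff_pdivides[OF carrier_is_subfield S(4)[OF g] S(4)[OF f] M(1)]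
      by (simp_all only: mem_Collect_eq poly_cong_def simp_thms)
    then have "mset_prod f = mset_prod g" unfolding h by simp
    then show "f = g" using mset_prod_inj[OF S(1)[OF f] S(1)[OF g]] by blast
  qed
  show "(\<lambda>f. mset_prod f pmod M) ` ?S \<subseteq> {A \<in> carrier (poly_ring R). (A = [] \<or> degree A < degree M) \<and> poly_coprime R A M}"
  proof (rule image_subsetI)
    fix f assume f: "f \<in> ?S"
    let ?r = "mset_prod f pmod M" and ?u = "mset_prod f pdiv M"
    have c: "?r \<in> carrier (poly_ring R)" "?u \<in> carrier (poly_ring R)"
      using long_division_closed[OF carrier_is_subfield S(4)[OF f] M(1)] by blast+
    have "poly_coprime R ?r M"
      unfolding poly_coprime_iff[OF c(1) M]
    proof (intro ballI notI)
      fix p assume p: "p \<in> monic_irreducibles" "p pdivides ?r \<and> p pdivides M"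
      have pc: "p \<in> carrier (poly_ring R)" using p monic_irreducibles_carrier by blast
      have "p pdivides ((?u \<otimes>\<^bsub>poly_ring R\<^esub> M) \<oplus>\<^bsub>poly_ring R\<^esub> ?r)"
        using p c M by (intro pdivides_add[OF pc] pdivides_mult[OF pc M(1)]) auto
      also have "(?u \<otimes>\<^bsub>poly_ring R\<^esub> M) \<oplus>\<^bsub>poly_ring R\<^esub> ?r = mset_prod f"
        using pdiv_pmod[OF carrier_is_subfield S(4)[OF f] M(1)] UP.m_comm[OF c(2) M(1)] by simp
      finally have "p \<in># f" using monic_irreducible_divides_mset_prod[OF p(1) S(1)[OF f]] by blast
      then show False using S(2)[OF f] p by (auto simp: irreducible_divisors_def)
    qed
    then show "?r \<in> {A \<in> carrier (poly_ring R). (A = [] \<or> degree A < degree M) \<and> poly_coprime R A M}"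
      using c(1) pmod_degree[OF carrier_is_subfield S(4)[OF f] M] by blast
  qed
  show "finite {A \<in> carrier (poly_ring R). (A = [] \<or> degree A < degree M) \<and> poly_coprime R A M}"
  proof (rule finite_subset)
    show "{A \<in> carrier (poly_ring R). (A = [] \<or> degree A < degree M) \<and> poly_coprime R A M}
        \<subseteq> {as. set as \<subseteq> carrier R \<and> length as \<le> length M}"
      by (auto simp: univ_poly_carrier[symmetric] polynomial_def)
    show "finite {as. set as \<subseteq> carrier R \<and> length as \<le> length M}"
      by (rule finite_lists_length_le[OF finite_carrier])
  qed
qed

lemma card_product_set_le_mult_table:
  "card (FD.product_set n (residue_class A1 M1) (residue_class A2 M2)) \<le> card (mult_table R n A1 A2 M1 M2)"
proof (rule card_inj_on_le[where f = mset_prod])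
  let ?Z = "FD.product_set n (residue_class A1 M1) (residue_class A2 M2)"
  have Z: "set_mset f \<subseteq> monic_irreducibles" if "f \<in> ?Z" for f
    using that unfolding FD.product_set_def residue_class_def by auto
  show "inj_on mset_prod ?Z" using mset_prod_inj Z by (intro inj_onI) blast
  show "mset_prod ` ?Z \<subseteq> mult_table R n A1 A2 M1 M2"
  proof (rule image_subsetI)
    fix f assume "f \<in> ?Z"
    then obtain f1 f2 where f: "f = f1 + f2" "f1 \<in> residue_class A1 M1" "f2 \<in> residue_class A2 M2"
      "FD.mdeg f1 = n" "FD.mdeg f2 = n" unfolding FD.product_set_def by blast
    then have I: "set_mset f1 \<subseteq> monic_irreducibles" "set_mset f2 \<subseteq> monic_irreducibles"
      and cong: "poly_cong R (mset_prod f1) A1 M1" "poly_cong R (mset_prod f2) A2 M2"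
      by (auto simp: residue_class_def)
    then have "f1 \<in> FD.monics n" "f2 \<in> FD.monics n" using f(4,5) unfolding FD.monics_def by blast+
    then have "mset_prod f1 \<in> monic_polys R n" "mset_prod f2 \<in> monic_polys R n"
      using mset_prod_in_monic_polys by blast+
    moreover have "mset_prod f = mset_prod f1 \<otimes>\<^bsub>poly_ring R\<^esub> mset_prod f2"
      unfolding f(1) using I monic_irreducibles_carrier by (intro mset_prod_union) blast+
    ultimately show "mset_prod f \<in> mult_table R n A1 A2 M1 M2"
      unfolding mult_table_def using cong by blast
  qed
  show "finite (mult_table R n A1 A2 M1 M2)"
  proof (rule finite_subset)
    show "mult_table R n A1 A2 M1 M2 \<subseteq> monic_polys R (n + n)"
    proof
      fix f assume "f \<in> mult_table R n A1 A2 M1 M2"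
      then obtain g h where gh: "f = g \<otimes>\<^bsub>poly_ring R\<^esub> h" "g \<in> monic_polys R n" "h \<in> monic_polys R n"
        unfolding mult_table_def by blast
      then have "is_monic g" "degree g = n" "is_monic h" "degree h = n" unfolding monic_polys_eq by blast+
      then have "is_monic f" "degree f = n + n" using is_monic_mult[of g h] gh(1) by (simp_all only:)
      then show "f \<in> monic_polys R (n + n)" unfolding monic_polys_eq by blast
    qed
    show "finite (monic_polys R (n + n))" by (rule card_monic_polys(1)[OF finite_carrier])
  qed
qed

text \<open>Below \<open>26 * 2 ^ (i0 + 3)\<close> no block is available. There the trivial bound
  loses at most \<open>2 ^ (52 * 2 ^ (i0 + 3))\<close>, a constant that depends on \<open>i0\<close>
  only and not on \<open>q\<close>; the denominator is at least 1.\<close>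

lemma mult_table_lower:
  fixes \<epsilon> C :: real
  assumes A1: "A1 \<in> carrier (poly_ring R)" and A2: "A2 \<in> carrier (poly_ring R)"
    and M1: "M1 \<in> carrier (poly_ring R)" "M1 \<noteq> []" and M2: "M2 \<in> carrier (poly_ring R)" "M2 \<noteq> []"
    and cop: "poly_coprime R A1 M1" "poly_coprime R A2 M2"
    and \<epsilon>: "0 < \<epsilon>" "\<epsilon> \<le> 1" and C: "C \<ge> 0"
    and P1: "\<And>j. j \<ge> 1 \<Longrightarrow> real (num_irred_divisors R j M1) \<le> C * (real (card (carrier R)) ^ j / real j powr (1 + \<epsilon>))"
    and P2: "\<And>j. j \<ge> 1 \<Longrightarrow> real (num_irred_divisors R j M2) \<le> C * (real (card (carrier R)) ^ j / real j powr (1 + \<epsilon>))"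
    and i0: "i0 \<ge> 1" "(10 + 4 * C) * (2 powr (-\<epsilon>)) ^ i0 / (1 - 2 powr (-\<epsilon>)) \<le> 1 / 4"
    and n: "n \<ge> 1" and m: "4 * degree M1 \<le> n" "4 * degree M2 \<le> n"
  shows "real (card (mult_table R n A1 A2 M1 M2)) \<ge> min (large_const i0 / 2 ^ 104) (1 / 2 ^ (52 * 2 ^ (i0 + 3)))
      * (real (card (carrier R)) ^ (2 * n - degree M1 - degree M2) / (real n powr ford_delta * (1 + ln (real n)) powr (3 / 2)))"
proof -
  let ?q = "card (carrier R)"
  let ?N = "real ?q ^ (2 * n - degree M1 - degree M2)" and ?D = "real n powr ford_delta * (1 + ln (real n)) powr (3 / 2)"
  let ?Z = "FD.product_set n (residue_class A1 M1) (residue_class A2 M2)"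
  have R1: "FD.equidistributed (residue_class A1 M1) (degree M1) (irreducible_divisors M1)"
    by (rule equidistributed_residue_class[OF A1 M1 cop(1)])
  have R2: "FD.equidistributed (residue_class A2 M2) (degree M2) (irreducible_divisors M2)"
    by (rule equidistributed_residue_class[OF A2 M2 cop(2)])
  have D: "?D \<ge> 1"
  proof -
    have "1 \<le> real n powr ford_delta" using n ford_delta_nonneg by (intro ge_one_powr_ge_zero) auto
    moreover have "1 \<le> (1 + ln (real n)) powr (3 / 2)" using n by (intro ge_one_powr_ge_zero) auto
    ultimately have "1 * 1 \<le> ?D" by (intro mult_mono) auto
    then show ?thesis by simp
  qed
  have ND: "0 \<le> ?N / ?D" by (intro divide_nonneg_nonneg) (use D in linarith | simp)+
  have "min (large_const i0 / 2 ^ 104) (1 / 2 ^ (52 * 2 ^ (i0 + 3))) * (?N / ?D) \<le> real (card ?Z)"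
  proof (cases "26 * 2 ^ (i0 + 3) \<le> n")
    case True
    have "min (large_const i0 / 2 ^ 104) (1 / 2 ^ (52 * 2 ^ (i0 + 3))) * (?N / ?D) \<le> large_const i0 / 2 ^ 104 * (?N / ?D)"
      by (rule mult_right_mono[OF min.cobounded1 ND])
    also have "\<dots> \<le> real (card ?Z)"
      by (rule FD.product_set_asymptotic_lower[OF R1 R2 \<epsilon> C _ _ i0 True m])
        (simp_all only: card_irr_Int_irreducible_divisors P1 P2)
    finally show ?thesis .
  next
    case False
    have "min (large_const i0 / 2 ^ 104) (1 / 2 ^ (52 * 2 ^ (i0 + 3))) * (?N / ?D) \<le> 1 / 2 ^ (52 * 2 ^ (i0 + 3)) * (?N / ?D)"
      by (rule mult_right_mono[OF min.cobounded2 ND])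
    also have "\<dots> \<le> 1 / 2 ^ (2 * n) * ?N"
    proof (rule mult_mono)
      have "2 * n \<le> 52 * 2 ^ (i0 + 3)" using False by simp
      then have "(2::real) ^ (2 * n) \<le> 2 ^ (52 * 2 ^ (i0 + 3))" by (rule power_increasing) simp
      then show "1 / 2 ^ (52 * 2 ^ (i0 + 3)) \<le> 1 / (2::real) ^ (2 * n)" by (rule frac_le[rotated 3]) auto
      have "?N / ?D \<le> ?N / 1" using D by (rule frac_le[rotated 3]) auto
      then show "?N / ?D \<le> ?N" by simp
    qed (use ND in auto)
    also have "\<dots> \<le> real (card ?Z)"
    proof -
      have "?N \<le> 2 ^ (2 * n) * real (card ?Z)"
        by (rule FD.product_set_trivial_lower[OF R1 R2]) (use m in linarith)+
      then have "?N / 2 ^ (2 * n) \<le> real (card ?Z)" by (intro mult_imp_div_pos_le) (simp_all add: mult.commute)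
      then show ?thesis by simp
    qed
    finally show ?thesis .
  qed
  also have "\<dots> \<le> real (card (mult_table R n A1 A2 M1 M2))"
    by (rule of_nat_mono[OF card_product_set_le_mult_table])
  finally show ?thesis .
qed

lemma poly_phi_lower:
  fixes \<epsilon> C :: real
  assumes M: "M \<in> carrier (poly_ring R)" "M \<noteq> []" and \<epsilon>: "0 < \<epsilon>" and C: "C \<ge> 0"
    and P: "\<And>j. j \<ge> 1 \<Longrightarrow> real (num_irred_divisors R j M) \<le> C * (real (card (carrier R)) ^ j / real j powr (1 + \<epsilon>))"
  shows "real (poly_phi R M) \<ge> exp (- 2 * C * (1 + 1 / (1 - 2 powr (-\<epsilon>)))) * real (card (carrier R)) ^ degree M"
proof -
  have "exp (- 2 * C * (1 + 1 / (1 - 2 powr (-\<epsilon>)))) * real (card (carrier R)) ^ degree M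
      \<le> real (card {f \<in> FD.monics (degree M). set_mset f \<inter> irreducible_divisors M = {}})"
    by (rule FD.card_coprime_ge[OF sum_degree_irreducible_divisors(1)[OF M] _ sum_degree_irreducible_divisors(2)[OF M] \<epsilon> C])
      (simp_all only: card_irr_Int_irreducible_divisors P, auto simp: irreducible_divisors_def)
  also have "\<dots> \<le> real (poly_phi R M)" by (rule of_nat_mono[OF poly_phi_ge[OF M]])
  finally show ?thesis .
qed

end

section \<open>The theorem: choice of the constants\<close>

lemma poly_coprime_lcm:
  assumes "field F" and "M1 \<in> carrier (poly_ring F)"
    and "M lcmof\<^bsub>poly_ring F\<^esub> M1 M2" and "poly_coprime F A M"
  shows "poly_coprime F A M1"
proof -
  interpret field F by fact
  interpret UP: principal_domain "poly_ring F"
    by (rule univ_poly_is_principal[OF carrier_is_subfield])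
  have "M1 divides\<^bsub>poly_ring F\<^esub> M" using assms(3) by (simp add: islcm_def)
  then show ?thesis
    using assms(4) UP.divides_trans UP.unit_divides[OF UP.Units_one_closed assms(2)]
    unfolding poly_coprime_def isgcd_def by blast
qed

lemma lcmof_commute: "M lcmof\<^bsub>G\<^esub> M1 M2 \<Longrightarrow> M lcmof\<^bsub>G\<^esub> M2 M1"
  by (auto simp: islcm_def)

theorem theorem1p5:
  fixes \<epsilon> C :: real
  assumes "\<epsilon> > 0" and "C > 0"
  shows "\<exists>c X0 :: real. c > 0 \<and>
    (\<forall>(F :: nat ring) (q :: nat) (n :: nat) (b :: nat) M1 M2 M A1 A2.
       field F \<and> finite (carrier F) \<and> card (carrier F) = q \<and>
       n \<ge> 2 \<and> 1 \<le> b \<and> real b \<le> real n / 2 \<and>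
       M1 \<in> carrier (poly_ring F) \<and> M2 \<in> carrier (poly_ring F) \<and>
       A1 \<in> carrier (poly_ring F) \<and> A2 \<in> carrier (poly_ring F) \<and>
       M1 \<noteq> \<zero>\<^bsub>poly_ring F\<^esub> \<and> M2 \<noteq> \<zero>\<^bsub>poly_ring F\<^esub> \<and>
       M \<in> carrier (poly_ring F) \<and> M lcmof\<^bsub>poly_ring F\<^esub> M1 M2 \<and>
       poly_coprime F A1 M \<and> poly_coprime F A2 M \<and>
       real (Polynomials.degree M1) \<le> (1/2 - \<epsilon>) * real b \<and>
       real (Polynomials.degree M2) \<le> (1/2 - \<epsilon>) * real b \<and>
       (\<forall>j\<ge>1. real (num_irred_divisors F j M1) \<le> C * (real q ^ j / real j powr (1 + \<epsilon>))) \<and>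
       (\<forall>j\<ge>1. real (num_irred_divisors F j M2) \<le> C * (real q ^ j / real j powr (1 + \<epsilon>))) \<and>
       real q ^ n \<ge> X0
       \<longrightarrow>
       real (card (mult_table F n A1 A2 M1 M2)) \<ge>
         c * (1 / (real (poly_phi F M1) * real (poly_phi F M2))) *
           (real q ^ (2 * n) / (real n powr ford_delta * (1 + ln (real n)) powr (3/2))))"
proof -
  \<comment> \<open>The estimate of the block masses assumes an exponent of at most 1; a smaller
    \<open>\<epsilon>'\<close> weakens the hypotheses on the prime divisors.\<close>
  define \<epsilon>' where "\<epsilon>' = min \<epsilon> 1"
  define \<rho> where "\<rho> = 2 powr (-\<epsilon>')"
  have \<epsilon>': "0 < \<epsilon>'" "\<epsilon>' \<le> 1" "\<epsilon>' \<le> \<epsilon>" using assms(1) by (auto simp: \<epsilon>'_def)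
  have \<rho>: "0 < \<rho>" "\<rho> < 1" using \<epsilon>' by (auto simp: \<rho>_def powr_less_one)
  \<comment> \<open>\<open>i0\<close> has to make the geometric tail of all defects at most
    \<open>1 / 4\<close>; it depends on \<open>C\<close> and \<open>\<epsilon>\<close> only.\<close>
  obtain k where k: "\<rho> ^ k < (1 - \<rho>) / (4 * (10 + 4 * C))"
    using real_arch_pow_inv[of "(1 - \<rho>) / (4 * (10 + 4 * C))" \<rho>] \<rho> assms(2) by auto
  define i0 where "i0 = Suc k"
  have "\<rho> ^ i0 \<le> \<rho> ^ k" unfolding i0_def using \<rho> by (intro power_decreasing) auto
  then have "\<rho> ^ i0 \<le> (1 - \<rho>) / (4 * (10 + 4 * C))" using k by linarith
  then have "(10 + 4 * C) * \<rho> ^ i0 \<le> (10 + 4 * C) * ((1 - \<rho>) / (4 * (10 + 4 * C)))"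
    using assms(2) by (intro mult_left_mono) auto
  also have "\<dots> = 1 / 4 * (1 - \<rho>)" using assms(2) by (simp add: field_simps)
  finally have i0: "(10 + 4 * C) * \<rho> ^ i0 / (1 - \<rho>) \<le> 1 / 4"
    using \<rho> by (intro mult_imp_div_pos_le) auto
  \<comment> \<open>\<open>\<kappa>\<close> is the constant in
    \<open>\<Phi>(M) \<ge> \<kappa> * q ^ degree M\<close>; it enters the final constant once for
    each modulus.\<close>
  define \<kappa> where "\<kappa> = exp (- 2 * C * (1 + 1 / (1 - \<rho>)))"
  define c0 where "c0 = min (large_const i0 / 2 ^ 104) (1 / 2 ^ (52 * 2 ^ (i0 + 3)))"
  have \<kappa>: "\<kappa> > 0" by (simp add: \<kappa>_def)
  have c0: "c0 > 0" by (simp add: c0_def large_const_def)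
  show ?thesis
  \<comment> \<open>The witness for \<open>X0\<close> is \<open>0\<close>: bounded \<open>n\<close>
    has been absorbed into \<open>c0\<close> by the trivial bound.\<close>
  proof (intro exI[of _ "c0 * (\<kappa> * \<kappa>)"] exI[of _ 0] conjI allI impI; (elim conjE)?)
    show "c0 * (\<kappa> * \<kappa>) > 0" using c0 \<kappa> by simp
    fix F :: "nat ring" and q n b :: nat and M1 M2 M A1 A2 :: "nat list"
    assume F: "field F" "finite (carrier F)" and q: "card (carrier F) = q"
      and n: "n \<ge> 2" and b: "real b \<le> real n / 2"
      and M1: "M1 \<in> carrier (poly_ring F)" and M2: "M2 \<in> carrier (poly_ring F)"
      and A1: "A1 \<in> carrier (poly_ring F)" and A2: "A2 \<in> carrier (poly_ring F)"
      and M10: "M1 \<noteq> \<zero>\<^bsub>poly_ring F\<^esub>" and M20: "M2 \<noteq> \<zero>\<^bsub>poly_ring F\<^esub>"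
      and lcm: "M lcmof\<^bsub>poly_ring F\<^esub> M1 M2"
      and cop1: "poly_coprime F A1 M" and cop2: "poly_coprime F A2 M"
      and d1: "real (Polynomials.degree M1) \<le> (1/2 - \<epsilon>) * real b"
      and d2: "real (Polynomials.degree M2) \<le> (1/2 - \<epsilon>) * real b"
      and P1: "\<forall>j\<ge>1. real (num_irred_divisors F j M1) \<le> C * (real q ^ j / real j powr (1 + \<epsilon>))"
      and P2: "\<forall>j\<ge>1. real (num_irred_divisors F j M2) \<le> C * (real q ^ j / real j powr (1 + \<epsilon>))"
    interpret FF: finite_field F using F by (intro finite_field.intro finite_field_axioms.intro)
    have weaken: "C * (real q ^ j / real j powr (1 + \<epsilon>)) \<le> C * (real q ^ j / real j powr (1 + \<epsilon>'))" if "j \<ge> 1" for j :: nat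
      using that \<epsilon>' assms(2) by (intro mult_left_mono divide_left_mono powr_mono) auto
    have P1': "real (num_irred_divisors F j M1) \<le> C * (real (card (carrier F)) ^ j / real j powr (1 + \<epsilon>'))" if "j \<ge> 1" for j
      using P1 weaken[OF that] that unfolding q by (meson order_trans)
    have P2': "real (num_irred_divisors F j M2) \<le> C * (real (card (carrier F)) ^ j / real j powr (1 + \<epsilon>'))" if "j \<ge> 1" for j
      using P2 weaken[OF that] that unfolding q by (meson order_trans)
    have M1': "M1 \<noteq> []" and M2': "M2 \<noteq> []" using M10 M20 by (simp_all add: univ_poly_zero)
    \<comment> \<open>Together with \<open>b \<le> n / 2\<close> this bounds the degrees of both
      moduli by \<open>n / 4\<close>, the share reserved for them.\<close>
    have "(1/2 - \<epsilon>) * real b \<le> 1/2 * real b" using assms(1) by (intro mult_right_mono) auto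
    then have "4 * real (Polynomials.degree M1) \<le> real n" "4 * real (Polynomials.degree M2) \<le> real n"
      using d1 d2 b by linarith+
    then have m: "4 * Polynomials.degree M1 \<le> n" "4 * Polynomials.degree M2 \<le> n" by linarith+
    let ?m1 = "Polynomials.degree M1" and ?m2 = "Polynomials.degree M2"
    let ?D = "real n powr ford_delta * (1 + ln (real n)) powr (3 / 2)"
    let ?Q = "\<kappa> * real q ^ ?m1 * (\<kappa> * real q ^ ?m2)"
    have q0: "real q > 0" using FF.FD.q_ge_2 q by simp
    have table: "c0 * (real q ^ (2 * n - ?m1 - ?m2) / ?D) \<le> real (card (mult_table F n A1 A2 M1 M2))"
      using FF.mult_table_lower[OF A1 A2 M1 M1' M2 M2' poly_coprime_lcm[OF F(1) M1 lcm cop1]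
          poly_coprime_lcm[OF F(1) M2 lcmof_commute[OF lcm] cop2] \<epsilon>'(1,2) _ P1' P2' _ i0[unfolded \<rho>_def] _ m] assms(2) n
      unfolding q c0_def by (simp add: i0_def)
    have phi1: "\<kappa> * real q ^ ?m1 \<le> real (poly_phi F M1)"
      using FF.poly_phi_lower[OF M1 M1' \<epsilon>'(1) _ P1'] assms(2) unfolding q \<kappa>_def \<rho>_def by simp
    have phi2: "\<kappa> * real q ^ ?m2 \<le> real (poly_phi F M2)"
      using FF.poly_phi_lower[OF M2 M2' \<epsilon>'(1) _ P2'] assms(2) unfolding q \<kappa>_def \<rho>_def by simp
    have Q0: "?Q > 0" using \<kappa> q0 by simp
    have "?Q \<le> real (poly_phi F M1) * real (poly_phi F M2)"
      using phi1 phi2 \<kappa> q0 by (intro mult_mono) auto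
    then have "1 / (real (poly_phi F M1) * real (poly_phi F M2)) \<le> 1 / ?Q"
      using Q0 by (intro frac_le) auto
    then have "c0 * (\<kappa> * \<kappa>) * (1 / (real (poly_phi F M1) * real (poly_phi F M2))) * (real q ^ (2 * n) / ?D)
        \<le> c0 * (\<kappa> * \<kappa>) * (1 / ?Q) * (real q ^ (2 * n) / ?D)"
      using c0 \<kappa> q0 by (intro mult_right_mono mult_left_mono) auto
    also have "\<dots> = c0 * (real q ^ (2 * n - ?m1 - ?m2) / ?D)"
    proof -
      have "2 * n = (2 * n - ?m1 - ?m2) + ?m1 + ?m2" using m by linarith
      then have split: "real q ^ (2 * n) = real q ^ (2 * n - ?m1 - ?m2) * real q ^ ?m1 * real q ^ ?m2"
        by (metis power_add)
      have "c0 * (k' * k') * (1 / (k' * x * (k' * y))) * (z * x * y / w) = c0 * (z / w)"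
        if "k' > 0" "x > 0" "y > 0" for k' x y z w :: real
        using that by simp
      from this[of \<kappa> "real q ^ ?m1" "real q ^ ?m2"] show ?thesis
        unfolding split using \<kappa> q0 by simp
    qed
    also note table
    finally show "real (card (mult_table F n A1 A2 M1 M2)) \<ge>
         c0 * (\<kappa> * \<kappa>) * (1 / (real (poly_phi F M1) * real (poly_phi F M2))) *
           (real q ^ (2 * n) / (real n powr ford_delta * (1 + ln (real n)) powr (3/2)))" .
  qed
qed

end
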